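(* Up to affine transformations of $x$ and re-scaling of $t$ by a positive factor, the following list consists of exactly the non-trivial free Meixner systems. In each case $\{P_n(x,t)\}_{n\ge 0}$ (with $P_0=1$, $P_{-1}=0$) is the system of monic orthogonal polynomials of the free convolution semigroup $\{\mu_t\}$, and there is a formal power series $u\in\mathcal P_{0,1}$ with \[ \sum_{n=0}^\infty P_n(x,t) z^n=\frac{1}{u(z)\,(K_t(u(z))-x)}=\frac{1}{1+t\,u(z)R_\mu(u(z))-u(z)x}. \] The cases are: \begin{itemize} \item (Semicircular / Chebyshev) $P_{n+1}(x,t)=xP_n(x,t)-tP_{n-1}(x,t)$ for $n\ge0$; $P_n(x,t)=U_n(x,t)$; $\mu_t=\sigma_t=\sigma_{0,t}$; $u(z)=z$, $R_\mu(z)=z$. \item (Free Poisson / Charlier) $P_1(x,t)=x-t$ and $P_{n+1}(x,t)=(x-(t+1))P_n(x,t)-tP_{n-1}(x,t)$ for $n\ge1$; $P_n(x,t)=Q_n(x,t)+Q_{n-1}(x,t)$ for $n\ge1$, where $Q_n(x,t)=U_n(x-(t+1),t)$; $\mu_t(dx)=\frac{t}{x}\sigma_{1+t,t}(dx)+\max(1-t,0)\delta_0$; $u(z)=\frac{z}{1+z}$, $R_\mu(z)=\frac{1}{1-z}$. \item In the remaining three cases there is a parameter $a\ge0$, and with $\alpha(t)=a(t+2)$, $\beta(t)=t+1$: $P_1(x,t)=x-at$, $P_2(x,t)=(x-a(t+2))P_1(x,t)-tP_0(x,t)$, and $P_{n+1}(x,t)=(x-a(t+2))P_n(x,t)-(t+1)P_{n-1}(x,t)$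 for $n\ge2$. Moreover $P_1=Q_1+2aQ_0$ and $P_n=Q_n+2aQ_{n-1}+Q_{n-2}$ for $n\ge2$, where $Q_n(x,t)=U_n(x-\alpha(t),\beta(t))$; $u(z)=\frac{z}{1+2az+z^2}$ and $R_\mu(z)=\frac{z^{-1}-\sqrt{(2a-z^{-1})^2-4}}{2}$. The semigroups are: \begin{itemize} \item (Continuous binomial / Meixner–Pollaczek) $0\le a<1$: $\mu_t(dx)=\frac{t\beta(t)}{x^2+t^2(1-a^2)}\sigma_{\alpha(t),\beta(t)}(dx)$. \item (Gamma / Laguerre) $a=1$: $\mu_t(dx)=\frac{t(1+t)}{x^2}\sigma_{2+t,1+t}(dx)$. \item (Negative binomial / Meixner) $a>1$: $\mu_t(dx)=\frac{t\beta(t)}{x^2-t^2(a^2-1)}\sigma_{\alpha(t),\beta(t)}(dx)+\max\Bigl(1-t\frac{a-\sqrt{a^2-1}}{2\sqrt{a^2-1}},0\Bigr)\delta_{t\sqrt{a^2-1}}$. \end{itemize} \end{itemize}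
   Context: Free probability setup. For a linear functional $\nu$ on $\mathbb C[x]$ with $\langle\nu,1\rangle=1$, $G_\nu(z)=\sum_{n\ge0}\langle\nu,x^n\rangle z^{-(n+1)}$ is its Cauchy transform (a formal series in $z^{-1}$, or an analytic function off $\mathbb R$ for measures), $K_\nu$ its compositional inverse, of the form $K_\nu(z)=\frac1z+\sum_{n\ge1}r_n(\nu)z^{n-1}$ ($r_n$ = free cumulants), and $R_\nu(z)=K_\nu(z)-\frac1z$ its $R$-transform; free convolution $\boxplus$ is characterized by $R_{\mu\boxplus\nu}=R_\mu+R_\nu$. A freely infinitely divisible probability measure $\mu$ with finite moments of all orders gives a free convolution semigroup $\{\mu_t\}_{t\ge0}$ of probability measures with $\mu_0=\delta_0$, $\mu_1=\mu$, $R_{\mu_t}=tR_\mu$; write $K_t=K_{\mu_t}=\frac1z+tR_\mu(z)$. $\mathcal P_{0,1}$ denotes formal power series $u(z)$ with $u(0)=0$, $u'(0)=1$. For $u,v\in\mathcal P_{0,1}$, the polynomials $Q_n(x,t)$ defined by $\frac{1}{u(z)(K_t(v(z))-x)}=\sum_{n\ge0}Q_n(x,t)z^n$ form a generalized free Sheffer system for $\{\mu_t\}$. A free Meixner system is a family $\{P_n(x,t)\}$ such that for each $t$, $\{P_n(\cdot,t)\}$ are the monic orthogonal polynomials of $\mu_t$, and which is a generalized free Sheffer system for $\{\mu_t\}$; non-trivial means $\mu_1$ has nonzero variance. Semicircular distribution with mean $\alpha$ and variance $\beta$: $\sigma_{\alpha,\beta}(dx)=\frac{1}{2\pi\beta}\sqrt{4\beta-(x-\alpha)^2}\,\mathbf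 1_{[\alpha-2\sqrt\beta,\alpha+2\sqrt\beta]}(x)\,dx$, $\sigma_t=\sigma_{0,t}$. Chebyshev polynomials of the second kind: $U_n(2\cos\theta)=\frac{\sin(n+1)\theta}{\sin\theta}$, $U_n(x,t)=t^{n/2}U_n(x/\sqrt t)$, and $U_n(x-\alpha,\beta)$ means $U_n(\cdot,\beta)$ evaluated at $x-\alpha$. *)

theory Defs
  imports "HOL-Probability.Probability" "HOL-Computational_Algebra.Computational_Algebra"
begin

definition moment :: "real measure \<Rightarrow> nat \<Rightarrow> real" where
  "moment M n = (\<integral>x. x ^ n \<partial>M)"

definition finite_moments :: "real measure \<Rightarrow> bool" where
  "finite_moments M \<longleftrightarrow> (\<forall>n. integrable M (\<lambda>x. x ^ n))"

definition variance_of :: "real measure \<Rightarrow> real" where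
  "variance_of M = moment M 2 - (moment M 1)\<^sup>2"

text \<open>The Cauchy transform G(z) = sum m_n z^{-(n+1)} written in the variable w = 1/z:
  g(w) = G(1/w) = sum m_n w^{n+1}, an element of P_{0,1}.\<close>
definition cauchy_fps :: "real measure \<Rightarrow> real fps" where
  "cauchy_fps M = fps_X * Abs_fps (moment M)"

text \<open>K = compositional inverse of G.  In the variable w = 1/z the compositional inverse
  of g is k = fps_inv g and K(z) = 1 / k(z).  Writing k = z h with h(0) = 1 we have
  K(z) = 1/z * (1/h(z)), hence R(z) = K(z) - 1/z = (1/h(z) - 1)/z.\<close>
definition R_transform :: "real measure \<Rightarrow> real fps" where
  "R_transform M = fps_shift 1 (inverse (fps_shift 1 (fps_inv (cauchy_fps M))))"

definition free_cumulant :: "real measure \<Rightarrow> nat \<Rightarrow> real" where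
  "free_cumulant M n = R_transform M $ (n - 1)"

definition free_conv_semigroup :: "(real \<Rightarrow> real measure) \<Rightarrow> bool" where
  "free_conv_semigroup mu \<longleftrightarrow>
     (\<forall>t\<ge>0. prob_space (mu t) \<and> sets (mu t) = sets borel \<and> finite_moments (mu t)) \<and>
     mu 0 = return borel 0 \<and>
     (\<forall>t\<ge>0. R_transform (mu t) = fps_const t * R_transform (mu 1))"

definition P01 :: "real fps \<Rightarrow> bool" where
  "P01 u \<longleftrightarrow> u $ 0 = 0 \<and> u $ 1 = 1"

text \<open>u(z) (K_t(v(z)) - x) with K_t(z) = 1/z + t R(z); u(z)/v(z) is a genuine power series.\<close>
definition sheffer_denom :: "real fps \<Rightarrow> real fps \<Rightarrow> real fps \<Rightarrow> real \<Rightarrow> real \<Rightarrow> real fps" where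
  "sheffer_denom u v R t x = u / v + fps_const t * u * (R oo v) - fps_const x * u"

definition gen_free_sheffer :: "(real \<Rightarrow> real measure) \<Rightarrow> (nat \<Rightarrow> real \<Rightarrow> real \<Rightarrow> real) \<Rightarrow> bool" where
  "gen_free_sheffer mu P \<longleftrightarrow>
     (\<exists>u v. P01 u \<and> P01 v \<and>
        (\<forall>t\<ge>0. \<forall>x. Abs_fps (\<lambda>n. P n x t) = inverse (sheffer_denom u v (R_transform (mu 1)) t x)))"

definition monic_OPS :: "real measure \<Rightarrow> (nat \<Rightarrow> real \<Rightarrow> real) \<Rightarrow> bool" where
  "monic_OPS M p \<longleftrightarrow>
     (\<forall>n. \<exists>q :: real poly. degree q = n \<and> lead_coeff q = 1 \<and> (\<forall>x. p n x = poly q x)) \<and>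
     (\<forall>m n. m \<noteq> n \<longrightarrow> (\<integral>x. p m x * p n x \<partial>M) = 0)"

definition free_meixner :: "(real \<Rightarrow> real measure) \<Rightarrow> (nat \<Rightarrow> real \<Rightarrow> real \<Rightarrow> real) \<Rightarrow> bool" where
  "free_meixner mu P \<longleftrightarrow> free_conv_semigroup mu \<and>
     (\<forall>t\<ge>0. monic_OPS (mu t) (\<lambda>n x. P n x t)) \<and> gen_free_sheffer mu P"

definition nontrivial_free_meixner where
  "nontrivial_free_meixner mu P \<longleftrightarrow> free_meixner mu P \<and> variance_of (mu 1) \<noteq> 0"

text \<open>Equivalence up to an affine change of x (x |-> c x + d t, which maps semigroups to
  semigroups) and a rescaling t |-> s t of time, s > 0.\<close>
definition affine_time_equiv ::
  "(real \<Rightarrow> real measure) \<Rightarrow> (nat \<Rightarrow> real \<Rightarrow> real \<Rightarrow> real) \<Rightarrow>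
   (real \<Rightarrow> real measure) \<Rightarrow> (nat \<Rightarrow> real \<Rightarrow> real \<Rightarrow> real) \<Rightarrow> bool" where
  "affine_time_equiv mu P mu' P' \<longleftrightarrow>
     (\<exists>c d s. c \<noteq> 0 \<and> s > 0 \<and>
        (\<forall>t\<ge>0. mu' t = distr (mu (s * t)) borel (\<lambda>x. c * x + d * t) \<and>
                (\<forall>n x. P' n x t = c ^ n * P n ((x - d * t) / c) (s * t))))"

definition add_measure :: "'a measure \<Rightarrow> 'a measure \<Rightarrow> 'a measure" where
  "add_measure M N = measure_of (space M) (sets M) (\<lambda>A. emeasure M A + emeasure N A)"

definition scale_density :: "(real \<Rightarrow> real) \<Rightarrow> real measure \<Rightarrow> real measure" where
  "scale_density f M = density M (\<lambda>x. ennreal (f x))"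

definition semicircle :: "real \<Rightarrow> real \<Rightarrow> real measure" where
  "semicircle \<alpha> \<beta> = (if \<beta> = 0 then return borel \<alpha> else
     density lborel (\<lambda>x. ennreal (indicator {\<alpha> - 2 * sqrt \<beta> .. \<alpha> + 2 * sqrt \<beta>} x *
        sqrt (4 * \<beta> - (x - \<alpha>)\<^sup>2) / (2 * pi * \<beta>))))"

definition chebU :: "nat \<Rightarrow> real poly" where
  "chebU n = (THE p. \<forall>\<theta>. sin \<theta> \<noteq> 0 \<longrightarrow> poly p (2 * cos \<theta>) = sin (real (Suc n) * \<theta>) / sin \<theta>)"

text \<open>U_n(x,t) = t^{n/2} U_n(x / sqrt t), written out as a polynomial in x and t
  (only monomials with n - k even occur), so that it also makes sense at t = 0.\<close>
definition chebU2 :: "nat \<Rightarrow> real \<Rightarrow> real \<Rightarrow> real" where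
  "chebU2 n x t = (\<Sum>k\<le>n. coeff (chebU n) k * x ^ k * sqrt t ^ (n - k))"

fun P_semi :: "nat \<Rightarrow> real \<Rightarrow> real \<Rightarrow> real" where
  "P_semi 0 x t = 1"
| "P_semi (Suc 0) x t = x"
| "P_semi (Suc (Suc n)) x t = x * P_semi (Suc n) x t - t * P_semi n x t"

definition mu_semi :: "real \<Rightarrow> real measure" where
  "mu_semi t = semicircle 0 t"

definition u_semi :: "real fps" where "u_semi = fps_X"
definition R_semi :: "real fps" where "R_semi = fps_X"

fun P_poi :: "nat \<Rightarrow> real \<Rightarrow> real \<Rightarrow> real" where
  "P_poi 0 x t = 1"
| "P_poi (Suc 0) x t = x - t"
| "P_poi (Suc (Suc n)) x t = (x - (t + 1)) * P_poi (Suc n) x t - t * P_poi n x t"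

definition Q_poi :: "nat \<Rightarrow> real \<Rightarrow> real \<Rightarrow> real" where
  "Q_poi n x t = chebU2 n (x - (t + 1)) t"

definition mu_poi :: "real \<Rightarrow> real measure" where
  "mu_poi t = add_measure (scale_density (\<lambda>x. t / x) (semicircle (1 + t) t))
                          (scale_density (\<lambda>_. max (1 - t) 0) (return borel 0))"

definition u_poi :: "real fps" where "u_poi = fps_X * inverse (1 + fps_X)"
definition R_poi :: "real fps" where "R_poi = inverse (1 - fps_X)"

definition alpha3 :: "real \<Rightarrow> real \<Rightarrow> real" where "alpha3 a t = a * (t + 2)"
definition beta3 :: "real \<Rightarrow> real" where "beta3 t = t + 1"

fun P3 :: "real \<Rightarrow> nat \<Rightarrow> real \<Rightarrow> real \<Rightarrow> real" where
  "P3 a 0 x t = 1"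
| "P3 a (Suc 0) x t = x - a * t"
| "P3 a (Suc (Suc 0)) x t = (x - a * (t + 2)) * P3 a (Suc 0) x t - t * P3 a 0 x t"
| "P3 a (Suc (Suc (Suc n))) x t =
     (x - a * (t + 2)) * P3 a (Suc (Suc n)) x t - (t + 1) * P3 a (Suc n) x t"

definition Q3 :: "real \<Rightarrow> nat \<Rightarrow> real \<Rightarrow> real \<Rightarrow> real" where
  "Q3 a n x t = chebU2 n (x - alpha3 a t) (beta3 t)"

definition u3 :: "real \<Rightarrow> real fps" where
  "u3 a = fps_X * inverse (1 + fps_const (2 * a) * fps_X + fps_X ^ 2)"

text \<open>R(z) = (z^{-1} - sqrt((2a - z^{-1})^2 - 4))/2
         = (1 - sqrt(1 - 4 a z + 4 (a^2 - 1) z^2)) / (2 z),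
  the square root being the formal power series with constant term 1.\<close>
definition R3 :: "real \<Rightarrow> real fps" where
  "R3 a = fps_shift 1 (fps_const (1/2) * (1 - fps_radical (\<lambda>k y. root k y) 2
            (1 - fps_const (4 * a) * fps_X + fps_const (4 * (a\<^sup>2 - 1)) * fps_X ^ 2)))"

definition mu3 :: "real \<Rightarrow> real \<Rightarrow> real measure" where
  "mu3 a t = (if t = 0 then return borel 0
     else if a < 1 then
       scale_density (\<lambda>x. t * beta3 t / (x\<^sup>2 + t\<^sup>2 * (1 - a\<^sup>2))) (semicircle (alpha3 a t) (beta3 t))
     else if a = 1 then
       scale_density (\<lambda>x. t * (1 + t) / x\<^sup>2) (semicircle (2 + t) (1 + t))
     else
       add_measure
         (scale_density (\<lambda>x. t * beta3 t / (x\<^sup>2 - t\<^sup>2 * (a\<^sup>2 - 1))) (semicircle (alpha3 a t) (beta3 t)))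
         (scale_density (\<lambda>_. max (1 - t * (a - sqrt (a\<^sup>2 - 1)) / (2 * sqrt (a\<^sup>2 - 1))) 0)
            (return borel (t * sqrt (a\<^sup>2 - 1)))))"

definition listed_props :: "(real \<Rightarrow> real measure) \<Rightarrow> (nat \<Rightarrow> real \<Rightarrow> real \<Rightarrow> real) \<Rightarrow> real fps \<Rightarrow> real fps \<Rightarrow> bool" where
  "listed_props mu P u R \<longleftrightarrow>
     nontrivial_free_meixner mu P \<and> P01 u \<and> R_transform (mu 1) = R \<and>
     (\<forall>t\<ge>0. \<forall>x. Abs_fps (\<lambda>n. P n x t) = inverse (sheffer_denom u u R t x) \<and>
                 sheffer_denom u u R t x = 1 + fps_const t * u * (R oo u) - fps_const x * u)"

end

(* Every system involved has the generating function
   (1 + e z + d z^2) / (1 + (e + r t - x) z + (d + v t) z^2), the image of 1 / (1 + t u R(u) - u x)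
   under u = z / (1 + e z + d z^2) and R(u(z)) = r + v z; an affine change of x and a rescaling of t
   act on the parameters (e, d, r, v) and reduce them to (0, 0, 0, 1), (1, 0, 1, 1) or
   (2 a, 1, a, 1).

   The listed measures are semicircle laws divided by a polynomial D of degree at most two, plus an
   atom at a zero of D. Since D times a Chebyshev polynomial is a short combination of the
   P n, the functional p -> integral of D p being a multiple of the semicircle law propagates
   the vanishing of the integrals of the P n from small n to all n. By Favard's argument this gives
   orthogonality, and through the generating function the R-transform.

   Conversely, at t = 0 the generating function forces u = v; comparing coefficients expresses
   x P n linearly in P (n+1), ..., P 0, and orthogonality to P 0 and P 1 leaves only the
   parameters (e, d, r, v). The measures are then identified because a measure of bounded support
   is determined by its moments. *)

theory Submission
  imports Defs "HOL-Real_Asymp.Real_Asymp"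
begin

unbundle no vec_syntax

section \<open>Free Meixner polynomials and their generating function\<close>

text \<open>Here \<open>r t\<close> and \<open>v t\<close> are the mean and the variance at time
  \<open>t\<close>, while \<open>e\<close> and \<open>d\<close> are the coefficients of z / u and do
  not involve time. On the constructive side everything is read off from single integrals: each
  polynomial of positive index integrates to 0. Multiplying a law by D loses information: the total
  mass stays undetermined for D = x, the total mass and the mean for the quadratic D. Supplying
  these values is the analytic core. Where D has simple real zeros, they are Stieltjes transforms of
  the semicircle law at points on or to the left of the edge of its support, and the atom carries
  exactly the missing mass. Where the zeros are complex or double, a growth argument forces them. In
  the converse, a negative \<open>d\<close> is impossible because the squared norm of P 2 is (d + v
  t) v t, which would be negative for small t. A translation proportional to t absorbs
  \<open>r\<close>, a rescaling of time normalises \<open>v\<close>, and a dilation multiplies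
  \<open>e\<close> by c and \<open>d\<close> by c^2. Hence the cases depend only on whether
  \<open>d\<close> and \<open>e\<close> vanish and, for d > 0, on a^2 = e^2 / (4 d).\<close>

fun meixner_poly :: "real \<Rightarrow> real \<Rightarrow> real \<Rightarrow> real \<Rightarrow> nat \<Rightarrow> real \<Rightarrow> real \<Rightarrow> real" where
  "meixner_poly e d r v 0 x t = 1"
| "meixner_poly e d r v (Suc 0) x t = x - r * t"
| "meixner_poly e d r v (Suc (Suc 0)) x t =
     (x - (e + r * t)) * meixner_poly e d r v (Suc 0) x t - v * t * meixner_poly e d r v 0 x t"
| "meixner_poly e d r v (Suc (Suc (Suc n))) x t =
     (x - (e + r * t)) * meixner_poly e d r v (Suc (Suc n)) x t
     - (d + v * t) * meixner_poly e d r v (Suc n) x t"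

definition meixner_u :: "real \<Rightarrow> real \<Rightarrow> real fps" where
  "meixner_u e d = fps_X * inverse (1 + fps_const e * fps_X + fps_const d * fps_X ^ 2)"

lemma P01_meixner_u: "P01 (meixner_u e d)"
  by (simp add: P01_def meixner_u_def)

lemma P01_nonzero: "P01 u \<Longrightarrow> u \<noteq> 0"
  by (auto simp: P01_def)

lemma u_semi_eq: "u_semi = meixner_u 0 0"
  by (simp add: u_semi_def meixner_u_def)

lemma u_poi_eq: "u_poi = meixner_u 1 0"
  by (simp add: u_poi_def meixner_u_def)

lemma u3_eq: "u3 a = meixner_u (2 * a) 1"
  by (simp add: u3_def meixner_u_def)

lemma P_semi_eq: "P_semi n x t = meixner_poly 0 0 0 1 n x t"
proof (induction n x t rule: P_semi.induct)
  case (3 n x t)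
  then show ?case by (cases n) simp_all
qed simp_all

lemma P_poi_eq: "P_poi n x t = meixner_poly 1 0 1 1 n x t"
proof (induction n x t rule: P_poi.induct)
  case (3 n x t)
  then show ?case by (cases n) (simp_all add: algebra_simps)
qed simp_all

lemma P3_eq: "P3 a n x t = meixner_poly (2 * a) 1 a 1 n x t"
  by (induction a n x t rule: P3.induct) (simp_all add: algebra_simps)

text \<open>The coefficients of index at least 3 vanish by the regular three-term recurrence. The
  irregular first steps, with mean \<open>r * t\<close> in place of \<open>e + r * t\<close> and
  weight \<open>v * t\<close> in place of \<open>d + v * t\<close>, leave exactly the numerator on
  the right.\<close>

lemma meixner_poly_gen_mult:
  "Abs_fps (\<lambda>n. meixner_poly e d r v n x t) *
     (1 + fps_const (e + r * t - x) * fps_X + fps_const (d + v * t) * fps_X ^ 2) =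
   1 + fps_const e * fps_X + fps_const d * fps_X ^ 2" (is "?F * _ = _")
proof (rule fps_ext)
  fix n
  have "?F * (1 + fps_const (e + r * t - x) * fps_X + fps_const (d + v * t) * fps_X ^ 2) =
        ?F + fps_const (e + r * t - x) * (?F * fps_X) + fps_const (d + v * t) * (?F * fps_X * fps_X)"
    by (simp add: algebra_simps power2_eq_square)
  moreover have "(?F + fps_const (e + r * t - x) * (?F * fps_X)
      + fps_const (d + v * t) * (?F * fps_X * fps_X)) $ n =
      (1 + fps_const e * fps_X + fps_const d * fps_X ^ 2) $ n"
    by (cases "(e,d,r,v,n,x,t)" rule: meixner_poly.cases)
       (simp_all add: power2_eq_square algebra_simps)
  ultimately show "(?F * (1 + fps_const (e + r * t - x) * fps_X + fps_const (d + v * t) * fps_X ^ 2)) $ n =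
      (1 + fps_const e * fps_X + fps_const d * fps_X ^ 2) $ n" by simp
qed

lemma meixner_u_mult:
  "meixner_u e d * (1 + fps_const e * fps_X + fps_const d * fps_X ^ 2) = fps_X"
  unfolding meixner_u_def mult.assoc by (subst inverse_mult_eq_1) auto

text \<open>Multiplying the denominator by z / u turns every u into z, so that only polynomials in z
  remain and the previous identity applies.\<close>

lemma meixner_poly_gen:
  fixes S :: "real fps"
  assumes S: "S oo meixner_u e d = fps_const r + fps_const v * fps_X"
  shows "Abs_fps (\<lambda>n. meixner_poly e d r v n x t) =
    inverse (1 + fps_const t * meixner_u e d * (S oo meixner_u e d) - fps_const x * meixner_u e d)"
    (is "?F = inverse ?B")
proof -
  let ?h = "1 + fps_const e * fps_X + fps_const d * fps_X ^ 2 :: real fps"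
  have "?B * ?h = ?h + fps_const t * (meixner_u e d * ?h) * (fps_const r + fps_const v * fps_X)
      - fps_const x * (meixner_u e d * ?h)"
    unfolding S by (simp add: algebra_simps)
  also have "\<dots> = 1 + fps_const (e + r * t - x) * fps_X + fps_const (d + v * t) * fps_X ^ 2"
    unfolding meixner_u_mult
    by (simp add: algebra_simps power2_eq_square flip: fps_const_add fps_const_sub fps_const_mult)
  finally have "?F * (?B * ?h) = ?h"
    using meixner_poly_gen_mult[of e d r v x t] by simp
  then have "(?B * ?F) * ?h = 1 * ?h" by (simp add: ac_simps)
  moreover have "?h $ 0 \<noteq> 0" by simp
  then have "?h \<noteq> 0" by (metis fps_zero_nth)
  ultimately have "?B * ?F = 1" by (metis mult_right_cancel)
  moreover have "?B $ 0 \<noteq> 0" by (simp add: meixner_u_def)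
  ultimately show ?thesis by (metis fps_inverse_unique mult.commute)
qed

lemma sheffer_denom_diag:
  assumes "P01 u"
  shows "sheffer_denom u u R t x = 1 + fps_const t * u * (R oo u) - fps_const x * u"
  using P01_nonzero[OF assms] by (simp add: sheffer_denom_def)

section \<open>R-transforms of the listed families, composed with u\<close>

lemma R_semi_comp: "R_semi oo meixner_u 0 0 = fps_const 0 + fps_const 1 * fps_X"
  by (simp add: R_semi_def meixner_u_def)

lemma R_poi_comp: "R_poi oo meixner_u 1 0 = fps_const 1 + fps_const 1 * fps_X"
proof -
  let ?u = "meixner_u 1 0"
  have u0: "?u $ 0 = 0" by (simp add: meixner_u_def)
  have "(1 - ?u) * (1 + fps_X) = 1 + fps_X - ?u * (1 + fps_X)" by (simp add: algebra_simps)
  also have "\<dots> = 1" using meixner_u_mult[of 1 0] by simp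
  finally have "(1 - ?u) * (1 + fps_X) = 1" .
  moreover have "R_poi oo ?u = inverse (1 - ?u)"
    unfolding R_poi_def using u0
    by (simp add: fps_inverse_compose fps_compose_sub_distrib)
  ultimately show ?thesis using u0 
    by (simp add: fps_inverse_unique)
qed

text \<open>With h = z / u, the radicand composed with u and multiplied by h^2 is (h - 2 a z)^2 - 4
  z^2 = (1 + z^2)^2 - 4 z^2 = (1 - z^2)^2, so the square root becomes rational.\<close>

lemma R3_comp: "R3 a oo meixner_u (2 * a) 1 = fps_const a + fps_const 1 * fps_X"
proof -
  let ?u = "meixner_u (2 * a) 1"
  let ?h = "1 + fps_const (2 * a) * fps_X + fps_const 1 * fps_X ^ 2 :: real fps"
  define q where "q = (1 - fps_const (4 * a) * fps_X + fps_const (4 * (a\<^sup>2 - 1)) * fps_X ^ 2 :: real fps)"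
  define s where "s = fps_radical (\<lambda>k y. root k y) 2 q"
  have u0: "?u $ 0 = 0" by (simp add: meixner_u_def)
  have uh: "?u * ?h = fps_X" by (rule meixner_u_mult)
  have s2: "s ^ 2 = q"
  proof -
    have "q $ 0 = 1" by (simp add: q_def)
    then show ?thesis
      using power_radical[of q "\<lambda>k y. root k y" 1] by (simp add: s_def numeral_2_eq_2)
  qed
  have s0: "s $ 0 = 1" by (simp add: s_def q_def)
  have XR: "fps_X * R3 a = fps_const (1/2) * (1 - s)"
  proof -
    have "(fps_const (1/2) * (1 - s)) $ 0 = 0" using s0 by simp
    then have "fps_X * fps_shift 1 (fps_const (1/2) * (1 - s)) = fps_const (1/2) * (1 - s)"
      by (intro fps_ext) (simp add: fps_X_mult_nth)
    then show ?thesis by (simp add: R3_def s_def q_def)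
  qed
  define w where "w = s oo ?u"
  have w2: "w ^ 2 = q oo ?u" using s2 u0 by (metis fps_compose_power w_def)
  have qu: "q oo ?u = 1 - fps_const (4 * a) * ?u + fps_const (4 * (a\<^sup>2 - 1)) * ?u ^ 2"
    using u0 by (simp add: q_def fps_compose_add_distrib fps_compose_sub_distrib
        fps_compose_mult_distrib flip: fps_compose_power)
  have expand: "(1 - c * y + k * y ^ 2) * h ^ 2 = h ^ 2 - c * (y * h) * h + k * (y * h) ^ 2"
    for c k y h :: "real fps" by algebra
  have "(w * ?h) ^ 2 = ?h ^ 2 - fps_const (4 * a) * (?u * ?h) * ?h + fps_const (4 * (a\<^sup>2 - 1)) * (?u * ?h) ^ 2"
    unfolding power_mult_distrib[of w] w2 qu by (rule expand)
  also have "\<dots> = (1 - fps_X ^ 2) ^ 2"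
  proof -
    define A where "A = fps_const a"
    have "fps_const (4 * (a\<^sup>2 - 1)) = fps_const 4 * (fps_const a ^ 2 - fps_const 1)"
      by (simp only: fps_const_mult fps_const_sub fps_const_power)
    moreover have "fps_const (2 * a) = fps_const 2 * fps_const a" "fps_const (4 * a) = fps_const 4 * fps_const a"
      by (simp_all only: fps_const_mult)
    ultimately have c: "fps_const (2 * a) = 2 * A" "fps_const (4 * a) = 4 * A"
      "fps_const (4 * (a\<^sup>2 - 1)) = 4 * (A ^ 2 - 1)" "fps_const (1::real) = 1"
      by (simp_all only: A_def numeral_fps_const fps_const_1_eq_1)
    show ?thesis unfolding uh unfolding c by algebra
  qed
  \<comment> \<open>Power series form an integral domain, and the constant term 2 of the second
    factor selects the sign of the root.\<close>
  finally have "(w * ?h - (1 - fps_X ^ 2)) * (w * ?h + (1 - fps_X ^ 2)) = 0"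
    by (simp add: algebra_simps power2_eq_square)
  moreover have "(w * ?h + (1 - fps_X ^ 2)) $ 0 = 2" using s0 by (simp add: w_def)
  then have "w * ?h + (1 - fps_X ^ 2) \<noteq> 0" by (metis fps_zero_nth zero_neq_numeral)
  ultimately have wh: "w * ?h = 1 - fps_X ^ 2" by simp
  have "?u * (R3 a oo ?u) = (fps_X * R3 a) oo ?u"
    using u0 by (simp add: fps_compose_mult_distrib)
  also have "\<dots> = fps_const (1/2) * (1 - w)"
    unfolding XR using u0 by (simp add: fps_compose_mult_distrib fps_compose_sub_distrib w_def)
  finally have uR: "?u * (R3 a oo ?u) = fps_const (1/2) * (1 - w)" .
  have "(y * h) * z = k * (h - w * h)" if "y * z = k * (1 - w)" for y h z k :: "real fps"
    using that by algebra
  from this[OF uR] have "(?u * ?h) * (R3 a oo ?u) = fps_const (1/2) * (?h - w * ?h)" .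
  then have "fps_X * (R3 a oo ?u) = fps_X * (fps_const a + fps_const 1 * fps_X)"
    unfolding uh wh
    by (simp add: algebra_simps power2_eq_square flip: fps_const_mult)
  then show ?thesis by simp
qed

section \<open>Chebyshev polynomials\<close>

fun cheb_poly :: "nat \<Rightarrow> real poly" where
  "cheb_poly 0 = 1"
| "cheb_poly (Suc 0) = [:0, 1:]"
| "cheb_poly (Suc (Suc n)) = [:0, 1:] * cheb_poly (Suc n) - cheb_poly n"

lemma poly_cheb_poly_cos: "poly (cheb_poly n) (2 * cos \<theta>) * sin \<theta> = sin (real (Suc n) * \<theta>)"
proof (induction n rule: cheb_poly.induct)
  case 2
  then show ?case by (simp add: sin_double)
next
  case (3 n)
  have "sin (real (Suc (Suc (Suc n))) * \<theta>) + sin (real (Suc n) * \<theta>) = 2 * cos \<theta> * sin (real (Suc (Suc n)) * \<theta>)"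
    using sin_add[of "real (Suc (Suc n)) * \<theta>" \<theta>] sin_diff[of "real (Suc (Suc n)) * \<theta>" \<theta>]
    by (simp add: algebra_simps)
  with 3 show ?case by (simp add: algebra_simps)
qed simp

lemma degree_cheb_poly: "degree (cheb_poly n) \<le> n" and coeff_cheb_poly: "coeff (cheb_poly n) n = 1"
proof (induction n rule: cheb_poly.induct)
  case (3 n)
  { case 1
    have "degree ([:0, 1:] * cheb_poly (Suc n)) \<le> Suc (Suc n)"
      using degree_mult_le[of "[:0, 1:]" "cheb_poly (Suc n)"] 3(1) by simp
    with 3(3) show ?case by (auto intro!: degree_diff_le) }
  { case 2
    have "coeff (cheb_poly n) (Suc (Suc n)) = 0" using 3(3) by (intro coeff_eq_0) auto
    then show ?case using 3(2) by simp }
qed simp_all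

text \<open>The definite description is legitimate because 2 cos \<theta> takes infinitely many
  values on (0, pi), where sin \<theta> is nonzero; two polynomials agreeing there coincide.\<close>

lemma chebU_eq: "chebU n = cheb_poly n"
  unfolding chebU_def
proof (rule the_equality)
  show "\<forall>\<theta>. sin \<theta> \<noteq> 0 \<longrightarrow> poly (cheb_poly n) (2 * cos \<theta>) = sin (real (Suc n) * \<theta>) / sin \<theta>"
    by (metis nonzero_eq_divide_eq poly_cheb_poly_cos)
next
  fix p :: "real poly"
  assume p: "\<forall>\<theta>. sin \<theta> \<noteq> 0 \<longrightarrow> poly p (2 * cos \<theta>) = sin (real (Suc n) * \<theta>) / sin \<theta>"
  let ?A = "(\<lambda>\<theta>. 2 * cos \<theta>) ` {0<..<pi}"
  have "inj_on (\<lambda>\<theta>. 2 * cos \<theta>) {0<..<pi}"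
    by (auto intro!: inj_onI intro: cos_inj_pi)
  then have "infinite ?A" by (metis finite_imageD infinite_Ioo pi_gt_zero)
  moreover have "?A \<subseteq> {x. poly (p - cheb_poly n) x = 0}"
  proof (clarsimp)
    fix \<theta> :: real assume "0 < \<theta>" "\<theta> < pi"
    then have "sin \<theta> \<noteq> 0" using sin_gt_zero by force
    with p show "poly p (2 * cos \<theta>) = poly (cheb_poly n) (2 * cos \<theta>)"
      by (metis nonzero_eq_divide_eq poly_cheb_poly_cos)
  qed
  ultimately have "p - cheb_poly n = 0"
    by (metis finite_subset poly_roots_finite)
  then show "p = cheb_poly n" by simp
qed

lemma chebU2_pos:
  assumes "t > 0"
  shows "chebU2 n x t = sqrt t ^ n * poly (cheb_poly n) (x / sqrt t)"
proof -
  have "poly (cheb_poly n) y = (\<Sum>k\<le>n. coeff (cheb_poly n) k * y ^ k)" for y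
    unfolding poly_altdef
    by (rule sum.mono_neutral_left) (use degree_cheb_poly[of n] in \<open>auto intro: coeff_eq_0\<close>)
  moreover have scale: "sqrt t ^ n * (c * (x / sqrt t) ^ k) = c * x ^ k * sqrt t ^ (n - k)" if "k \<le> n" for c k
    using that assms by (simp add: power_divide power_diff)
  ultimately show ?thesis
    unfolding chebU2_def chebU_eq by (simp only: sum_distrib_left) (intro sum.cong refl, simp only: atMost_iff scale)
qed

text \<open>At t = 0 only the term k = n survives, through 0 ^ 0 = 1, and its coefficient is 1
  because the polynomial is monic.\<close>

lemma chebU2_zero: "chebU2 n x 0 = x ^ n"
proof -
  have "chebU2 n x 0 = (\<Sum>k\<le>n. if k = n then x ^ n else 0)"
    unfolding chebU2_def chebU_eq by (intro sum.cong) (auto simp: coeff_cheb_poly power_0_left)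
  then show ?thesis by simp
qed

lemma chebU2_0 [simp]: "t \<ge> 0 \<Longrightarrow> chebU2 0 x t = 1"
  by (cases "t = 0") (auto simp: chebU2_zero chebU2_pos)

lemma chebU2_1 [simp]: "t \<ge> 0 \<Longrightarrow> chebU2 (Suc 0) x t = x"
  by (cases "t = 0") (auto simp: chebU2_zero chebU2_pos)

lemma chebU2_Suc_Suc:
  assumes "t \<ge> 0"
  shows "chebU2 (Suc (Suc n)) x t = x * chebU2 (Suc n) x t - t * chebU2 n x t"
proof (cases "t = 0")
  case False
  with assms show ?thesis
    by (simp add: chebU2_pos algebra_simps)
qed (simp add: chebU2_zero)

lemma chebU2_cos:
  assumes "t > 0" "sin \<theta> \<noteq> 0"
  shows "chebU2 n (2 * sqrt t * cos \<theta>) t = sqrt t ^ n * (sin (real (Suc n) * \<theta>) / sin \<theta>)"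
proof -
  have "2 * sqrt t * cos \<theta> / sqrt t = 2 * cos \<theta>" using assms by simp
  then show ?thesis using poly_cheb_poly_cos[of n \<theta>] assms
    by (simp add: chebU2_pos field_simps)
qed

lemma meixner_poly_eq_chebU2_1:
  assumes "d + v * t \<ge> 0"
  shows "meixner_poly e d r v (Suc 0) x t =
    chebU2 (Suc 0) (x - (e + r * t)) (d + v * t) + e * chebU2 0 (x - (e + r * t)) (d + v * t)"
  using assms by simp

text \<open>The denominator of the generating function is that of the Chebyshev polynomials in y = x
  - (e + r t) with scale d + v t; the numerator 1 + e z + d z^2 gives the three
  coefficients.\<close>

lemma meixner_poly_eq_chebU2:
  assumes "d + v * t \<ge> 0"
  shows "meixner_poly e d r v (Suc (Suc n)) x t =
    chebU2 (Suc (Suc n)) (x - (e + r * t)) (d + v * t)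
    + e * chebU2 (Suc n) (x - (e + r * t)) (d + v * t) + d * chebU2 n (x - (e + r * t)) (d + v * t)"
proof (induction n rule: induct_nat_012)
  case (ge2 n)
  then show ?case
    using chebU2_Suc_Suc[OF assms, of "Suc (Suc n)" "x - (e + r * t)"]
      chebU2_Suc_Suc[OF assms, of "Suc n" "x - (e + r * t)"]
      chebU2_Suc_Suc[OF assms, of n "x - (e + r * t)"]
    by (simp only: meixner_poly.simps) (simp add: algebra_simps)
qed (use assms in \<open>simp_all add: chebU2_Suc_Suc algebra_simps\<close>)

text \<open>All cases in one Jacobi form. For n = 0 the truncated index n - 1 = 0 is harmless
  because its coefficient is 0.\<close>

lemma meixner_poly_rec:
  "meixner_poly e d r v (Suc n) x t =
    (x - (if n = 0 then r * t else e + r * t)) * meixner_poly e d r v n x t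
    - (if n = 0 then 0 else if n = 1 then v * t else d + v * t) * meixner_poly e d r v (n - 1) x t"
  by (cases "(e,d,r,v,n,x,t)" rule: meixner_poly.cases) (simp_all add: algebra_simps)

lemma meixner_poly_monic:
  "\<exists>q :: real poly. degree q = n \<and> lead_coeff q = 1 \<and> (\<forall>x. meixner_poly e d r v n x t = poly q x)"
proof (induction n rule: less_induct)
  case (less n)
  show ?case
  proof (cases n)
    case 0
    then show ?thesis by (intro exI[of _ 1]) auto
  next
    case (Suc m)
    from less[of m] Suc obtain q where q: "degree q = m" "lead_coeff q = 1"
      "\<And>x. meixner_poly e d r v m x t = poly q x" by auto
    from less[of "m - 1"] Suc obtain q' where q': "degree q' = m - 1"
      "\<And>x. meixner_poly e d r v (m - 1) x t = poly q' x" by (metis diff_le_self le_imp_less_Suc)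
    define a where "a = (if m = 0 then r * t else e + r * t)"
    define b where "b = (if m = 0 then 0 else if m = 1 then v * t else d + v * t)"
    have eq: "meixner_poly e d r v n x t = poly ([:-a, 1:] * q - smult b q') x" for x
      unfolding Suc meixner_poly_rec a_def b_def q q'(2) by (simp add: algebra_simps)
    have q0: "q \<noteq> 0" using q by auto
    have d1: "degree ([:-a, 1:] * q) = Suc m" using q0 q by (subst degree_mult_eq) auto
    have d2: "degree (smult b q') < Suc m" using q' degree_smult_le[of b q'] by auto
    have d3: "degree ([:-a, 1:] * q - smult b q') = Suc m"
      using d1 d2 degree_add_eq_left[of "- smult b q'" "[:-a, 1:] * q"] by simp
    have "coeff (smult b q') (Suc m) = 0" using d2 by (intro coeff_eq_0)
    moreover have "lead_coeff ([:-a, 1:] * q) = 1" using q by (subst lead_coeff_mult) auto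
    ultimately have "lead_coeff ([:-a, 1:] * q - smult b q') = 1" using d1 d3 by simp
    with d3 eq Suc show ?thesis by metis
  qed
qed

section \<open>Moments, orthogonality and the R-transform\<close>

lemma integrable_poly:
  assumes "finite_moments M"
  shows "integrable M (\<lambda>x. poly q x)"
  unfolding poly_altdef using assms by (auto simp: finite_moments_def)

lemma integral_poly:
  assumes "finite_moments M"
  shows "(\<integral>x. poly q x \<partial>M) = (\<Sum>i\<le>degree q. coeff q i * moment M i)"
  unfolding poly_altdef moment_def using assms
  by (subst Bochner_Integration.integral_sum) (auto simp: finite_moments_def)

lemma integrable_meixner_poly:
  assumes "finite_moments M"
  shows "integrable M (\<lambda>x. meixner_poly e d r v n x t)"
proof -
  obtain q where "\<And>x. meixner_poly e d r v n x t = poly q x" using meixner_poly_monic by blast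
  with integrable_poly[OF assms, of q] show ?thesis by simp
qed

lemma integrable_meixner_poly_mult:
  assumes "finite_moments M"
  shows "integrable M (\<lambda>x. meixner_poly e d r v m x t * meixner_poly e d r v n x t)"
proof -
  obtain p where "\<And>x. meixner_poly e d r v m x t = poly p x" using meixner_poly_monic by blast
  moreover obtain q where "\<And>x. meixner_poly e d r v n x t = poly q x" using meixner_poly_monic by blast
  ultimately show ?thesis using integrable_poly[OF assms, of "p * q"] by simp
qed

text \<open>Favard's argument with the integral as the functional: expressing x P k and x P n by the
  recurrence trades one degree of the first factor for one of the second. Every product that arises
  has a first index below m, so the induction is on the smaller index and ends at P 0 = 1.\<close>

lemma meixner_poly_orthogonal:
  assumes fm: "finite_moments M" and zero: "\<And>n. n \<ge> 1 \<Longrightarrow> (\<integral>x. meixner_poly e d r v n x t \<partial>M) = 0"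
  shows "m < n \<Longrightarrow> (\<integral>x. meixner_poly e d r v m x t * meixner_poly e d r v n x t \<partial>M) = 0"
proof (induction m arbitrary: n rule: less_induct)
  case (less m)
  let ?p = "\<lambda>n x. meixner_poly e d r v n x t"
  let ?L = "\<lambda>m n. \<integral>x. ?p m x * ?p n x \<partial>M"
  define a where "a = (\<lambda>m::nat. if m = 0 then r * t else e + r * t)"
  define b where "b = (\<lambda>m::nat. if m = 0 then 0 else if m = 1 then v * t else d + v * t)"
  note i [simp] = integrable_meixner_poly_mult[OF fm, of e d r v _ t _]
  show ?case
  proof (cases m)
    case 0
    with less zero show ?thesis by simp
  next
    case (Suc k)
    have p: "?p (Suc n) x = (x - a n) * ?p n x - b n * ?p (n - 1) x" for n x
      unfolding a_def b_def by (rule meixner_poly_rec)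
    have "?p m x * ?p n x = ?p k x * ?p (Suc n) x + (a n - a k) * (?p k x * ?p n x)
        + b n * (?p k x * ?p (n - 1) x) - b k * (?p (k - 1) x * ?p n x)" for x
      unfolding p[of k] p[of n] Suc by (simp add: algebra_simps)
    then have "?L m n = ?L k (Suc n) + (a n - a k) * ?L k n + b n * ?L k (n - 1) - b k * ?L (k - 1) n"
      by simp
    moreover have "?L k (Suc n) = 0" "?L k n = 0" "?L k (n - 1) = 0" "?L (k - 1) n = 0"
      using less Suc by auto
    ultimately show ?thesis by simp
  qed
qed

lemma monic_OPS_meixner_poly:
  assumes "finite_moments M" "\<And>n. n \<ge> 1 \<Longrightarrow> (\<integral>x. meixner_poly e d r v n x t \<partial>M) = 0"
  shows "monic_OPS M (\<lambda>n x. meixner_poly e d r v n x t)"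
  unfolding monic_OPS_def
proof (intro conjI allI impI meixner_poly_monic)
  fix m n :: nat assume "m \<noteq> n"
  then consider "m < n" | "n < m" by linarith
  then show "(\<integral>x. meixner_poly e d r v m x t * meixner_poly e d r v n x t \<partial>M) = 0"
    by cases (use meixner_poly_orthogonal[OF assms, of m n] meixner_poly_orthogonal[OF assms, of n m]
        in \<open>simp_all add: mult.commute\<close>)
qed

text \<open>The integrals of monic polynomials of each degree are a unitriangular linear image of
  the moments, so they determine the moments one after another.\<close>

lemma moment_eqI:
  fixes p :: "nat \<Rightarrow> real \<Rightarrow> real"
  assumes M: "finite_moments M" and N: "finite_moments N"
    and p: "\<And>n. \<exists>q :: real poly. degree q = n \<and> lead_coeff q = 1 \<and> (\<forall>x. p n x = poly q x)"
    and eq: "\<And>n. (\<integral>x. p n x \<partial>M) = (\<integral>x. p n x \<partial>N)"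
  shows "moment M n = moment N n"
proof (induction n rule: less_induct)
  case (less n)
  obtain q where q: "degree q = n" "lead_coeff q = 1" "\<And>x. p n x = poly q x" using p by blast
  have "(\<Sum>i\<le>n. coeff q i * moment M i) = (\<Sum>i\<le>n. coeff q i * moment N i)"
    using eq[of n] integral_poly[OF M, of q] integral_poly[OF N, of q] q by simp
  moreover have "(\<Sum>i<n. coeff q i * moment M i) = (\<Sum>i<n. coeff q i * moment N i)"
    using less by simp
  ultimately show ?case using q by (simp flip: lessThan_Suc_atMost)
qed

text \<open>By Levy's uniqueness theorem it suffices to compare characteristic functions, whose Taylor
  polynomials at 0 converge because the moments of N, hence of M, grow geometrically.\<close>
lemma moment_determinate:
  fixes M N :: "real measure"
  assumes M: "real_distribution M" "finite_moments M"
    and N: "real_distribution N" "finite_moments N"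
    and bd: "AE x in N. \<bar>x\<bar> \<le> C"
    and eq: "\<And>n. moment M n = moment N n"
  shows "M = N"
proof (rule Levy_uniqueness[OF M(1) N(1)], rule ext)
  fix t :: real
  interpret M: real_distribution M by fact
  interpret N: real_distribution N by fact
  define C' where "C' = \<bar>C\<bar>"
  have mom: "moment N (2 * n) \<le> C' ^ (2 * n)" for n
  proof -
    have "moment N (2 * n) \<le> (\<integral>x. C' ^ (2 * n) \<partial>N)"
      unfolding moment_def
    proof (rule integral_mono_AE)
      show "integrable N (\<lambda>x. x ^ (2 * n))" using N(2) by (simp add: finite_moments_def)
      show "AE x in N. x ^ (2 * n) \<le> C' ^ (2 * n)"
        using bd
      proof eventually_elim
        case (elim x)
        have "x ^ (2 * n) = \<bar>x\<bar> ^ (2 * n)" by (simp add: power_even_abs)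
        also have "\<dots> \<le> C' ^ (2 * n)" using elim by (intro power_mono) (auto simp: C'_def)
        finally show ?case .
      qed
    qed simp
    then show ?thesis by (simp add: N.prob_space[simplified])
  qed
  define T where "T = (\<lambda>n. \<Sum>k\<le>n. ((\<i> * t)^k / fact k) * complex_of_real (moment N k))"
  \<comment> \<open>At even order the absolute moment in the error term is an ordinary moment. The
    bound therefore passes from N to any law with the same moments, without assuming that its
    support is bounded.\<close>
  have approx: "cmod (char K t - T (2 * n)) \<le> 2 * (\<bar>t\<bar> * C') ^ (2 * n) / fact (2 * n)"
    if K: "real_distribution K" "finite_moments K" "\<And>n. moment K n = moment N n" for K n
  proof -
    interpret K: real_distribution K by fact
    have "cmod (char K t - (\<Sum>k \<le> 2*n. ((\<i> * t)^k / fact k) * K.expectation (\<lambda>x. x^k))) \<le>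
      (2*\<bar>t\<bar>^(2*n) / fact (2*n)) * K.expectation (\<lambda>x. \<bar>x\<bar>^(2*n))"
      using K(2) by (intro K.char_approx1) (simp add: finite_moments_def)
    also have "K.expectation (\<lambda>x. \<bar>x\<bar>^(2*n)) = moment N (2 * n)"
      using K(3)[of "2 * n"] by (simp add: moment_def power_even_abs)
    also have "(2*\<bar>t\<bar>^(2*n) / fact (2*n)) * moment N (2 * n) \<le> (2*\<bar>t\<bar>^(2*n) / fact (2*n)) * C' ^ (2 * n)"
      by (intro mult_left_mono mom) auto
    finally show ?thesis
      using K(3) by (simp add: T_def moment_def power_mult_distrib)
  qed
  have "(\<lambda>n. (\<bar>t\<bar> * C') ^ n / fact n) \<longlonglongrightarrow> 0"
    using summable_LIMSEQ_zero[OF summable_exp[of "\<bar>t\<bar> * C'"]] by (simp add: field_simps)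
  then have "(\<lambda>n. (\<bar>t\<bar> * C') ^ (2 * n) / fact (2 * n)) \<longlonglongrightarrow> 0"
    by (rule LIMSEQ_subseq_LIMSEQ[where f = "\<lambda>n. 2 * n", unfolded comp_def]) (auto intro: strict_monoI)
  then have lim: "(\<lambda>n. 2 * (\<bar>t\<bar> * C') ^ (2 * n) / fact (2 * n)) \<longlonglongrightarrow> 0"
    using tendsto_mult_left[of _ 0 _ 2] by fastforce
  have "(\<lambda>n. char K t - T (2 * n)) \<longlonglongrightarrow> 0"
    if K: "real_distribution K" "finite_moments K" "\<And>n. moment K n = moment N n" for K
    by (rule Lim_null_comparison[OF _ lim]) (use approx[OF K] in auto)
  from tendsto_diff[OF this[OF M eq] this[OF N refl]]
  have "(\<lambda>n. char M t - char N t) \<longlonglongrightarrow> 0" by simp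
  then show "char M t = char N t" by (simp add: LIMSEQ_const_iff)
qed

text \<open>With B = 1 + u S(u) and w = u / B, the generating function is (1 / B) times the
  geometric series 1 / (1 - x w). Integrating in x replaces that series by m(w), m being the moment
  series, so m(w) = B and w m(w) = u. Thus w is the inverse Cauchy transform at u, which identifies
  K as 1 / z + S.\<close>

lemma R_transform_eqI:
  assumes fm: "finite_moments M"
    and u: "P01 u"
    and gen: "\<And>x. Abs_fps (\<lambda>n. p n x) = inverse (1 + u * (S oo u) - fps_const x * u)"
    and int: "\<And>n. (\<integral>x. p n x \<partial>M) = (if n = 0 then 1 else 0)"
  shows "R_transform M = S"
proof -
  define B where "B = 1 + u * (S oo u)"
  define w where "w = u * inverse B"
  define m where "m = Abs_fps (moment M)"
  have u0: "u $ 0 = 0" "u $ 1 = 1" using u by (auto simp: P01_def)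
  have B0: "B $ 0 = 1" using u0 by (simp add: B_def)
  have w0: "w $ 0 = 0" using u0 by (simp add: w_def)
  have wB: "w * B = u" unfolding w_def mult.assoc using B0 by (subst inverse_mult_eq_1) auto
  have BB: "B * inverse B = 1" using B0 by (simp add: inverse_mult_eq_1')
  \<comment> \<open>Since w has no constant term, each coefficient is a finite combination of powers
    of x and can be integrated termwise.\<close>
  have pn: "p n x = (\<Sum>j\<le>n. inverse B $ j * (\<Sum>i\<le>n - j. x ^ i * (w ^ i) $ (n - j)))" for n x
  proof -
    define g where "g = Abs_fps (\<lambda>n. x ^ n)"
    have "(1 - fps_const x * fps_X) * g = 1"
      by (intro fps_ext) (simp add: g_def left_diff_distrib mult.assoc fps_X_mult_nth power_eq_if)
    then have "((1 - fps_const x * fps_X) oo w) * (g oo w) = 1"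
      using w0 by (metis fps_compose_mult_distrib fps_compose_1)
    then have gw: "(1 - fps_const x * w) * (g oo w) = 1"
      using w0 by (simp add: fps_compose_sub_distrib fps_compose_mult_distrib)
    have "B - fps_const x * u = B * (1 - fps_const x * w)"
      using wB by (simp add: algebra_simps)
    moreover have "(B * (1 - fps_const x * w)) * (inverse B * (g oo w)) = (B * inverse B) * ((1 - fps_const x * w) * (g oo w))"
      by (simp only: ac_simps)
    ultimately have "(B - fps_const x * u) * (inverse B * (g oo w)) = 1"
      using BB gw by simp
    moreover have "(B - fps_const x * u) $ 0 \<noteq> 0" using B0 u0 by simp
    ultimately have "Abs_fps (\<lambda>n. p n x) = inverse B * (g oo w)"
      unfolding gen by (subst fps_inverse_unique) (auto simp: B_def)
    then have "p n x = (inverse B * (g oo w)) $ n" by (metis fps_nth_Abs_fps)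
    then show ?thesis by (simp add: fps_mult_nth fps_compose_nth g_def atMost_atLeast0)
  qed
  have "(inverse B * (m oo w)) $ n = (if n = 0 then 1 else 0)" for n
  proof -
    have "(\<integral>x. p n x \<partial>M) = (\<Sum>j\<le>n. inverse B $ j * (\<Sum>i\<le>n - j. moment M i * (w ^ i) $ (n - j)))"
      unfolding pn moment_def using fm by (simp add: finite_moments_def)
    also have "\<dots> = (inverse B * (m oo w)) $ n"
      by (simp add: fps_mult_nth fps_compose_nth m_def atMost_atLeast0)
    finally show ?thesis using int by simp
  qed
  then have "inverse B * (m oo w) = 1" by (intro fps_ext) simp
  then have "m oo w = B" using BB by (metis mult.left_commute mult.right_neutral mult.commute)
  then have gw: "cauchy_fps M oo w = u"
    using w0 wB by (simp add: cauchy_fps_def fps_compose_mult_distrib flip: m_def)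
  \<comment> \<open>\<open>k\<close> is 1 / K for the expected K = 1 / z + S, in the same variable
    as \<open>fps_inv (cauchy_fps M)\<close>.\<close>
  define k where "k = fps_X * inverse (1 + fps_X * S)"
  have k0: "k $ 0 = 0" by (simp add: k_def)
  have "k oo u = w"
    using u0 by (simp add: k_def w_def B_def fps_compose_mult_distrib fps_inverse_compose fps_compose_add_distrib)
  then have "(cauchy_fps M oo k) oo u = fps_X oo u"
    using gw u0 k0 by (simp flip: fps_compose_assoc)
  then have gk: "cauchy_fps M oo k = fps_X"
    using u0 by (subst (asm) fps_compose_inj_right) auto
  have g0: "cauchy_fps M $ 0 = 0" by (simp add: cauchy_fps_def)
  have g1: "cauchy_fps M $ 1 \<noteq> 0"
  proof
    assume "cauchy_fps M $ 1 = 0"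
    then have "(cauchy_fps M oo k) $ 1 = 0" using g0 by (simp add: fps_compose_nth)
    then show False unfolding gk by simp
  qed
  have "fps_inv (cauchy_fps M) = fps_inv (cauchy_fps M) oo (cauchy_fps M oo k)" unfolding gk by simp
  also have "\<dots> = (fps_inv (cauchy_fps M) oo cauchy_fps M) oo k"
    using g0 k0 by (intro fps_compose_assoc) auto
  also have "\<dots> = k" using fps_inv[OF g0 g1] k0 by simp
  finally have "fps_inv (cauchy_fps M) = k" .
  moreover have shift: "fps_shift 1 (fps_X * f) = f" for f :: "real fps" by (intro fps_ext) simp
  moreover have "fps_shift 1 (1 + fps_X * S) = S" by (intro fps_ext) simp
  ultimately show ?thesis unfolding R_transform_def k_def by (simp only: shift) simp
qed

section \<open>The semicircle distribution\<close>

definition semicircle_density :: "real \<Rightarrow> real \<Rightarrow> real \<Rightarrow> real" where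
  "semicircle_density \<alpha> \<beta> x = indicator {\<alpha> - 2 * sqrt \<beta> .. \<alpha> + 2 * sqrt \<beta>} x *
     sqrt (4 * \<beta> - (x - \<alpha>)\<^sup>2) / (2 * pi * \<beta>)"

lemma semicircle_eq_density:
  "\<beta> > 0 \<Longrightarrow> semicircle \<alpha> \<beta> = density lborel (\<lambda>x. ennreal (semicircle_density \<alpha> \<beta> x))"
  by (simp add: semicircle_def semicircle_density_def)

lemma borel_measurable_semicircle_density [measurable]: "semicircle_density \<alpha> \<beta> \<in> borel_measurable borel"
  unfolding semicircle_density_def[abs_def] by measurable

lemma sets_semicircle [measurable_cong, simp]: "sets (semicircle \<alpha> \<beta>) = sets borel"
  by (simp add: semicircle_def)

lemma space_semicircle [simp]: "space (semicircle \<alpha> \<beta>) = UNIV"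
  by (simp add: semicircle_def)

lemma semicircle_interval_iff:
  assumes "\<beta> > 0"
  shows "x \<in> {\<alpha> - 2 * sqrt \<beta> .. \<alpha> + 2 * sqrt \<beta>} \<longleftrightarrow> (x - \<alpha>)\<^sup>2 \<le> 4 * \<beta>"
proof -
  have "(x - \<alpha>)\<^sup>2 \<le> 4 * \<beta> \<longleftrightarrow> \<bar>x - \<alpha>\<bar> \<le> 2 * sqrt \<beta>"
    using assms abs_le_square_iff[of "x - \<alpha>" "2 * sqrt \<beta>"] by (simp add: power_mult_distrib)
  then show ?thesis by auto
qed

lemma semicircle_density_nonneg [simp]: "\<beta> > 0 \<Longrightarrow> semicircle_density \<alpha> \<beta> x \<ge> 0"
  using semicircle_interval_iff[of \<beta> x \<alpha>] by (auto simp: semicircle_density_def indicator_def)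

lemma AE_semicircle:
  assumes "\<beta> > 0"
  shows "AE x in semicircle \<alpha> \<beta>. (x - \<alpha>)\<^sup>2 < 4 * \<beta>"
  unfolding semicircle_eq_density[OF assms]
proof (subst AE_density)
  have "0 < semicircle_density \<alpha> \<beta> x \<longrightarrow> (x - \<alpha>)\<^sup>2 < 4 * \<beta>" for x
    using assms semicircle_interval_iff[of \<beta> x \<alpha>]
    by (auto simp: semicircle_density_def indicator_def zero_less_divide_iff zero_less_mult_iff)
  then show "AE x in lborel. 0 < ennreal (semicircle_density \<alpha> \<beta> x) \<longrightarrow> (x - \<alpha>)\<^sup>2 < 4 * \<beta>"
    by simp
qed simp

text \<open>The substitution x = \<alpha> + 2 sqrt \<beta> cos \<theta> turns the semicircle density into
  (2 / pi) sin^2 \<theta>, so that integrals reduce to antiderivatives in \<theta>.\<close>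
lemma has_integral_semicircle_density:
  assumes b: "\<beta> > 0"
    and cont: "continuous_on {0..pi} G"
    and deriv: "\<And>\<theta>. 0 < \<theta> \<Longrightarrow> \<theta> < pi \<Longrightarrow>
      (G has_real_derivative f (\<alpha> + 2 * sqrt \<beta> * cos \<theta>) * (2 / pi * (sin \<theta>)\<^sup>2)) (at \<theta>)"
  shows "((\<lambda>x. semicircle_density \<alpha> \<beta> x * f x) has_integral (G pi - G 0)) UNIV"
proof -
  let ?a = "\<alpha> - 2 * sqrt \<beta>" and ?b = "\<alpha> + 2 * sqrt \<beta>"
  define y where "y = (\<lambda>x. (x - \<alpha>) / (2 * sqrt \<beta>))"
  \<comment> \<open>The minus sign compensates for arccos being decreasing: the left end of the
    support corresponds to \<theta> = pi.\<close>
  define F where "F = (\<lambda>x. - G (arccos (y x)))"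
  have ya: "y ?a = -1" "y ?b = 1" using b by (simp_all add: y_def)
  have yI: "y x \<in> {-1..1}" if "x \<in> {?a..?b}" for x
    using that b by (auto simp: y_def field_simps)
  have "continuous_on {?a..?b} (\<lambda>x. G (arccos (y x)))"
  proof (rule continuous_on_compose2[OF cont])
    show "continuous_on {?a..?b} (\<lambda>x. arccos (y x))"
      using yI b by (intro continuous_on_arccos) (auto simp: y_def intro!: continuous_intros)
    show "(\<lambda>x. arccos (y x)) ` {?a..?b} \<subseteq> {0..pi}"
      using yI by (force intro: arccos_lbound arccos_ubound)
  qed
  then have contF: "continuous_on {?a..?b} F" unfolding F_def by (intro continuous_intros)
  have derF: "(F has_vector_derivative (semicircle_density \<alpha> \<beta> x * f x)) (at x)" if x: "x \<in> {?a<..<?b}" for x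
  proof -
    have y1: "-1 < y x" "y x < 1" using x b by (auto simp: y_def field_simps)
    define \<theta> where "\<theta> = arccos (y x)"
    have th: "0 < \<theta>" "\<theta> < pi" using arccos_lt_bounded[OF y1] by (auto simp: \<theta>_def)
    have c: "cos \<theta> = y x" using y1 by (simp add: \<theta>_def)
    have s: "sin \<theta> > 0" using th by (rule sin_gt_zero)
    have s2: "sqrt (1 - (y x)\<^sup>2) = sin \<theta>"
      using s by (simp add: sin_squared_eq[of \<theta>, symmetric] flip: c)
    have xe: "\<alpha> + 2 * sqrt \<beta> * cos \<theta> = x" using b by (simp add: c y_def)
    have "sqrt (4 * \<beta> - (x - \<alpha>)\<^sup>2) = sqrt ((2 * sqrt \<beta> * sin \<theta>)\<^sup>2)"
    proof -
      have "(x - \<alpha>) = 2 * sqrt \<beta> * cos \<theta>" using xe by simp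
      then have "4 * \<beta> - (x - \<alpha>)\<^sup>2 = (2 * sqrt \<beta> * sin \<theta>)\<^sup>2"
        using b by (simp add: power_mult_distrib sin_squared_eq algebra_simps)
      then show ?thesis by simp
    qed
    also have "\<dots> = 2 * sqrt \<beta> * sin \<theta>" using s b by (simp add: real_sqrt_abs2)
    finally have sq: "sqrt (4 * \<beta> - (x - \<alpha>)\<^sup>2) = 2 * sqrt \<beta> * sin \<theta>" .
    have dy: "(y has_real_derivative 1 / (2 * sqrt \<beta>)) (at x)"
      unfolding y_def by (intro DERIV_cdivide) (auto intro!: derivative_eq_intros)
    have "((\<lambda>x. arccos (y x)) has_real_derivative inverse (- sqrt (1 - (y x)\<^sup>2)) * (1 / (2 * sqrt \<beta>))) (at x)"
      by (rule DERIV_chain2[OF DERIV_arccos[OF y1] dy])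
    then have da: "((\<lambda>x. arccos (y x)) has_real_derivative - (1 / (sin \<theta> * (2 * sqrt \<beta>)))) (at x)"
      unfolding s2 by (simp add: field_simps)
    have "((\<lambda>x. G (arccos (y x))) has_real_derivative
        (f x * (2 / pi * (sin \<theta>)\<^sup>2)) * - (1 / (sin \<theta> * (2 * sqrt \<beta>)))) (at x)"
      using DERIV_chain2[where f = G, OF deriv[OF th, unfolded \<theta>_def] da] xe by (simp add: \<theta>_def)
    then have "(F has_real_derivative - ((f x * (2 / pi * (sin \<theta>)\<^sup>2)) * - (1 / (sin \<theta> * (2 * sqrt \<beta>))))) (at x)"
      unfolding F_def by (rule DERIV_minus)
    moreover have "- ((f x * (2 / pi * (sin \<theta>)\<^sup>2)) * - (1 / (sin \<theta> * (2 * sqrt \<beta>)))) = semicircle_density \<alpha> \<beta> x * f x"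
    proof -
      have "\<beta> = sqrt \<beta> * sqrt \<beta>" using b by simp
      then have "2 * sqrt \<beta> * sin \<theta> / (2 * pi * \<beta>) = sin \<theta> / (pi * sqrt \<beta>)"
        using b by (simp add: divide_simps)
      moreover have "indicator {?a..?b} x = (1::real)" using x by simp
      ultimately have "semicircle_density \<alpha> \<beta> x = sin \<theta> / (pi * sqrt \<beta>)"
        unfolding semicircle_density_def sq by simp
      then show ?thesis using s b by (simp add: field_simps power2_eq_square)
    qed
    ultimately show ?thesis by (simp add: has_real_derivative_iff_has_vector_derivative)
  qed
  \<comment> \<open>arccos is not differentiable at the two ends, so the form of the fundamental
    theorem that asks for a derivative only in the interior is applied.\<close>
  have "((\<lambda>x. semicircle_density \<alpha> \<beta> x * f x) has_integral (F ?b - F ?a)) {?a..?b}"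
    by (rule fundamental_theorem_of_calculus_interior) (use b contF derF in auto)
  moreover have "F ?b - F ?a = G pi - G 0" by (simp add: F_def ya)
  moreover have "semicircle_density \<alpha> \<beta> x * f x = 0" if "x \<notin> {?a..?b}" for x
    using that by (simp add: semicircle_density_def)
  ultimately show ?thesis
    by (subst has_integral_on_superset[of _ _ "{?a..?b}"]) auto
qed

section \<open>Integrals with respect to the semicircle law\<close>

lemma has_bochner_integral_semicircleI:
  fixes f :: "real \<Rightarrow> real"
  assumes b: "\<beta> > 0" and m [measurable]: "f \<in> borel_measurable borel"
    and f: "has_bochner_integral lborel (\<lambda>x. semicircle_density \<alpha> \<beta> x * f x) I"
  shows "has_bochner_integral (semicircle \<alpha> \<beta>) f I"
  unfolding semicircle_eq_density[OF b]
  by (rule has_bochner_integral_density) (use b f in auto)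

text \<open>For nonnegative integrands a gauge integral already gives Lebesgue integrability. This
  covers the resolvent at the very edge of the support, where the integrand is unbounded.\<close>

lemma has_bochner_integral_semicircle_nonneg:
  fixes f :: "real \<Rightarrow> real"
  assumes b: "\<beta> > 0" and m [measurable]: "f \<in> borel_measurable borel"
    and nonneg: "\<And>x. (x - \<alpha>)\<^sup>2 \<le> 4 * \<beta> \<Longrightarrow> f x \<ge> 0"
    and I: "((\<lambda>x. semicircle_density \<alpha> \<beta> x * f x) has_integral I) UNIV"
  shows "has_bochner_integral (semicircle \<alpha> \<beta>) f I"
proof (rule has_bochner_integral_semicircleI[OF b m])
  have nn: "semicircle_density \<alpha> \<beta> x * f x \<ge> 0" for x
  proof (cases "(x - \<alpha>)\<^sup>2 \<le> 4 * \<beta>")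
    case True
    with nonneg b show ?thesis by simp
  next
    case False
    then have "x \<notin> {\<alpha> - 2 * sqrt \<beta> .. \<alpha> + 2 * sqrt \<beta>}" using semicircle_interval_iff[OF b] by blast
    then show ?thesis by (simp add: semicircle_density_def)
  qed
  show "has_bochner_integral lborel (\<lambda>x. semicircle_density \<alpha> \<beta> x * f x) I"
    by (rule has_bochner_integral_nn_integral)
       (use nn has_integral_nonneg[OF I] nn_integral_has_integral_lborel[OF _ nn I] in auto)
qed

lemma integrable_semicircle_continuous:
  fixes f :: "real \<Rightarrow> real"
  assumes b: "\<beta> > 0" and m [measurable]: "f \<in> borel_measurable borel"
    and c: "continuous_on {\<alpha> - 2 * sqrt \<beta> .. \<alpha> + 2 * sqrt \<beta>} f"
  shows "integrable (semicircle \<alpha> \<beta>) f"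
proof -
  let ?I = "{\<alpha> - 2 * sqrt \<beta> .. \<alpha> + 2 * sqrt \<beta>}"
  have "integrable lborel (\<lambda>x. indicator ?I x *\<^sub>R (sqrt (4 * \<beta> - (x - \<alpha>)\<^sup>2) / (2 * pi * \<beta>) * f x))"
    by (intro borel_integrable_compact continuous_intros c) (use b in auto)
  then have "integrable lborel (\<lambda>x. semicircle_density \<alpha> \<beta> x * f x)"
    by (simp add: semicircle_density_def mult.assoc)
  then show ?thesis
    unfolding semicircle_eq_density[OF b] by (subst integrable_density) (use b in auto)
qed

lemma integral_semicircle_continuous:
  fixes f :: "real \<Rightarrow> real"
  assumes b: "\<beta> > 0" and m [measurable]: "f \<in> borel_measurable borel"
    and c: "continuous_on {\<alpha> - 2 * sqrt \<beta> .. \<alpha> + 2 * sqrt \<beta>} f"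
    and I: "((\<lambda>x. semicircle_density \<alpha> \<beta> x * f x) has_integral I) UNIV"
  shows "(\<integral>x. f x \<partial>semicircle \<alpha> \<beta>) = I"
proof -
  have i: "integrable lborel (\<lambda>x. semicircle_density \<alpha> \<beta> x * f x)"
    using integrable_semicircle_continuous[OF b m c] unfolding semicircle_eq_density[OF b]
    by (subst (asm) integrable_density) (use b in auto)
  have "(\<integral>x. f x \<partial>semicircle \<alpha> \<beta>) = (\<integral>x. semicircle_density \<alpha> \<beta> x * f x \<partial>lborel)"
    unfolding semicircle_eq_density[OF b] by (subst integral_density) (use b in auto)
  also have "\<dots> = I" using has_integral_integral_lborel[OF i] I by (rule has_integral_unique)
  finally show ?thesis .
qed

lemma continuous_on_chebU2: "continuous_on A (\<lambda>x. chebU2 n (x - \<alpha>) \<beta>)"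
  unfolding chebU2_def by (intro continuous_intros)

lemma borel_measurable_chebU2 [measurable]: "(\<lambda>x. chebU2 n (x - \<alpha>) \<beta>) \<in> borel_measurable borel"
  unfolding chebU2_def by measurable

lemma integrable_chebU2:
  "\<beta> > 0 \<Longrightarrow> integrable (semicircle \<alpha> \<beta>) (\<lambda>x. chebU2 n (x - \<alpha>) \<beta>)"
  by (rule integrable_semicircle_continuous[OF _ borel_measurable_chebU2 continuous_on_chebU2])

text \<open>After the substitution the integrand is a multiple of 2 sin((n+1) \<theta>) sin \<theta>
  = cos(n \<theta>) - cos((n+2) \<theta>), whose antiderivative has equal values at 0 and pi unless
  n = 0.\<close>

lemma integral_chebU2:
  assumes b: "\<beta> > 0"
  shows "(\<integral>x. chebU2 n (x - \<alpha>) \<beta> \<partial>semicircle \<alpha> \<beta>) = (if n = 0 then 1 else 0)"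
proof -
  \<comment> \<open>The case n = 0 is separated because sin(0) / 0 is 0 here, while the
    antiderivative of cos(0 \<theta>) is \<theta>.\<close>
  define G where "G = (\<lambda>\<theta>. sqrt \<beta> ^ n / pi *
    ((if n = 0 then \<theta> else sin (real n * \<theta>) / n) - sin (real (n + 2) * \<theta>) / (n + 2)))"
  have "((\<lambda>x. semicircle_density \<alpha> \<beta> x * chebU2 n (x - \<alpha>) \<beta>) has_integral (G pi - G 0)) UNIV"
  proof (rule has_integral_semicircle_density[OF b])
    show "continuous_on {0..pi} G" unfolding G_def by (cases "n = 0") (auto intro!: continuous_intros)
    fix \<theta> :: real assume th: "0 < \<theta>" "\<theta> < pi"
    then have s: "sin \<theta> \<noteq> 0" using sin_gt_zero by force
    have "((\<lambda>\<theta>. if n = 0 then \<theta> else sin (real n * \<theta>) / n) has_real_derivative cos (real n * \<theta>)) (at \<theta>)"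
      by (cases "n = 0") (auto intro!: derivative_eq_intros)
    moreover have "((\<lambda>\<theta>. sin (real (n + 2) * \<theta>) / (n + 2)) has_real_derivative cos (real (n + 2) * \<theta>)) (at \<theta>)"
      by (auto intro!: derivative_eq_intros)
    ultimately have dG: "(G has_real_derivative sqrt \<beta> ^ n / pi * (cos (real n * \<theta>) - cos (real (n + 2) * \<theta>))) (at \<theta>)"
      unfolding G_def by (intro DERIV_cmult DERIV_diff)
    have cc: "cos (real n * \<theta>) - cos (real (n + 2) * \<theta>) = 2 * sin (real (Suc n) * \<theta>) * sin \<theta>"
      using cos_add[of "real (Suc n) * \<theta>" \<theta>] cos_diff[of "real (Suc n) * \<theta>" \<theta>]
      by (simp add: algebra_simps)
    have e: "chebU2 n (\<alpha> + 2 * sqrt \<beta> * cos \<theta> - \<alpha>) \<beta> * (2 / pi * (sin \<theta>)\<^sup>2)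
        = sqrt \<beta> ^ n / pi * (2 * sin (real (Suc n) * \<theta>) * sin \<theta>)"
      using chebU2_cos[OF b s, of n] s by (simp add: power2_eq_square del: of_nat_Suc)
    show "(G has_real_derivative
        chebU2 n (\<alpha> + 2 * sqrt \<beta> * cos \<theta> - \<alpha>) \<beta> * (2 / pi * (sin \<theta>)\<^sup>2)) (at \<theta>)"
      using dG unfolding e cc .
  qed
  from integral_semicircle_continuous[OF b borel_measurable_chebU2 continuous_on_chebU2 this]
  have "(\<integral>x. chebU2 n (x - \<alpha>) \<beta> \<partial>semicircle \<alpha> \<beta>) = G pi - G 0" .
  also have "\<dots> = (if n = 0 then 1 else 0)"
    using sin_npi[of "n + 2"] by (simp add: G_def)
  finally show ?thesis .
qed

lemma prob_space_semicircle:
  assumes "\<beta> > 0"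
  shows "prob_space (semicircle \<alpha> \<beta>)"
proof
  have "integrable (semicircle \<alpha> \<beta>) (\<lambda>x. 1::real)" and "(\<integral>x. 1 \<partial>semicircle \<alpha> \<beta>) = (1::real)"
    using integrable_chebU2[OF assms, where n = 0] integral_chebU2[OF assms, where n = 0] assms by simp_all
  then have "(\<integral>\<^sup>+x. ennreal 1 \<partial>semicircle \<alpha> \<beta>) = ennreal 1"
    by (subst nn_integral_eq_integral) auto
  then show "emeasure (semicircle \<alpha> \<beta>) (space (semicircle \<alpha> \<beta>)) = 1" by simp
qed

lemma abs_sin_mult_le: "\<bar>sin (real n * \<theta>)\<bar> \<le> real n * \<bar>sin \<theta>\<bar>"
proof (induction n)
  case (Suc n)
  have "\<bar>sin (real (Suc n) * \<theta>)\<bar> = \<bar>sin (real n * \<theta>) * cos \<theta> + cos (real n * \<theta>) * sin \<theta>\<bar>"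
    by (simp add: algebra_simps sin_add)
  also have "\<dots> \<le> \<bar>sin (real n * \<theta>)\<bar> * \<bar>cos \<theta>\<bar> + \<bar>cos (real n * \<theta>)\<bar> * \<bar>sin \<theta>\<bar>"
    by (metis abs_mult abs_triangle_ineq)
  also have "\<dots> \<le> \<bar>sin (real n * \<theta>)\<bar> * 1 + 1 * \<bar>sin \<theta>\<bar>"
    by (intro add_mono mult_left_mono mult_right_mono) auto
  finally show ?case using Suc by (simp add: algebra_simps)
qed simp

lemma abs_chebU2_le:
  assumes b: "\<beta> > 0" and y: "y\<^sup>2 < 4 * \<beta>"
  shows "\<bar>chebU2 n y \<beta>\<bar> \<le> real (Suc n) * sqrt \<beta> ^ n"
proof -
  have "\<bar>y\<bar> < 2 * sqrt \<beta>"
    using y b abs_le_square_iff[of "2 * sqrt \<beta>" y] by (simp add: power_mult_distrib not_le[symmetric])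
  then have y1: "-1 < y / (2 * sqrt \<beta>)" "y / (2 * sqrt \<beta>) < 1" using b by (auto simp: field_simps)
  define \<theta> where "\<theta> = arccos (y / (2 * sqrt \<beta>))"
  have "0 < \<theta>" "\<theta> < pi" using arccos_lt_bounded[OF y1] by (auto simp: \<theta>_def)
  then have s: "sin \<theta> \<noteq> 0" using sin_gt_zero by force
  have "cos \<theta> = y / (2 * sqrt \<beta>)" using y1 by (simp add: \<theta>_def)
  then have "y = 2 * sqrt \<beta> * cos \<theta>" using b by simp
  then have "\<bar>chebU2 n y \<beta>\<bar> = sqrt \<beta> ^ n * (\<bar>sin (real (Suc n) * \<theta>)\<bar> / \<bar>sin \<theta>\<bar>)"
    using chebU2_cos[OF b s, of n] b by (simp add: abs_mult)
  also have "\<bar>sin (real (Suc n) * \<theta>)\<bar> / \<bar>sin \<theta>\<bar> \<le> real (Suc n)"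
    using s abs_sin_mult_le[of "Suc n" \<theta>] by (simp add: divide_le_eq)
  finally show ?thesis using b by (simp add: mult.commute mult_left_mono)
qed

text \<open>The Joukowski parameter q rationalises the Stieltjes transform to the left of the
  support: under the substitution the integrand becomes a constant times sin^2 \<theta> / (1 + 2 q
  cos \<theta> + q^2). The value q = 1 is the left edge itself.\<close>

lemma semicircle_resolvent:
  assumes b: "\<beta> > 0" and q: "0 < q" "q \<le> 1" and x0: "\<alpha> - x0 = sqrt \<beta> * (q + 1 / q)"
  shows "has_bochner_integral (semicircle \<alpha> \<beta>) (\<lambda>x. 1 / (x - x0)) (q / sqrt \<beta>)"
proof -
  (* The arctan is the argument of 1 + q e^(i theta). At q = 1, theta = pi its quotient is 0 / 0 = 0,
     which is harmless because the factor 1 - q^2 vanishes. *)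
  define G where "G = (\<lambda>\<theta>. 2 * q / (pi * sqrt \<beta>) * (\<theta> / 2 - sin \<theta> / (2 * q)
     + (1 - q\<^sup>2) / (2 * q\<^sup>2) * arctan (q * sin \<theta> / (1 + q * cos \<theta>))))"
  have pos: "1 + q * cos \<theta> > 0" if "q < 1 \<or> (0 < \<theta> \<and> \<theta> < pi)" for \<theta>
  proof (cases "q < 1")
    case True
    have "q * (- cos \<theta>) \<le> q * 1" by (intro mult_left_mono) (use q in \<open>auto simp: cos_ge_minus_one minus_le_iff\<close>)
    with True show ?thesis by simp
  next
    case False
    with that q have "q = 1" "0 < \<theta>" "\<theta> < pi" by auto
    moreover from this have "cos pi < cos \<theta>" by (intro cos_monotone_0_pi) auto
    ultimately show ?thesis by simp
  qed
  have "((\<lambda>x. semicircle_density \<alpha> \<beta> x * (1 / (x - x0))) has_integral (G pi - G 0)) UNIV"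
  proof (rule has_integral_semicircle_density[OF b])
    show "continuous_on {0..pi} G"
    proof (cases "q = 1")
      case True
      with b show ?thesis unfolding G_def by (auto intro!: continuous_intros)
    next
      case False
      with q have "1 + q * cos \<theta> \<noteq> 0" for \<theta> using pos[of \<theta>] by force
      then show ?thesis unfolding G_def using q b by (auto intro!: continuous_intros)
    qed
    fix \<theta> :: real assume th: "0 < \<theta>" "\<theta> < pi"
    define s where "s = sin \<theta>"
    define c where "c = cos \<theta>"
    have sc: "s\<^sup>2 = 1 - c\<^sup>2" unfolding s_def c_def by (rule sin_squared_eq)
    have p: "1 + q * c > 0" using pos th by (simp add: c_def)
    have pp: "1 + 2 * q * c + q\<^sup>2 > 0"
    proof -
      have "s > 0" using th by (simp add: s_def sin_gt_zero)
      moreover have "1 + 2 * q * c + q\<^sup>2 = (1 + q * c)\<^sup>2 + q\<^sup>2 * s\<^sup>2" unfolding sc by algebra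
      ultimately show ?thesis using p by (simp add: add_pos_nonneg)
    qed
    have "((\<lambda>\<theta>. q * sin \<theta> / (1 + q * cos \<theta>)) has_real_derivative
        (q * c * (1 + q * c) + q * s * (q * s)) / (1 + q * c)\<^sup>2) (at \<theta>)"
      using p unfolding s_def c_def by (auto intro!: derivative_eq_intros simp: power2_eq_square)
    from DERIV_chain2[OF DERIV_arctan this]
    have "((\<lambda>\<theta>. arctan (q * sin \<theta> / (1 + q * cos \<theta>))) has_real_derivative
        inverse (1 + (q * s / (1 + q * c))\<^sup>2) * ((q * c * (1 + q * c) + q * s * (q * s)) / (1 + q * c)\<^sup>2)) (at \<theta>)"
      by (simp add: s_def c_def)
    also have "inverse (1 + (q * s / (1 + q * c))\<^sup>2) * ((q * c * (1 + q * c) + q * s * (q * s)) / (1 + q * c)\<^sup>2)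
       = (q * c + q\<^sup>2) / (1 + 2 * q * c + q\<^sup>2)"
    proof -
      have "1 + (q * s / (1 + q * c))\<^sup>2 = (1 + 2 * q * c + q\<^sup>2) / (1 + q * c)\<^sup>2"
        using p sc by (simp add: power_divide field_simps) algebra
      moreover have "q * c * (1 + q * c) + q * s * (q * s) = q * c + q\<^sup>2" using sc by algebra
      ultimately show ?thesis using p by simp
    qed
    finally have d: "((\<lambda>\<theta>. arctan (q * sin \<theta> / (1 + q * cos \<theta>))) has_real_derivative
       (q * c + q\<^sup>2) / (1 + 2 * q * c + q\<^sup>2)) (at \<theta>)" .
    have "((\<lambda>\<theta>. \<theta> / 2 - sin \<theta> / (2 * q)) has_real_derivative 1 / 2 - c / (2 * q)) (at \<theta>)"
      using q unfolding c_def by (auto intro!: derivative_eq_intros)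
    then have dG: "(G has_real_derivative 2 * q / (pi * sqrt \<beta>) * (1 / 2 - c / (2 * q)
       + (1 - q\<^sup>2) / (2 * q\<^sup>2) * ((q * c + q\<^sup>2) / (1 + 2 * q * c + q\<^sup>2)))) (at \<theta>)"
      unfolding G_def by (intro DERIV_cmult DERIV_add d)
    have e: "1 / 2 - c / (2 * q) + (1 - q\<^sup>2) / (2 * q\<^sup>2) * ((q * c + q\<^sup>2) / (1 + 2 * q * c + q\<^sup>2))
       = s\<^sup>2 / (1 + 2 * q * c + q\<^sup>2)"
      unfolding sc using pp q by (simp add: divide_simps) algebra
    have "1 / (\<alpha> + 2 * sqrt \<beta> * c - x0) = q / (sqrt \<beta> * (1 + 2 * q * c + q\<^sup>2))"
    proof -
      have "\<alpha> + 2 * sqrt \<beta> * c - x0 = sqrt \<beta> * (1 + 2 * q * c + q\<^sup>2) / q"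
        using x0 q by (simp add: field_simps power2_eq_square)
      then show ?thesis by simp
    qed
    then have "1 / (\<alpha> + 2 * sqrt \<beta> * c - x0) * (2 / pi * s\<^sup>2)
        = 2 * q / (pi * sqrt \<beta>) * (s\<^sup>2 / (1 + 2 * q * c + q\<^sup>2))"
      by (simp add: mult_ac)
    with dG show "(G has_real_derivative
        1 / (\<alpha> + 2 * sqrt \<beta> * cos \<theta> - x0) * (2 / pi * (sin \<theta>)\<^sup>2)) (at \<theta>)"
      unfolding e by (simp only: s_def[symmetric] c_def[symmetric])
  qed
  moreover have "G pi - G 0 = q / sqrt \<beta>" by (simp add: G_def)
  \<comment> \<open>By q + 1 / q \<ge> 2 the point x0 is not inside the support; at x = x0 the
    quotient is 0 by convention.\<close>
  moreover have "1 / (x - x0) \<ge> 0" if "(x - \<alpha>)\<^sup>2 \<le> 4 * \<beta>" for x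
  proof -
    have "q + 1 / q \<ge> 2"
    proof -
      have "(1 - q)\<^sup>2 \<ge> 0" by simp
      with q show ?thesis by (simp add: field_simps power2_eq_square)
    qed
    then have "sqrt \<beta> * 2 \<le> sqrt \<beta> * (q + 1 / q)" using b by (intro mult_left_mono) auto
    moreover have "x \<in> {\<alpha> - 2 * sqrt \<beta> .. \<alpha> + 2 * sqrt \<beta>}" using semicircle_interval_iff[OF b] that by blast
    ultimately show ?thesis using x0 by simp
  qed
  ultimately show ?thesis
    by (intro has_bochner_integral_semicircle_nonneg[OF b]) auto
qed

text \<open>Here q = u / sqrt \<beta>. In the applications \<alpha> - x0 splits as a sum of two
  factors of \<beta>, and the transform is the reciprocal of the larger one; which one is larger
  later decides whether there is an atom.\<close>

lemma semicircle_resolvent':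
  assumes "u > 0" "w > 0" "u * w = \<beta>" "u \<le> w" "\<alpha> - x0 = u + w"
  shows "has_bochner_integral (semicircle \<alpha> \<beta>) (\<lambda>x. 1 / (x - x0)) (1 / w)"
proof -
  have b: "\<beta> > 0" and sb: "\<beta> = sqrt \<beta> * sqrt \<beta>" using assms by auto
  have "u\<^sup>2 \<le> \<beta>" using assms by (auto simp: power2_eq_square)
  then have "u \<le> sqrt \<beta>" by (simp add: real_le_rsqrt)
  then have "has_bochner_integral (semicircle \<alpha> \<beta>) (\<lambda>x. 1 / (x - x0)) (u / sqrt \<beta> / sqrt \<beta>)"
    using assms b sb by (intro semicircle_resolvent) (auto simp: field_simps)
  moreover have "u / sqrt \<beta> / sqrt \<beta> = 1 / w"
    using assms b sb by (auto simp: field_simps)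
  ultimately show ?thesis by simp
qed

text \<open>By (u + w)^2 - 4 u w = (u - w)^2 \<ge> 0, the distance from x0 to the centre is at least
  the radius.\<close>

lemma semicircle_right_of:
  fixes x :: real
  assumes "u > 0" "w > 0" "u * w = \<beta>" "\<alpha> - x0 = u + w" "(x - \<alpha>)\<^sup>2 < 4 * \<beta>"
  shows "x > x0"
proof (rule ccontr)
  assume "\<not> x > x0"
  then have "\<alpha> - x \<ge> u + w" using assms by simp
  then have "(u + w)\<^sup>2 \<le> (\<alpha> - x)\<^sup>2" using assms by (intro power_mono) auto
  moreover have "(u + w)\<^sup>2 = 4 * \<beta> + (u - w)\<^sup>2" unfolding assms(3)[symmetric] by algebra
  ultimately show False using assms(5) zero_le_power2[of "u - w"] by (simp add: power2_commute)
qed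

section \<open>Semicircle densities with an atom\<close>

lemma sets_scale_density [simp, measurable_cong]: "sets (scale_density f M) = sets M"
  by (simp add: scale_density_def)

lemma space_scale_density [simp]: "space (scale_density f M) = space M"
  by (simp add: scale_density_def)

lemma sets_add_measure [simp, measurable_cong]: "sets (add_measure M N) = sets M"
  by (simp add: add_measure_def sets.sets_measure_of_eq)

lemma space_add_measure [simp]: "space (add_measure M N) = space M"
  by (simp add: add_measure_def)

text \<open>\<open>measure_of\<close> returns the intended set function only once it is known to be
  positive and countably additive.\<close>

lemma emeasure_add_measure:
  assumes "sets N = sets M" "A \<in> sets M"
  shows "emeasure (add_measure M N) A = emeasure M A + emeasure N A"
  unfolding add_measure_def
proof (rule emeasure_measure_of_sigma)
  show "sigma_algebra (space M) (sets M)" by (rule sets.sigma_algebra_axioms)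
  show "positive (sets M) (\<lambda>A. emeasure M A + emeasure N A)" by (simp add: positive_def)
  show "countably_additive (sets M) (\<lambda>A. emeasure M A + emeasure N A)"
  proof (rule countably_additiveI)
    fix A :: "nat \<Rightarrow> _" assume A: "range A \<subseteq> sets M" "disjoint_family A"
    have "(\<Sum>i. emeasure M (A i) + emeasure N (A i)) = (\<Sum>i. emeasure M (A i)) + (\<Sum>i. emeasure N (A i))"
      by (rule suminf_add[symmetric]) auto
    then show "(\<Sum>i. emeasure M (A i) + emeasure N (A i)) = emeasure M (\<Union> (range A)) + emeasure N (\<Union> (range A))"
      using A assms(1) by (simp add: suminf_emeasure)
  qed
qed (use assms in auto)

lemma nn_integral_add_measure:
  assumes N: "sets N = sets M" and f: "f \<in> borel_measurable M"
  shows "(\<integral>\<^sup>+x. f x \<partial>add_measure M N) = (\<integral>\<^sup>+x. f x \<partial>M) + (\<integral>\<^sup>+x. f x \<partial>N)"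
  using f
proof induction
  case (cong f g)
  moreover have "space N = space M" using N by (rule sets_eq_imp_space_eq)
  ultimately show ?case
    using nn_integral_cong[of "add_measure M N" f g] nn_integral_cong[of M f g] nn_integral_cong[of N f g] by simp
next
  case (set A)
  then show ?case using N by (simp add: emeasure_add_measure)
next
  case (mult u c)
  have [measurable]: "u \<in> borel_measurable M" "u \<in> borel_measurable N" "u \<in> borel_measurable (add_measure M N)"
    using mult N by (auto cong: measurable_cong_sets)
  show ?case using mult by (simp add: nn_integral_cmult distrib_left)
next
  case (add u v)
  have [measurable]: "u \<in> borel_measurable M" "u \<in> borel_measurable N" "u \<in> borel_measurable (add_measure M N)"
    "v \<in> borel_measurable M" "v \<in> borel_measurable N" "v \<in> borel_measurable (add_measure M N)"
    using add N by (auto cong: measurable_cong_sets)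
  show ?case using add by (simp add: nn_integral_add ac_simps)
next
  case (seq U)
  have m: "U i \<in> borel_measurable M" "U i \<in> borel_measurable N" "U i \<in> borel_measurable (add_measure M N)" for i
    using seq(1)[of i] N by (auto cong: measurable_cong_sets)
  have "(\<integral>\<^sup>+x. Sup (range U) x \<partial>K) = (SUP i. \<integral>\<^sup>+x. U i x \<partial>K)" if "\<And>i. U i \<in> borel_measurable K" for K
    using nn_integral_monotone_convergence_SUP[of U K] seq that by (simp add: SUP_apply image_comp)
  moreover have "(SUP i. (\<integral>\<^sup>+x. U i x \<partial>M) + (\<integral>\<^sup>+x. U i x \<partial>N)) = (SUP i. \<integral>\<^sup>+x. U i x \<partial>M) + (SUP i. \<integral>\<^sup>+x. U i x \<partial>N)"
    using seq(3) by (intro ennreal_SUP_add) (auto intro!: monoI nn_integral_mono simp: incseq_def le_fun_def)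
  ultimately show ?case using m seq by simp
qed

lemma integral_add_measure:
  fixes f :: "'a \<Rightarrow> real"
  assumes N: "sets N = sets M" and "integrable M f" "integrable N f"
  shows "integrable (add_measure M N) f"
    and "(\<integral>x. f x \<partial>add_measure M N) = (\<integral>x. f x \<partial>M) + (\<integral>x. f x \<partial>N)"
proof -
  have m [measurable]: "f \<in> borel_measurable M" "f \<in> borel_measurable (add_measure M N)"
    using assms(2) by auto
  show i: "integrable (add_measure M N) f"
    using assms by (auto simp: integrable_iff_bounded nn_integral_add_measure)
  have fin: "(\<integral>\<^sup>+x. ennreal (f x) \<partial>K) < \<infinity>" "(\<integral>\<^sup>+x. ennreal (- f x) \<partial>K) < \<infinity>" if "integrable K f" for K
    using that by (auto simp: real_integrable_def top.not_eq_extremum)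
  show "(\<integral>x. f x \<partial>add_measure M N) = (\<integral>x. f x \<partial>M) + (\<integral>x. f x \<partial>N)"
    unfolding real_lebesgue_integral_def[OF i] real_lebesgue_integral_def[OF assms(2)]
      real_lebesgue_integral_def[OF assms(3)]
    using fin[OF assms(2)] fin[OF assms(3)] N by (simp add: nn_integral_add_measure enn2real_plus)
qed

lemma finite_momentsI:
  assumes "prob_space M" "sets M = sets borel" "AE x in M. \<bar>x\<bar> \<le> C"
  shows "finite_moments M"
  unfolding finite_moments_def
proof
  fix n
  interpret prob_space M by fact
  show "integrable M (\<lambda>x. x ^ n)"
  proof (rule integrable_const_bound)
    show "(\<lambda>x. x ^ n) \<in> borel_measurable M" using assms(2) by (simp cong: measurable_cong_sets)
    show "AE x in M. norm (x ^ n) \<le> C ^ n"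
      using assms(3) by eventually_elim (simp add: power_abs power_mono)
  qed
qed

text \<open>One template for all the laws, with \<open>\<kappa>\<close> = 0 when there is no atom.
  Sign conditions on \<open>h\<close> are imposed only in the open support, so a pole at the edge is
  allowed.\<close>

locale semicircle_mixture =
  fixes \<alpha> \<beta> \<kappa> x0 :: real and h :: "real \<Rightarrow> real" and M :: "real measure"
  assumes \<beta>_pos: "\<beta> > 0"
    and measurable_h [measurable]: "h \<in> borel_measurable borel"
    and h_nonneg: "\<And>x. (x - \<alpha>)\<^sup>2 < 4 * \<beta> \<Longrightarrow> h x \<ge> 0"
    and \<kappa>_nonneg: "\<kappa> \<ge> 0"
    and integrable_h: "integrable (semicircle \<alpha> \<beta>) h"
    and total_mass: "(\<integral>x. h x \<partial>semicircle \<alpha> \<beta>) + \<kappa> = 1"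
    and M_eq: "M = add_measure (scale_density h (semicircle \<alpha> \<beta>)) (scale_density (\<lambda>_. \<kappa>) (return borel x0))"
begin

lemma AE_h_nonneg: "AE x in semicircle \<alpha> \<beta>. 0 \<le> h x"
  using AE_semicircle[OF \<beta>_pos] by eventually_elim (rule h_nonneg)

lemma sets_M: "sets M = sets borel"
  by (simp add: M_eq)

lemma prob_space_M: "prob_space M"
proof
  have "emeasure M (space M) = (\<integral>\<^sup>+x. ennreal (h x) \<partial>semicircle \<alpha> \<beta>) + ennreal \<kappa>"
    using \<beta>_pos by (simp add: M_eq emeasure_add_measure scale_density_def emeasure_density)
  also have "(\<integral>\<^sup>+x. ennreal (h x) \<partial>semicircle \<alpha> \<beta>) = ennreal (\<integral>x. h x \<partial>semicircle \<alpha> \<beta>)"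
    by (rule nn_integral_eq_integral[OF integrable_h AE_h_nonneg])
  also have "\<dots> + ennreal \<kappa> = ennreal ((\<integral>x. h x \<partial>semicircle \<alpha> \<beta>) + \<kappa>)"
    using AE_h_nonneg \<kappa>_nonneg by (intro ennreal_plus[symmetric] integral_nonneg_AE)
  finally show "emeasure M (space M) = 1" by (simp add: total_mass)
qed

text \<open>\<open>h\<close> may be unbounded at the edge (the free Poisson law at t = 1), so
  \<open>h\<close> times \<open>p\<close> is dominated by a multiple of \<open>h\<close>, the
  continuous \<open>p\<close> being bounded on the compact support.\<close>

lemma integrable_h_mult:
  assumes p: "continuous_on UNIV p"
  shows "integrable (semicircle \<alpha> \<beta>) (\<lambda>x. h x * p x)"
proof -
  let ?I = "{\<alpha> - 2 * sqrt \<beta> .. \<alpha> + 2 * sqrt \<beta>}"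
  have [measurable]: "p \<in> borel_measurable borel" by (rule borel_measurable_continuous_onI[OF p])
  have "compact (p ` ?I)" by (intro compact_continuous_image continuous_on_subset[OF p]) auto
  then obtain B where B: "\<And>x. x \<in> ?I \<Longrightarrow> \<bar>p x\<bar> \<le> B"
    using compact_imp_bounded bounded_iff by (metis imageI real_norm_def)
  show ?thesis
  proof (rule Bochner_Integration.integrable_bound)
    show "integrable (semicircle \<alpha> \<beta>) (\<lambda>x. B * h x)" using integrable_h by simp
    show "AE x in semicircle \<alpha> \<beta>. norm (h x * p x) \<le> norm (B * h x)"
      using AE_semicircle[OF \<beta>_pos] AE_h_nonneg
    proof eventually_elim
      case (elim x)
      then have "x \<in> ?I" using semicircle_interval_iff[OF \<beta>_pos] by (metis less_imp_le)
      then have "\<bar>p x\<bar> \<le> B" by (rule B)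
      then have "\<bar>h x\<bar> * \<bar>p x\<bar> \<le> \<bar>h x\<bar> * \<bar>B\<bar>" by (intro mult_left_mono) auto
      then show ?case by (simp add: abs_mult mult.commute)
    qed
  qed simp
qed

lemma integral_M:
  assumes p: "continuous_on UNIV p"
  shows "(\<integral>x. p x \<partial>M) = (\<integral>x. h x * p x \<partial>semicircle \<alpha> \<beta>) + \<kappa> * p x0"
proof -
  have [measurable]: "p \<in> borel_measurable borel" by (rule borel_measurable_continuous_onI[OF p])
  have 1: "integrable (scale_density h (semicircle \<alpha> \<beta>)) p"
    "(\<integral>x. p x \<partial>scale_density h (semicircle \<alpha> \<beta>)) = (\<integral>x. h x * p x \<partial>semicircle \<alpha> \<beta>)"
    using integrable_h_mult[OF p] AE_h_nonneg
    by (simp_all add: scale_density_def integrable_density integral_density)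
  have 2: "integrable (scale_density (\<lambda>_. \<kappa>) (return borel x0)) p"
    "(\<integral>x. p x \<partial>scale_density (\<lambda>_. \<kappa>) (return borel x0)) = \<kappa> * p x0"
  proof -
    have "integrable (return borel x0) (\<lambda>x. \<kappa> *\<^sub>R p x)"
      by (simp add: integrable_iff_bounded nn_integral_return)
    then show "integrable (scale_density (\<lambda>_. \<kappa>) (return borel x0)) p"
      unfolding scale_density_def using \<kappa>_nonneg by (subst integrable_density) auto
    show "(\<integral>x. p x \<partial>scale_density (\<lambda>_. \<kappa>) (return borel x0)) = \<kappa> * p x0"
      using \<kappa>_nonneg by (simp add: scale_density_def integral_density integral_return)
  qed
  show ?thesis
    unfolding M_eq using integral_add_measure(2)[OF _ 1(1) 2(1)] 1 2 by simp
qed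

lemma AE_bounded: "\<exists>C. AE x in M. \<bar>x\<bar> \<le> C"
proof -
  define C where "C = \<bar>\<alpha>\<bar> + 2 * sqrt \<beta> + \<bar>x0\<bar>"
  have A: "{x::real. \<not> \<bar>x\<bar> \<le> C} \<in> sets borel" by measurable
  have "AE x in scale_density h (semicircle \<alpha> \<beta>). \<bar>x\<bar> \<le> C"
    unfolding scale_density_def
  proof (subst AE_density)
    show "AE x in semicircle \<alpha> \<beta>. 0 < ennreal (h x) \<longrightarrow> \<bar>x\<bar> \<le> C"
      using AE_semicircle[OF \<beta>_pos]
    proof eventually_elim
      case (elim x)
      then have "x \<in> {\<alpha> - 2 * sqrt \<beta> .. \<alpha> + 2 * sqrt \<beta>}"
        using semicircle_interval_iff[OF \<beta>_pos] by (metis less_imp_le)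
      then show ?case by (auto simp: C_def)
    qed
  qed simp
  then have 1: "emeasure (scale_density h (semicircle \<alpha> \<beta>)) {x. \<not> \<bar>x\<bar> \<le> C} = 0"
    using A by (subst (asm) AE_iff_measurable[of "{x. \<not> \<bar>x\<bar> \<le> C}"]) auto
  have "x0 \<notin> {x. \<not> \<bar>x\<bar> \<le> C}" using \<beta>_pos by (simp add: C_def)
  then have 2: "emeasure (scale_density (\<lambda>_. \<kappa>) (return borel x0)) {x. \<not> \<bar>x\<bar> \<le> C} = 0"
    using A by (simp add: scale_density_def emeasure_density nn_integral_cmult)
  have "emeasure M {x. \<not> \<bar>x\<bar> \<le> C} = 0"
    unfolding M_eq using 1 2 A by (subst emeasure_add_measure) auto
  then have "AE x in M. \<bar>x\<bar> \<le> C"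
    using A by (subst AE_iff_measurable[of "{x. \<not> \<bar>x\<bar> \<le> C}"]) (auto simp: M_eq)
  then show ?thesis ..
qed

end

text \<open>Brings laws without an atom into the form of the template.\<close>

lemma scale_density_eq_add_measure:
  "scale_density h (semicircle \<alpha> \<beta>) =
    add_measure (scale_density h (semicircle \<alpha> \<beta>)) (scale_density (\<lambda>_. 0) (return borel x0))"
  by (rule measure_eqI) (simp_all add: emeasure_add_measure scale_density_def[of "\<lambda>_. 0"] emeasure_density)

section \<open>Semicircular and free Poisson semigroups\<close>

text \<open>The integral condition is the one from which both orthogonality and the R-transform
  follow; bounded support makes the law determined by its moments.\<close>

definition meixner_measure :: "real \<Rightarrow> real \<Rightarrow> real \<Rightarrow> real \<Rightarrow> real \<Rightarrow> real measure \<Rightarrow> bool" where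
  "meixner_measure e d r v t M \<longleftrightarrow> prob_space M \<and> sets M = sets borel \<and> (\<exists>C. AE x in M. \<bar>x\<bar> \<le> C) \<and>
     (\<forall>n. (\<integral>x. meixner_poly e d r v n x t \<partial>M) = (if n = 0 then 1 else 0))"

lemma continuous_on_meixner_poly: "continuous_on A (\<lambda>x. meixner_poly e d r v n x t)"
proof -
  obtain q where "\<And>x. meixner_poly e d r v n x t = poly q x" using meixner_poly_monic by blast
  then show ?thesis by (auto intro!: continuous_intros)
qed

lemma borel_measurable_meixner_poly [measurable]: "(\<lambda>x. meixner_poly e d r v n x t) \<in> borel_measurable borel"
  by (rule borel_measurable_continuous_onI[OF continuous_on_meixner_poly])

text \<open>At x = t = 0 the recurrence coefficients in front of P 0 vanish, so every later
  polynomial is 0 there.\<close>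

lemma meixner_measure_0: "meixner_measure e d r v 0 (return borel 0)"
proof -
  have "meixner_poly e d r v n 0 0 = (if n = 0 then 1 else 0)" for n
  proof (induction n rule: less_induct)
    case (less n)
    then show ?case
      using meixner_poly_rec[of e d r v "n - 1" 0 0] by (cases n) (auto split: if_splits)
  qed
  moreover have "prob_space (return borel (0::real))" by (rule prob_space_return) simp
  moreover have "AE x in return borel 0. \<bar>x\<bar> \<le> (1::real)" by (subst AE_return) auto
  ultimately show ?thesis unfolding meixner_measure_def by (auto simp: integral_return)
qed

lemma (in semicircle_mixture) meixner_measureI:
  assumes "\<And>n. (\<integral>x. meixner_poly e d r v (Suc n) x t \<partial>M) = 0"
  shows "meixner_measure e d r v t M"
proof -
  interpret prob_space M by (rule prob_space_M)
  have "(\<integral>x. meixner_poly e d r v n x t \<partial>M) = (if n = 0 then 1 else 0)" for n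
    using assms by (cases n) (simp_all add: prob_space)
  then show ?thesis
    using prob_space_M sets_M AE_bounded by (simp add: meixner_measure_def)
qed

lemma integrable_ident:
  assumes "finite_moments M"
  shows "integrable M (\<lambda>x. x)"
proof -
  have "integrable M (\<lambda>x. x ^ 1)" using assms unfolding finite_moments_def by blast
  then show ?thesis by simp
qed

lemma prob_space_integral_const:
  "prob_space M \<Longrightarrow> (\<integral>x. c \<partial>M) = (c::real)"
  by (simp add: prob_space.prob_space)

lemma integral_meixner_poly_1:
  assumes "prob_space M" "finite_moments M"
  shows "(\<integral>x. meixner_poly e d r v (Suc 0) x t \<partial>M) = (\<integral>x. x \<partial>M) - r * t"
  using prob_space_integral_const[OF assms(1), of "r * t"] integrable_ident[OF assms(2)]
    finite_measure.integrable_const[OF prob_space.finite_measure[OF assms(1)], of "r * t"] by simp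

lemma meixner_measure_semi:
  assumes "t \<ge> 0"
  shows "meixner_measure 0 0 0 1 t (mu_semi t)"
proof (cases "t = 0")
  case True
  then show ?thesis using meixner_measure_0 by (simp add: mu_semi_def semicircle_def)
next
  case False
  with assms have t: "t > 0" by simp
  interpret prob_space "semicircle 0 t" by (rule prob_space_semicircle[OF t])
  interpret semicircle_mixture 0 t 0 0 "\<lambda>_. 1" "semicircle 0 t"
  proof
    have "scale_density (\<lambda>_. 1) (semicircle 0 t) = semicircle 0 t"
      by (simp add: scale_density_def density_1)
    then show "semicircle 0 t = add_measure (scale_density (\<lambda>_. 1) (semicircle 0 t))
        (scale_density (\<lambda>_. 0) (return borel 0))"
      using scale_density_eq_add_measure[of "\<lambda>_. 1" 0 t 0] by simp
  qed (use t prob_space in auto)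
  show ?thesis unfolding mu_semi_def
  proof (rule meixner_measureI)
    fix n
    have "meixner_poly 0 0 0 1 (Suc n) x t = chebU2 (Suc n) (x - 0) t" for x
      using t meixner_poly_eq_chebU2_1[of 0 1 t 0 0 x] meixner_poly_eq_chebU2[of 0 1 t 0 0 "n - 1" x]
      by (cases n) simp_all
    then show "(\<integral>x. meixner_poly 0 0 0 1 (Suc n) x t \<partial>semicircle 0 t) = 0"
      using integral_chebU2[OF t, where n = "Suc n" and \<alpha> = 0] by simp
  qed
qed

lemma mu_poi_0: "mu_poi 0 = return borel 0"
  by (rule measure_eqI)
     (simp_all add: mu_poi_def emeasure_add_measure, simp add: scale_density_def emeasure_density)

text \<open>Here D = x. The only information missing from x times the law is its total mass.\<close>

lemma meixner_measure_poi:
  assumes "t \<ge> 0"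
  shows "meixner_measure 1 0 1 1 t (mu_poi t)"
proof (cases "t = 0")
  case True
  then show ?thesis using meixner_measure_0 mu_poi_0 by simp
next
  case False
  with assms have t: "t > 0" by simp
  let ?S = "semicircle (1 + t) t"
  interpret S: prob_space ?S by (rule prob_space_semicircle[OF t])
  \<comment> \<open>Since 1 + t is the sum and t the product of 1 and t, the transform at 0 is 1 /
    max(1, t). The density has mass min(t, 1), and the atom supplies max(1 - t, 0).\<close>
  define E where "E = (if t \<le> 1 then 1 else 1 / t)"
  have E: "has_bochner_integral ?S (\<lambda>x. 1 / (x - 0)) E"
    using t semicircle_resolvent'[of t 1 t "1 + t" 0] semicircle_resolvent'[of 1 t t "1 + t" 0]
    by (auto simp: E_def)
  have pos: "x > 0" if "(x - (1 + t))\<^sup>2 < 4 * t" for x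
    using semicircle_right_of[of t 1 t "1 + t" 0 x] t that by simp
  have h: "has_bochner_integral ?S (\<lambda>x. t / x) (t * E)"
    using has_bochner_integral_mult_right[OF E, of t] by simp
  interpret semicircle_mixture "1 + t" t "max (1 - t) 0" 0 "\<lambda>x. t / x" "mu_poi t"
  proof
    show "(\<integral>x. t / x \<partial>?S) + max (1 - t) 0 = 1"
      using has_bochner_integral_integral_eq[OF h] t by (auto simp: E_def)
  qed (use t h pos in \<open>auto simp: mu_poi_def integrable.simps intro: less_imp_le\<close>)
  have L1: "(\<integral>x. 1 \<partial>mu_poi t) = (1::real)" by (rule prob_space_integral_const[OF prob_space_M])
  \<comment> \<open>Multiplication by x kills the atom at 0 and cancels the density, leaving t times
    the semicircle law.\<close>
  have Lx: "(\<integral>x. x * p x \<partial>mu_poi t) = t * (\<integral>x. p x \<partial>?S)" if p: "continuous_on UNIV p" for p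
  proof -
    have [measurable]: "p \<in> borel_measurable borel" by (rule borel_measurable_continuous_onI[OF p])
    have "(\<integral>x. x * p x \<partial>mu_poi t) = (\<integral>x. t / x * (x * p x) \<partial>?S)"
      using integral_M[of "\<lambda>x. x * p x"] p by (simp add: continuous_on_mult continuous_on_id)
    also have "\<dots> = (\<integral>x. t * p x \<partial>?S)"
    proof (rule integral_cong_AE)
      show "AE x in ?S. t / x * (x * p x) = t * p x"
        using AE_semicircle[OF t] by eventually_elim (use pos in force)
    qed auto
    finally show ?thesis by simp
  qed
  let ?P = "\<lambda>n x. meixner_poly 1 0 1 1 n x t"
  let ?Q = "\<lambda>n x. chebU2 n (x - (1 + t)) t"
  have fm: "finite_moments (mu_poi t)"
    using AE_bounded finite_momentsI[OF prob_space_M sets_M] by blast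
  note i [simp] = integrable_meixner_poly[OF fm]
  show ?thesis
  proof (rule meixner_measureI)
    fix n show "(\<integral>x. ?P (Suc n) x \<partial>mu_poi t) = 0"
    proof (induction n)
      case 0
      have "(\<integral>x. x * 1 \<partial>mu_poi t) = t * (\<integral>x. 1 \<partial>?S)" by (rule Lx) (rule continuous_on_const)
      then have "(\<integral>x. x \<partial>mu_poi t) = t"
        using prob_space_integral_const[OF S.prob_space_axioms, of 1] by simp
      then show ?case by (simp add: integral_meixner_poly_1[OF prob_space_M fm] del: meixner_poly.simps)
    next
      case (Suc n)
      have P1: "?P (Suc n) x = ?Q (Suc n) x + ?Q n x" for x
        using t meixner_poly_eq_chebU2_1[of 0 1 t 1 1 x] meixner_poly_eq_chebU2[of 0 1 t 1 1 "n - 1" x]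
        by (cases n) simp_all
      have P2: "?P (Suc (Suc n)) x = ?Q (Suc (Suc n)) x + ?Q (Suc n) x" for x
        using t meixner_poly_eq_chebU2[of 0 1 t 1 1 n x] by simp
      \<comment> \<open>Multiplying a Chebyshev polynomial by D = x gives two consecutive P, so one
        vanishing integral yields the next.\<close>
      have "?P (Suc (Suc n)) x = x * ?Q (Suc n) x - t * ?P (Suc n) x" for x
        unfolding P1 P2 using chebU2_Suc_Suc[of t n "x - (1 + t)"] t by (simp add: algebra_simps)
      moreover have "integrable (mu_poi t) (\<lambda>x. x * ?Q (Suc n) x)"
      proof -
        have "x * ?Q (Suc n) x = ?P (Suc (Suc n)) x + t * ?P (Suc n) x" for x
          unfolding P1 P2 using chebU2_Suc_Suc[of t n "x - (1 + t)"] t by (simp add: algebra_simps)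
        then show ?thesis by simp
      qed
      ultimately have "(\<integral>x. ?P (Suc (Suc n)) x \<partial>mu_poi t)
          = (\<integral>x. x * ?Q (Suc n) x \<partial>mu_poi t) - t * (\<integral>x. ?P (Suc n) x \<partial>mu_poi t)" by simp
      also have "\<dots> = 0"
        using Lx[OF continuous_on_chebU2] integral_chebU2[OF t, where n = "Suc n" and \<alpha> = "1 + t"] Suc.IH by simp
      finally show ?case .
    qed
  qed
qed

section \<open>The three families with quadratic denominator\<close>

lemma meixner_poly3_eq_chebU2:
  assumes "\<beta> = t + 1" "t > 0"
  shows "meixner_poly (2 * a) 1 a 1 (Suc (Suc n)) x t = chebU2 (Suc (Suc n)) (x - (2 * a + a * t)) \<beta>
      + 2 * a * chebU2 (Suc n) (x - (2 * a + a * t)) \<beta> + chebU2 n (x - (2 * a + a * t)) \<beta>"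
    and "meixner_poly (2 * a) 1 a 1 (Suc 0) x t = chebU2 (Suc 0) (x - (2 * a + a * t)) \<beta>
      + 2 * a * chebU2 0 (x - (2 * a + a * t)) \<beta>"
  using meixner_poly_eq_chebU2[of 1 1 t "2 * a" a n x] meixner_poly_eq_chebU2_1[of 1 1 t "2 * a" a x] assms
  by (simp_all add: add.commute)

lemma quadratic_eq_meixner_poly3:
  assumes "\<beta> = t + 1"
  shows "x\<^sup>2 + t\<^sup>2 * (1 - a\<^sup>2) = t * \<beta> + 2 * a * \<beta> * meixner_poly (2 * a) 1 a 1 (Suc 0) x t
    + meixner_poly (2 * a) 1 a 1 (Suc (Suc 0)) x t"
  unfolding assms by (simp add: algebra_simps power2_eq_square)

text \<open>With x - \<alpha> = z + \<beta> / z and f(z) = 1 + 2 a / z + 1 / z^2, the quadratic is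
  \<beta>^2 f(z) f(\<beta> / z). Passing from Q to P contributes f(z); the complementary factor
  \<beta>^2 + 2 a \<beta> z + z^2 gives the three coefficients on the right.\<close>

lemma quadratic_chebU2_eq_meixner_poly3:
  assumes b: "\<beta> = t + 1" and t: "t > 0"
  shows "(x\<^sup>2 + t\<^sup>2 * (1 - a\<^sup>2)) * chebU2 (Suc n) (x - (2 * a + a * t)) \<beta> =
    \<beta>\<^sup>2 * meixner_poly (2 * a) 1 a 1 (Suc n) x t + 2 * a * \<beta> * meixner_poly (2 * a) 1 a 1 (Suc (Suc n)) x t
    + meixner_poly (2 * a) 1 a 1 (Suc (Suc (Suc n))) x t"
proof -
  define y where "y = x - (2 * a + a * t)"
  define Q where "Q = (\<lambda>n. chebU2 n y \<beta>)"
  have x: "x = y + 2 * a + a * t" by (simp add: y_def)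
  have b0: "\<beta> \<ge> 0" using assms by simp
  have Q: "Q (Suc (Suc k)) = y * Q (Suc k) - \<beta> * Q k" "Q 0 = 1" "Q (Suc 0) = y" for k
    unfolding Q_def using chebU2_Suc_Suc[OF b0] b0 by simp_all
  have P: "meixner_poly (2 * a) 1 a 1 (Suc (Suc k)) x t = Q (Suc (Suc k)) + 2 * a * Q (Suc k) + Q k"
    "meixner_poly (2 * a) 1 a 1 (Suc 0) x t = Q (Suc 0) + 2 * a * Q 0" for k
    unfolding Q_def y_def by (rule meixner_poly3_eq_chebU2[OF assms])+
  have goal_Q: "chebU2 (Suc n) (x - (2 * a + a * t)) \<beta> = Q (Suc n)" by (simp add: Q_def y_def)
  show ?thesis
  proof (cases n)
    case 0
    show ?thesis unfolding goal_Q unfolding 0 P Q unfolding x b by algebra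
  next
    case (Suc m)
    show ?thesis unfolding goal_Q unfolding Suc P Q unfolding x b by algebra
  qed
qed

text \<open>Total mass and mean are the two values that D times the law does not see. The mean
  settles P 1, testing with the constant 1 settles P 2, and testing with Chebyshev polynomials
  propagates to all later ones.\<close>

lemma (in semicircle_mixture) meixner_measure3I:
  assumes \<beta>: "\<beta> = t + 1" and \<alpha>: "\<alpha> = 2 * a + a * t" and t: "t > 0"
    and h: "\<And>x. (x - \<alpha>)\<^sup>2 < 4 * \<beta> \<Longrightarrow> h x * (x\<^sup>2 + t\<^sup>2 * (1 - a\<^sup>2)) = t * \<beta>"
    and x0: "\<kappa> * (x0\<^sup>2 + t\<^sup>2 * (1 - a\<^sup>2)) = 0"
    and mean: "(\<integral>x. h x * x \<partial>semicircle \<alpha> \<beta>) + \<kappa> * x0 = a * t"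
  shows "meixner_measure (2 * a) 1 a 1 t M"
proof (rule meixner_measureI)
  let ?P = "\<lambda>n x. meixner_poly (2 * a) 1 a 1 n x t"
  let ?D = "\<lambda>x. x\<^sup>2 + t\<^sup>2 * (1 - a\<^sup>2)"
  have fm: "finite_moments M"
    using AE_bounded finite_momentsI[OF prob_space_M sets_M] by blast
  note i [simp] = integrable_meixner_poly[OF fm]
  \<comment> \<open>The atom sits at a zero of D and the density is t \<beta> / D, so D times the
    law is t \<beta> times the semicircle law.\<close>
  have LD: "(\<integral>x. ?D x * p x \<partial>M) = t * \<beta> * (\<integral>x. p x \<partial>semicircle \<alpha> \<beta>)" if p: "continuous_on UNIV p" for p
  proof -
    have [measurable]: "p \<in> borel_measurable borel" by (rule borel_measurable_continuous_onI[OF p])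
    have "(\<integral>x. ?D x * p x \<partial>M) = (\<integral>x. h x * (?D x * p x) \<partial>semicircle \<alpha> \<beta>) + \<kappa> * (?D x0 * p x0)"
      by (rule integral_M) (intro continuous_intros p)
    also have "\<kappa> * (?D x0 * p x0) = 0" using x0 by (metis mult.assoc mult_zero_left)
    also have "(\<integral>x. h x * (?D x * p x) \<partial>semicircle \<alpha> \<beta>) = (\<integral>x. t * \<beta> * p x \<partial>semicircle \<alpha> \<beta>)"
    proof (rule integral_cong_AE)
      show "AE x in semicircle \<alpha> \<beta>. h x * (?D x * p x) = t * \<beta> * p x"
        using AE_semicircle[OF \<beta>_pos] by eventually_elim (simp only: h mult.assoc[symmetric])
    qed auto
    finally show ?thesis by simp
  qed
  have 1: "(\<integral>x. ?P (Suc 0) x \<partial>M) = 0"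
  proof -
    have "(\<integral>x. x \<partial>M) = a * t" using integral_M[of "\<lambda>x. x"] mean by (simp add: continuous_on_id)
    then show ?thesis by (simp add: integral_meixner_poly_1[OF prob_space_M fm] del: meixner_poly.simps)
  qed
  have 2: "(\<integral>x. ?P (Suc (Suc 0)) x \<partial>M) = 0"
  proof -
    have "(\<integral>x. ?D x * 1 \<partial>M) = t * \<beta>"
      using LD[of "\<lambda>_. 1"] prob_space_integral_const[OF prob_space_semicircle[OF \<beta>_pos, of \<alpha>], of 1] by (simp add: continuous_on_const)
    moreover have "(\<integral>x. ?D x * 1 \<partial>M) = (\<integral>x. t * \<beta> + 2 * a * \<beta> * ?P (Suc 0) x + ?P (Suc (Suc 0)) x \<partial>M)"
      using quadratic_eq_meixner_poly3[OF \<beta>] by (intro Bochner_Integration.integral_cong) auto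
    moreover have "\<dots> = t * \<beta> + 2 * a * \<beta> * (\<integral>x. ?P (Suc 0) x \<partial>M) + (\<integral>x. ?P (Suc (Suc 0)) x \<partial>M)"
      using prob_space_integral_const[OF prob_space_M, of "t * \<beta>"]
        finite_measure.integrable_const[OF prob_space.finite_measure[OF prob_space_M], of "t * \<beta>"]
        i[of "2 * a" 1 a 1 "Suc 0" t] i[of "2 * a" 1 a 1 "Suc (Suc 0)" t]
      by (simp del: meixner_poly.simps)
    ultimately show ?thesis using 1 by simp
  qed
  have "(\<integral>x. ?P (Suc n) x \<partial>M) = 0 \<and> (\<integral>x. ?P (Suc (Suc n)) x \<partial>M) = 0" for n
  proof (induction n)
    case (Suc n)
    have "0 = (\<integral>x. ?D x * chebU2 (Suc n) (x - \<alpha>) \<beta> \<partial>M)"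
      using LD[OF continuous_on_chebU2] integral_chebU2[OF \<beta>_pos, where n = "Suc n" and \<alpha> = \<alpha>] by simp
    also have "\<dots> = (\<integral>x. \<beta>\<^sup>2 * ?P (Suc n) x + 2 * a * \<beta> * ?P (Suc (Suc n)) x + ?P (Suc (Suc (Suc n))) x \<partial>M)"
      using quadratic_chebU2_eq_meixner_poly3[OF \<beta> t, of _ a n] unfolding \<alpha> by (intro Bochner_Integration.integral_cong) auto
    also have "\<dots> = \<beta>\<^sup>2 * (\<integral>x. ?P (Suc n) x \<partial>M) + 2 * a * \<beta> * (\<integral>x. ?P (Suc (Suc n)) x \<partial>M)
        + (\<integral>x. ?P (Suc (Suc (Suc n))) x \<partial>M)"
      by (simp del: meixner_poly.simps)
    finally show ?case using Suc by simp
  qed (use 1 2 in auto)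
  then show "(\<integral>x. ?P (Suc n) x \<partial>M) = 0" for n by blast
qed

lemma mu3_0: "mu3 a 0 = return borel 0"
  by (simp add: mu3_def)

text \<open>D has the real zeros t s and - t s with s = sqrt(a^2 - 1), so partial fractions reduce
  total mass and mean to two resolvents. Both are explicit because (a - s)(a + s) = 1.\<close>

lemma meixner_measure_mu3_gt1:
  assumes t: "t > 0" and a: "a > 1"
  shows "meixner_measure (2 * a) 1 a 1 t (mu3 a t)"
proof -
  define s where "s = sqrt (a\<^sup>2 - 1)"
  define \<beta> where "\<beta> = t + 1"
  define \<alpha> where "\<alpha> = 2 * a + a * t"
  have "a\<^sup>2 > 1" using a by (simp add: one_less_power)
  then have s: "s > 0" "s\<^sup>2 = a\<^sup>2 - 1" by (simp_all add: s_def)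
  have as: "a - s > 0" "(a - s) * (a + s) = 1"
  proof -
    have "s\<^sup>2 < a\<^sup>2" using s by simp
    then show "a - s > 0" using a power2_less_imp_less[of s a] by simp
    show "(a - s) * (a + s) = 1" using s(2) by algebra
  qed
  have b: "\<beta> > 0" "\<beta> > 1" using t by (auto simp: \<beta>_def)
  \<comment> \<open>Only at t s can either factor of \<beta> be the larger one; at - t s the order a
    - s \<le> \<beta> (a + s) is fixed.\<close>
  define E1 where "E1 = (if \<beta> * (a - s) \<le> a + s then a - s else (a + s) / \<beta>)"
  define E2 where "E2 = (a - s) / \<beta>"
  let ?S = "semicircle \<alpha> \<beta>"
  have i1: "1 / (a + s) = a - s" "1 / (a - s) = a + s"
    using as s a by (auto simp: field_simps)
  have pr: "\<beta> * (a - s) * (a + s) = \<beta>" using as(2) by (simp add: mult.assoc)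
  \<comment> \<open>These splittings have product \<beta>, as required to evaluate the
    resolvents.\<close>
  have e1: "\<alpha> - t * s = \<beta> * (a - s) + (a + s)" by (simp add: \<alpha>_def \<beta>_def algebra_simps)
  have e2: "\<alpha> - - (t * s) = (a - s) + \<beta> * (a + s)" by (simp add: \<alpha>_def \<beta>_def algebra_simps)
  have E1: "has_bochner_integral ?S (\<lambda>x. 1 / (x - t * s)) E1"
  proof (cases "\<beta> * (a - s) \<le> a + s")
    case True
    then show ?thesis
      using semicircle_resolvent'[of "\<beta> * (a - s)" "a + s" \<beta> \<alpha> "t * s"] pr e1 as s a b i1 by (simp add: E1_def)
  next
    case False
    have "1 / (\<beta> * (a - s)) = (a + s) / \<beta>" using i1 by (metis divide_divide_eq_left mult.commute)
    with False show ?thesis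
      using semicircle_resolvent'[of "a + s" "\<beta> * (a - s)" \<beta> \<alpha> "t * s"] pr e1 as s a b
      by (simp add: E1_def mult.commute add.commute)
  qed
  have E2: "has_bochner_integral ?S (\<lambda>x. 1 / (x - - (t * s))) E2"
  proof -
    have "1 / (\<beta> * (a + s)) = (a - s) / \<beta>" using i1 by (metis divide_divide_eq_left mult.commute)
    moreover have "a - s \<le> \<beta> * (a + s)"
    proof -
      have "a - s \<le> 1 * (a + s)" using s by simp
      also have "\<dots> \<le> \<beta> * (a + s)" using b s a by (intro mult_right_mono) auto
      finally show ?thesis .
    qed
    moreover have "(a - s) * (\<beta> * (a + s)) = \<beta>" using pr by (simp add: ac_simps)
    moreover have "\<beta> * (a + s) > 0" using b s a by (intro mult_pos_pos) auto
    ultimately show ?thesis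
      using semicircle_resolvent'[of "a - s" "\<beta> * (a + s)" \<beta> \<alpha> "- (t * s)"] e2 as by (simp add: E2_def)
  qed
  have pos: "x > t * s" if "(x - \<alpha>)\<^sup>2 < 4 * \<beta>" for x
    using semicircle_right_of[OF _ _ pr e1 that] as s a b by simp
  let ?h = "\<lambda>x. t * \<beta> / (x\<^sup>2 - t\<^sup>2 * (a\<^sup>2 - 1))"
  have fac: "x\<^sup>2 - t\<^sup>2 * (a\<^sup>2 - 1) = (x - t * s) * (x - - (t * s))" for x
    unfolding s(2)[symmetric] by algebra
  have ts: "t * s > 0" using t s by simp
  have fac_pos: "(x - t * s) * (x - - (t * s)) > 0" if "(x - \<alpha>)\<^sup>2 < 4 * \<beta>" for x
    using pos[OF that] ts by (intro mult_pos_pos) auto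
  have pf: "?h x = \<beta> / (2 * s) * (1 / (x - t * s) - 1 / (x - - (t * s)))"
       "?h x * x = t * \<beta> / 2 * (1 / (x - t * s) + 1 / (x - - (t * s)))" if "(x - \<alpha>)\<^sup>2 < 4 * \<beta>" for x
  proof -
    have ne: "x - t * s \<noteq> 0" "x + t * s \<noteq> 0" using pos[OF that] ts by auto
    show "?h x = \<beta> / (2 * s) * (1 / (x - t * s) - 1 / (x - - (t * s)))"
      unfolding fac using ne s t by (simp add: divide_simps) 
    show "?h x * x = t * \<beta> / 2 * (1 / (x - t * s) + 1 / (x - - (t * s)))"
      unfolding fac using ne by (simp add: divide_simps)
  qed
  have h1: "has_bochner_integral ?S ?h (\<beta> / (2 * s) * (E1 - E2))"
  proof (rule has_bochner_integralI_AE)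
    show "has_bochner_integral ?S (\<lambda>x. \<beta> / (2 * s) * (1 / (x - t * s) - 1 / (x - - (t * s)))) (\<beta> / (2 * s) * (E1 - E2))"
      by (intro has_bochner_integral_mult_right has_bochner_integral_diff E1 E2)
    show "AE x in ?S. \<beta> / (2 * s) * (1 / (x - t * s) - 1 / (x - - (t * s))) = ?h x"
      using AE_semicircle[OF b(1)] by eventually_elim (simp only: pf(1))
  qed auto
  have h2: "has_bochner_integral ?S (\<lambda>x. ?h x * x) (t * \<beta> / 2 * (E1 + E2))"
  proof (rule has_bochner_integralI_AE)
    show "has_bochner_integral ?S (\<lambda>x. t * \<beta> / 2 * (1 / (x - t * s) + 1 / (x - - (t * s)))) (t * \<beta> / 2 * (E1 + E2))"
      by (intro has_bochner_integral_mult_right has_bochner_integral_add E1 E2)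
    show "AE x in ?S. t * \<beta> / 2 * (1 / (x - t * s) + 1 / (x - - (t * s))) = ?h x * x"
      using AE_semicircle[OF b(1)] by eventually_elim (simp only: pf(2))
  qed auto
  define \<kappa> where "\<kappa> = max (1 - t * (a - s) / (2 * s)) 0"
  \<comment> \<open>The case distinction in \<open>E1\<close> coincides with the sign change of the
    atom's weight.\<close>
  have cond: "\<beta> * (a - s) \<le> a + s \<longleftrightarrow> t * (a - s) / (2 * s) \<le> 1"
    using s by (simp add: \<beta>_def divide_simps algebra_simps)
  have mass: "\<beta> / (2 * s) * (E1 - E2) + \<kappa> = 1"
    and mean: "t * \<beta> / 2 * (E1 + E2) + \<kappa> * (t * s) = a * t"
  proof -
    have "\<beta> / (2 * s) * (E1 - E2) + \<kappa> = 1 \<and> t * \<beta> / 2 * (E1 + E2) + \<kappa> * (t * s) = a * t"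
    proof (cases "\<beta> * (a - s) \<le> a + s")
      case True
      then have k: "\<kappa> = 1 - t * (a - s) / (2 * s)" "E1 = a - s" using cond by (simp_all add: \<kappa>_def E1_def)
      have m1: "\<beta> / (2 * s) * (E1 - E2) = (\<beta> - 1) * (a - s) / (2 * s)"
        using b s unfolding k E2_def by (simp add: field_simps)
      have m2: "t * \<beta> / 2 * (E1 + E2) = t * (\<beta> + 1) * (a - s) / 2"
        using b unfolding k E2_def by (simp add: field_simps)
      have m3: "\<kappa> * (t * s) = t * s - t * t * (a - s) / 2" using s unfolding k by (simp add: field_simps)
      show ?thesis unfolding m1 m2 m3 unfolding k(1) by (simp add: \<beta>_def field_simps)
    next
      case False
      then have k: "\<kappa> = 0" "E1 = (a + s) / \<beta>" using cond by (simp_all add: \<kappa>_def E1_def)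
      show ?thesis using b s unfolding k E2_def by (simp add: field_simps)
    qed
    then show "\<beta> / (2 * s) * (E1 - E2) + \<kappa> = 1" "t * \<beta> / 2 * (E1 + E2) + \<kappa> * (t * s) = a * t" by auto
  qed
  interpret semicircle_mixture \<alpha> \<beta> \<kappa> "t * s" ?h "mu3 a t"
  proof
    show "mu3 a t = add_measure (scale_density ?h ?S) (scale_density (\<lambda>_. \<kappa>) (return borel (t * s)))"
      using t a by (simp add: mu3_def alpha3_def beta3_def \<alpha>_def \<beta>_def \<kappa>_def s_def algebra_simps)
    show "(\<integral>x. ?h x \<partial>?S) + \<kappa> = 1" using has_bochner_integral_integral_eq[OF h1] mass by simp
    show "?h x \<ge> 0" if "(x - \<alpha>)\<^sup>2 < 4 * \<beta>" for x
      unfolding fac using fac_pos[OF that] t b by (intro divide_nonneg_pos) auto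
  qed (use b h1 in \<open>auto simp: \<kappa>_def integrable.simps\<close>)
  show ?thesis
  proof (rule meixner_measure3I[OF \<beta>_def \<alpha>_def t])
    show "?h x * (x\<^sup>2 + t\<^sup>2 * (1 - a\<^sup>2)) = t * \<beta>" if "(x - \<alpha>)\<^sup>2 < 4 * \<beta>" for x
    proof -
      have "x\<^sup>2 + t\<^sup>2 * (1 - a\<^sup>2) = (x - t * s) * (x - - (t * s))" using fac[of x] by (simp add: algebra_simps)
      moreover have "c / y * y = c" if "y > 0" for c y :: real using that by simp
      from this[OF fac_pos[OF that]] have "t * \<beta> / ((x - t * s) * (x - - (t * s))) * ((x - t * s) * (x - - (t * s))) = t * \<beta>" .
      ultimately show ?thesis unfolding fac by simp
    qed
    show "\<kappa> * ((t * s)\<^sup>2 + t\<^sup>2 * (1 - a\<^sup>2)) = 0" by (simp add: power_mult_distrib s(2) algebra_simps)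
    show "(\<integral>x. ?h x * x \<partial>?S) + \<kappa> * (t * s) = a * t"
      using has_bochner_integral_integral_eq[OF h2] mean by simp
  qed
qed

text \<open>For a \<le> 1 the zeros of the quadratic are complex or double, so no partial fractions are
  available. Instead, the integrals A n of the polynomials satisfy a linear recurrence whose
  solutions grow like \<beta> ^ n, detected by the conserved quadratic form
  \<beta>^2 A n^2 + 2 a \<beta> A n A (n+1) + A (n+1)^2, whereas |P n| is bounded by a multiple of
  n \<beta>^(n/2); hence A vanishes.\<close>
lemma recurrence_eq_0:
  fixes A :: "nat \<Rightarrow> real"
  assumes b: "\<beta> > 1" and a: "0 \<le> a" "a \<le> 1"
    and rec: "\<And>n. A (Suc (Suc n)) = - (2 * a * \<beta> * A (Suc n)) - \<beta>\<^sup>2 * A n"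
    and bound: "\<And>n. \<bar>A n\<bar> \<le> C * real (n + 2) * sqrt \<beta> ^ n"
  shows "A 0 = 0"
proof -
  define E where "E = (\<lambda>n. \<beta>\<^sup>2 * (A n)\<^sup>2 + 2 * a * \<beta> * A n * A (Suc n) + (A (Suc n))\<^sup>2)"
  have E_alt: "E n = (A (Suc n) + a * \<beta> * A n)\<^sup>2 + (1 - a\<^sup>2) * \<beta>\<^sup>2 * (A n)\<^sup>2" for n
    unfolding E_def by algebra
  have a2: "1 - a\<^sup>2 \<ge> 0" using a by (simp add: power_le_one)
  have "E (Suc n) = \<beta>\<^sup>2 * E n" for n unfolding E_def rec by algebra
  then have Epow: "E n = \<beta>\<^sup>2 ^ n * E 0" for n by (induction n) (auto simp: algebra_simps)
  have C: "C \<ge> 0" using bound[of 0] by simp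
  have lim0: "(\<lambda>n. K * real (n + 3) ^ 2 / \<beta> ^ n) \<longlonglongrightarrow> 0" for K
  proof -
    have "(\<lambda>n. real (n + 3) ^ 2 / \<beta> ^ n) \<longlonglongrightarrow> 0" using b by real_asymp
    from tendsto_mult_right_zero[OF this, of K] show ?thesis by simp
  qed
  \<comment> \<open>E n equals \<beta>^(2n) E 0, but the bound on A allows only order n^2 \<beta>^n;
    after division the right-hand side tends to 0.\<close>
  have "E 0 \<le> (\<beta>\<^sup>2 + 2 * a * \<beta> * sqrt \<beta> + \<beta>) * C\<^sup>2 * real (n + 3) ^ 2 / \<beta> ^ n" for n
  proof -
    let ?B = "C * real (n + 3) * sqrt \<beta> ^ n"
    have s2: "sqrt \<beta> ^ n * sqrt \<beta> ^ n = \<beta> ^ n" using b by (simp flip: power_mult_distrib)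
    have 1: "\<bar>A n\<bar> \<le> ?B"
    proof -
      have "C * real (n + 2) * sqrt \<beta> ^ n \<le> ?B" using C b by (intro mult_right_mono mult_left_mono) auto
      with bound[of n] show ?thesis by linarith
    qed
    have 2: "\<bar>A (Suc n)\<bar> \<le> sqrt \<beta> * ?B" using bound[of "Suc n"] by (simp add: ac_simps)
    have B0: "?B \<ge> 0" using 1 by linarith
    have "\<bar>A n\<bar>\<^sup>2 \<le> ?B\<^sup>2" using 1 by (intro power_mono) auto
    moreover have "\<bar>A (Suc n)\<bar>\<^sup>2 \<le> (sqrt \<beta> * ?B)\<^sup>2" using 2 by (intro power_mono) auto
    moreover have "A n * A (Suc n) \<le> ?B * (sqrt \<beta> * ?B)"
    proof -
      have "A n * A (Suc n) \<le> \<bar>A n\<bar> * \<bar>A (Suc n)\<bar>" by (metis abs_ge_self abs_mult)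
      also have "\<dots> \<le> ?B * (sqrt \<beta> * ?B)" using 1 2 B0 by (intro mult_mono) auto
      finally show ?thesis .
    qed
    ultimately have "E n \<le> \<beta>\<^sup>2 * ?B\<^sup>2 + 2 * a * \<beta> * (?B * (sqrt \<beta> * ?B)) + (sqrt \<beta> * ?B)\<^sup>2"
      unfolding E_def mult.assoc[of "2 * a * \<beta>"] using a b
      by (intro add_mono mult_left_mono) auto
    also have "\<dots> = (\<beta>\<^sup>2 + 2 * a * \<beta> * sqrt \<beta> + (sqrt \<beta>)\<^sup>2) * (C\<^sup>2 * real (n + 3) ^ 2 * (sqrt \<beta> ^ n * sqrt \<beta> ^ n))"
      by algebra
    also have "\<dots> = (\<beta>\<^sup>2 + 2 * a * \<beta> * sqrt \<beta> + \<beta>) * C\<^sup>2 * real (n + 3) ^ 2 * \<beta> ^ n"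
      unfolding s2 using b by simp
    finally have "E 0 * \<beta> ^ n * \<beta> ^ n \<le> (\<beta>\<^sup>2 + 2 * a * \<beta> * sqrt \<beta> + \<beta>) * C\<^sup>2 * real (n + 3) ^ 2 * \<beta> ^ n"
      unfolding Epow[of n] by (simp add: power2_eq_square power_mult_distrib mult_ac)
    then have "E 0 * \<beta> ^ n \<le> (\<beta>\<^sup>2 + 2 * a * \<beta> * sqrt \<beta> + \<beta>) * C\<^sup>2 * real (n + 3) ^ 2"
      by (rule mult_right_le_imp_le) (use b in simp)
    then show ?thesis using b by (simp only: pos_le_divide_eq zero_less_power)
  qed
  then have "E 0 \<le> 0" by (intro LIMSEQ_le_const[OF lim0]) auto
  moreover have "E n \<ge> 0" for n unfolding E_alt using a2 by simp
  then have "E 0 \<ge> 0" .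
  ultimately have "E 0 = 0" by (rule order_antisym)
  then have E0: "E n = 0" for n using Epow[of n] by simp
  have sq: "A (Suc n) + a * \<beta> * A n = 0" "(1 - a\<^sup>2) * \<beta>\<^sup>2 * (A n)\<^sup>2 = 0" for n
  proof -
    have "(A (Suc n) + a * \<beta> * A n)\<^sup>2 \<ge> 0" "(1 - a\<^sup>2) * \<beta>\<^sup>2 * (A n)\<^sup>2 \<ge> 0" using a2 by simp_all
    then have "(A (Suc n) + a * \<beta> * A n)\<^sup>2 = 0" and *: "(1 - a\<^sup>2) * \<beta>\<^sup>2 * (A n)\<^sup>2 = 0"
      using E0[of n] unfolding E_alt by linarith+
    then show "A (Suc n) + a * \<beta> * A n = 0" by simp
    show "(1 - a\<^sup>2) * \<beta>\<^sup>2 * (A n)\<^sup>2 = 0" by fact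
  qed
  show "A 0 = 0"
  \<comment> \<open>For a < 1 the form is definite and its vanishing suffices. For a = 1 it is only
    semidefinite and leaves A (n+1) = - \<beta> A n, which the growth bound must exclude
    again.\<close>
  proof (cases "a = 1")
    case True
    have "A (Suc n) = - \<beta> * A n" for n using sq(1)[of n] True by simp
    then have An: "\<bar>A n\<bar> = \<beta> ^ n * \<bar>A 0\<bar>" for n using b by (induction n) (auto simp: abs_mult)
    have "(\<lambda>n. C * real (n + 2) * sqrt \<beta> ^ n / \<beta> ^ n) \<longlonglongrightarrow> 0"
    proof -
      have "sqrt \<beta> > 1" using b by simp
      then have "(\<lambda>n. real (n + 2) / sqrt \<beta> ^ n) \<longlonglongrightarrow> 0" by real_asymp
      from tendsto_mult_right_zero[OF this, of C]
      have "(\<lambda>n. C * real (n + 2) * (1 / sqrt \<beta> ^ n)) \<longlonglongrightarrow> 0" by simp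
      moreover have "sqrt \<beta> ^ n / \<beta> ^ n = 1 / sqrt \<beta> ^ n" for n
        using b by (simp add: divide_simps flip: power_mult_distrib)
      ultimately show ?thesis by (simp only: times_divide_eq_right[symmetric])
    qed
    moreover have "\<bar>A 0\<bar> \<le> C * real (n + 2) * sqrt \<beta> ^ n / \<beta> ^ n" for n
      using bound[of n] b unfolding An[of n] by (simp add: field_simps)
    ultimately have "\<bar>A 0\<bar> \<le> 0" by (intro LIMSEQ_le_const) auto
    then show ?thesis by simp
  next
    case False
    with a have "a\<^sup>2 < 1" by (simp add: power_less_one_iff abs_square_less_1)
    then have "1 - a\<^sup>2 \<noteq> 0" by simp
    with sq(2)[of 0] b show ?thesis by auto
  qed
qed

text \<open>D is positive on the closed support, so everything is integrable; total mass and mean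
  are not computed but forced by the decay argument applied to the integrals of the P n.\<close>

lemma meixner_measure_mu3_le1:
  assumes t: "t > 0" and a: "0 \<le> a" "a \<le> 1"
  shows "meixner_measure (2 * a) 1 a 1 t (mu3 a t)"
proof -
  define \<beta> where "\<beta> = t + 1"
  define \<alpha> where "\<alpha> = 2 * a + a * t"
  have b: "\<beta> > 0" "\<beta> > 1" using t by (auto simp: \<beta>_def)
  let ?S = "semicircle \<alpha> \<beta>"
  let ?I = "{\<alpha> - 2 * sqrt \<beta> .. \<alpha> + 2 * sqrt \<beta>}"
  let ?D = "\<lambda>x::real. x\<^sup>2 + t\<^sup>2 * (1 - a\<^sup>2)"
  let ?h = "\<lambda>x. t * \<beta> / ?D x"
  let ?P = "\<lambda>n x. meixner_poly (2 * a) 1 a 1 n x t"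
  have D: "?D x > 0" if "x \<in> ?I" for x
  proof (cases "a = 1")
    case True
    \<comment> \<open>For a = 1 the double zero 0 of D lies strictly left of the support, whose left
      edge is \<beta> + 1 - 2 sqrt \<beta>.\<close>
    have "(sqrt \<beta> - 1)\<^sup>2 > 0" using b by simp
    moreover have "(sqrt \<beta> - 1)\<^sup>2 = \<alpha> - 2 * sqrt \<beta>" using b True by (simp add: power2_diff \<alpha>_def \<beta>_def)
    ultimately have "x > 0" using that by simp
    then show ?thesis using True by simp
  next
    case False
    with a have "a\<^sup>2 < 1" by (simp add: power_less_one_iff abs_square_less_1)
    then have "t\<^sup>2 * (1 - a\<^sup>2) > 0" using t by simp
    then show ?thesis by (simp add: add_nonneg_pos)
  qed
  have I: "x \<in> ?I" if "(x - \<alpha>)\<^sup>2 < 4 * \<beta>" for x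
    using semicircle_interval_iff[OF b(1), of x \<alpha>] that by auto
  have hp: "integrable ?S (\<lambda>x. ?h x * p x)" if p: "continuous_on UNIV p" for p
  proof (rule integrable_semicircle_continuous[OF b(1)])
    have [measurable]: "p \<in> borel_measurable borel" by (rule borel_measurable_continuous_onI[OF p])
    show "(\<lambda>x. ?h x * p x) \<in> borel_measurable borel" by measurable
    show "continuous_on ?I (\<lambda>x. ?h x * p x)"
      by (intro continuous_intros continuous_on_subset[OF p]) (use D in \<open>auto simp: less_le\<close>)
  qed
  have hDp: "(\<integral>x. ?h x * (?D x * p x) \<partial>?S) = t * \<beta> * (\<integral>x. p x \<partial>?S)" if p: "continuous_on UNIV p" for p
  proof -
    have [measurable]: "p \<in> borel_measurable borel" by (rule borel_measurable_continuous_onI[OF p])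
    have "(\<integral>x. ?h x * (?D x * p x) \<partial>?S) = (\<integral>x. t * \<beta> * p x \<partial>?S)"
    proof (rule integral_cong_AE)
      show "AE x in ?S. ?h x * (?D x * p x) = t * \<beta> * p x"
        using AE_semicircle[OF b(1)]
      proof eventually_elim
        case (elim x)
        with D[OF I[OF elim]] show ?case by simp
      qed
    qed auto
    then show ?thesis by simp
  qed
  define A where "A = (\<lambda>n. \<integral>x. ?h x * ?P n x \<partial>?S)"
  note iP [simp] = hp[OF continuous_on_meixner_poly]
  have one: "(\<integral>x. 1 \<partial>?S) = (1::real)" by (rule prob_space_integral_const[OF prob_space_semicircle[OF b(1)]])
  have rec: "A (Suc (Suc (Suc n))) = - (2 * a * \<beta> * A (Suc (Suc n))) - \<beta>\<^sup>2 * A (Suc n)" for n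
  proof -
    have "0 = (\<integral>x. ?h x * (?D x * chebU2 (Suc n) (x - \<alpha>) \<beta>) \<partial>?S)"
      using hDp[OF continuous_on_chebU2] integral_chebU2[OF b(1), where n = "Suc n" and \<alpha> = \<alpha>] by simp
    also have "\<dots> = (\<integral>x. \<beta>\<^sup>2 * (?h x * ?P (Suc n) x) + 2 * a * \<beta> * (?h x * ?P (Suc (Suc n)) x)
        + ?h x * ?P (Suc (Suc (Suc n))) x \<partial>?S)"
      unfolding \<alpha>_def quadratic_chebU2_eq_meixner_poly3[OF \<beta>_def t]
      by (intro Bochner_Integration.integral_cong refl) (simp only: distrib_left mult_ac)
    also have "\<dots> = \<beta>\<^sup>2 * A (Suc n) + 2 * a * \<beta> * A (Suc (Suc n)) + A (Suc (Suc (Suc n)))"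
      unfolding A_def by (simp del: meixner_poly.simps times_divide_eq_left)
    finally show ?thesis by simp
  qed
  have P_bound: "\<bar>?P (Suc n) x\<bar> \<le> 4 * \<beta> * real (n + 2) * sqrt \<beta> ^ n" if x: "(x - \<alpha>)\<^sup>2 < 4 * \<beta>" for n x
  proof -
    let ?Q = "\<lambda>n. chebU2 n (x - \<alpha>) \<beta>"
    have sb: "1 \<le> sqrt \<beta>" "sqrt \<beta> \<le> \<beta>" using b by (auto intro: real_le_lsqrt simp: power2_eq_square)
    have mono: "sqrt \<beta> ^ m \<le> \<beta> * sqrt \<beta> ^ n" if "m \<le> Suc n" for m
    proof -
      have "sqrt \<beta> ^ m \<le> sqrt \<beta> ^ Suc n" using that sb by (intro power_increasing) auto
      also have "\<dots> \<le> \<beta> * sqrt \<beta> ^ n" using sb b by (simp add: mult_right_mono)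
      finally show ?thesis .
    qed
    define B where "B = \<beta> * real (n + 2) * sqrt \<beta> ^ n"
    have Q: "\<bar>?Q m\<bar> \<le> B" if "m \<le> Suc n" for m
    proof -
      have "\<bar>?Q m\<bar> \<le> real (Suc m) * sqrt \<beta> ^ m" by (rule abs_chebU2_le[OF b(1) x])
      also have "\<dots> \<le> real (n + 2) * (\<beta> * sqrt \<beta> ^ n)" using that mono[OF that] b by (intro mult_mono) auto
      finally show ?thesis by (simp add: B_def ac_simps)
    qed
    have B0: "0 \<le> B" using b by (simp add: B_def)
    have aQ: "\<bar>2 * a * ?Q m\<bar> \<le> 2 * B" if "m \<le> Suc n" for m
    proof -
      have "\<bar>2 * a * ?Q m\<bar> = 2 * (a * \<bar>?Q m\<bar>)" using a by (simp add: abs_mult)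
      also have "\<dots> \<le> 2 * (1 * B)"
        using Q[OF that] a by (intro mult_left_mono mult_mono) auto
      finally show ?thesis by simp
    qed
    note P = meixner_poly3_eq_chebU2[OF \<beta>_def t, where a = a and x = x, folded \<alpha>_def]
    have "\<bar>?P (Suc n) x\<bar> \<le> 4 * B"
    proof (cases n)
      case 0
      show ?thesis unfolding 0 P(2) using Q[of "Suc 0"] aQ[of 0] B0 by linarith
    next
      case (Suc m)
      then have "\<bar>?Q (Suc (Suc m))\<bar> \<le> B" "\<bar>2 * a * ?Q (Suc m)\<bar> \<le> 2 * B" "\<bar>?Q m\<bar> \<le> B"
        using Q[of "Suc (Suc m)"] aQ[of "Suc m"] Q[of m] by simp_all
      then show ?thesis unfolding Suc P(1) by linarith
    qed
    then show ?thesis by (simp only: B_def mult_ac)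
  qed
  define K where "K = (\<integral>x. ?h x \<partial>?S)"
  have ih: "integrable ?S ?h" using hp[of "\<lambda>_. 1"] by (simp add: continuous_on_const)
  have A_bound: "\<bar>A (Suc n)\<bar> \<le> (4 * \<beta> * K) * real (n + 2) * sqrt \<beta> ^ n" for n
  proof -
    have "\<bar>A (Suc n)\<bar> \<le> (\<integral>x. \<bar>?h x * ?P (Suc n) x\<bar> \<partial>?S)" unfolding A_def by (rule integral_abs_bound)
    also have "\<dots> \<le> (\<integral>x. ?h x * (4 * \<beta> * real (n + 2) * sqrt \<beta> ^ n) \<partial>?S)"
    proof (rule integral_mono_AE)
      show "integrable ?S (\<lambda>x. \<bar>?h x * ?P (Suc n) x\<bar>)" using iP by (rule integrable_abs)
      show "integrable ?S (\<lambda>x. ?h x * (4 * \<beta> * real (n + 2) * sqrt \<beta> ^ n))" using ih by (rule integrable_mult_left)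
      show "AE x in ?S. \<bar>?h x * ?P (Suc n) x\<bar> \<le> ?h x * (4 * \<beta> * real (n + 2) * sqrt \<beta> ^ n)"
        using AE_semicircle[OF b(1)]
      proof eventually_elim
        case (elim x)
        have "?h x \<ge> 0" using D[OF I[OF elim]] t b by (intro divide_nonneg_pos) auto
        then show ?case using P_bound[OF elim, of n] unfolding abs_mult by (simp only: abs_of_nonneg mult_left_mono)
      qed
    qed
    also have "\<dots> = K * (4 * \<beta> * real (n + 2) * sqrt \<beta> ^ n)" unfolding K_def by (rule integral_mult_left_zero)
    finally show ?thesis by (simp only: mult_ac)
  qed
  have A0: "A (Suc n) = 0" for n
  proof -
    have 1: "A (Suc 0) = 0"
      by (rule recurrence_eq_0[OF b(2) a, where A = "\<lambda>n. A (Suc n)"]) (use rec A_bound in blast)+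
    \<comment> \<open>The growth lemma gives only the initial value of a sequence, so it is applied
      to the shifted one too; the constant absorbs n + 3 \<le> 2 (n + 2) and one more factor sqrt
      \<beta>.\<close>
    have 2: "A (Suc (Suc 0)) = 0"
    proof (rule recurrence_eq_0[OF b(2) a, where A = "\<lambda>n. A (Suc (Suc n))" and C = "2 * (4 * \<beta> * K) * sqrt \<beta>"])
      have K0: "4 * \<beta> * K \<ge> 0" using order_trans[OF abs_ge_zero A_bound[of 0]] b by (simp add: zero_le_mult_iff)
      fix n
      have "\<bar>A (Suc (Suc n))\<bar> \<le> (4 * \<beta> * K) * real (Suc n + 2) * sqrt \<beta> ^ Suc n" by (rule A_bound)
      also have "\<dots> \<le> (4 * \<beta> * K) * (2 * real (n + 2)) * sqrt \<beta> ^ Suc n"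
        using K0 b by (intro mult_right_mono mult_left_mono) auto
      finally show "\<bar>A (Suc (Suc n))\<bar> \<le> 2 * (4 * \<beta> * K) * sqrt \<beta> * real (n + 2) * sqrt \<beta> ^ n"
        by (simp add: ac_simps)
    qed (rule rec)
    have "A (Suc n) = 0 \<and> A (Suc (Suc n)) = 0" for n
      by (induction n) (use 1 2 rec in auto)
    then show ?thesis by blast
  qed
  \<comment> \<open>Total mass comes last: D is t \<beta> plus multiples of P 1 and P 2, whose
    integrals are already known to vanish.\<close>
  have K1: "K = 1"
  proof -
    have "t * \<beta> = (\<integral>x. ?h x * (?D x * 1) \<partial>?S)" using hDp[of "\<lambda>_. 1"] one by (simp add: continuous_on_const)
    also have "\<dots> = (\<integral>x. t * \<beta> * ?h x + 2 * a * \<beta> * (?h x * ?P (Suc 0) x) + ?h x * ?P (Suc (Suc 0)) x \<partial>?S)"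
    proof (intro Bochner_Integration.integral_cong refl)
      fix x
      have "y * (?D x * 1) = t * \<beta> * y + 2 * a * \<beta> * (y * ?P (Suc 0) x) + y * ?P (Suc (Suc 0)) x" for y
        unfolding quadratic_eq_meixner_poly3[OF \<beta>_def, of x a] by algebra
      then show "?h x * (?D x * 1) = t * \<beta> * ?h x + 2 * a * \<beta> * (?h x * ?P (Suc 0) x) + ?h x * ?P (Suc (Suc 0)) x" .
    qed
    also have "\<dots> = t * \<beta> * K + 2 * a * \<beta> * A (Suc 0) + A (Suc (Suc 0))"
      unfolding A_def K_def using ih by (simp del: meixner_poly.simps times_divide_eq_left times_divide_eq_right)
    finally show ?thesis using A0 t b by simp
  qed
  interpret semicircle_mixture \<alpha> \<beta> 0 0 ?h "mu3 a t"
  proof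
    have "mu3 a t = scale_density ?h ?S"
      using t a by (auto simp: mu3_def alpha3_def beta3_def \<alpha>_def \<beta>_def algebra_simps)
    then show "mu3 a t = add_measure (scale_density ?h ?S) (scale_density (\<lambda>_. 0) (return borel 0))"
      using scale_density_eq_add_measure by metis
    show "0 \<le> ?h x" if "(x - \<alpha>)\<^sup>2 < 4 * \<beta>" for x
      using D[OF I[OF that]] t b by (intro divide_nonneg_pos) auto
  qed (use b ih K1 in \<open>auto simp: K_def\<close>)
  show ?thesis
  proof (rule meixner_measureI)
    fix n show "(\<integral>x. ?P (Suc n) x \<partial>mu3 a t) = 0"
      using integral_M[OF continuous_on_meixner_poly] A0[of n] unfolding A_def by simp
  qed
qed

lemma meixner_measure_mu3:
  assumes "t \<ge> 0" "a \<ge> 0"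
  shows "meixner_measure (2 * a) 1 a 1 t (mu3 a t)"
  using assms meixner_measure_0 mu3_0 meixner_measure_mu3_le1 meixner_measure_mu3_gt1
  by (metis linorder_not_le order_le_less)

section \<open>Classification\<close>

lemma meixner_measureD:
  assumes "meixner_measure e d r v t M"
  shows "prob_space M" "sets M = sets borel" "finite_moments M" "\<exists>C. AE x in M. \<bar>x\<bar> \<le> C"
    "(\<integral>x. meixner_poly e d r v n x t \<partial>M) = (if n = 0 then 1 else 0)"
proof -
  show "prob_space M" "sets M = sets borel" and b: "\<exists>C. AE x in M. \<bar>x\<bar> \<le> C"
    "(\<integral>x. meixner_poly e d r v n x t \<partial>M) = (if n = 0 then 1 else 0)"
    using assms by (simp_all add: meixner_measure_def)
  with b show "finite_moments M" using finite_momentsI by blast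
qed

lemma R_transform_meixner:
  assumes fm: "finite_moments M"
    and int: "\<And>n. (\<integral>x. meixner_poly e d r v n x t \<partial>M) = (if n = 0 then 1 else 0)"
    and S: "S oo meixner_u e d = fps_const r + fps_const v * fps_X"
  shows "R_transform M = fps_const t * S"
proof (rule R_transform_eqI[OF fm P01_meixner_u _ int])
  fix x
  have "(fps_const t * S) oo meixner_u e d = fps_const t * (S oo meixner_u e d)"
    by (simp add: fps_compose_mult_distrib meixner_u_def)
  then show "Abs_fps (\<lambda>n. meixner_poly e d r v n x t) = inverse (1 + meixner_u e d *
      ((fps_const t * S) oo meixner_u e d) - fps_const x * meixner_u e d)"
    unfolding meixner_poly_gen[OF S] by (simp add: ac_simps)
qed

text \<open>Squared norms are products of the off-diagonal Jacobi coefficients. The first identifies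
  \<open>v\<close> with the variance; the second controls the sign of \<open>d\<close>.\<close>

lemma integral_meixner_poly_sq:
  assumes fm: "finite_moments M"
    and int: "\<And>n. (\<integral>x. meixner_poly e d r v n x t \<partial>M) = (if n = 0 then 1 else 0)"
  shows "(\<integral>x. (meixner_poly e d r v (Suc 0) x t)\<^sup>2 \<partial>M) = v * t"
    and "(\<integral>x. (meixner_poly e d r v (Suc (Suc 0)) x t)\<^sup>2 \<partial>M) = (d + v * t) * (v * t)"
proof -
  let ?P = "\<lambda>n x. meixner_poly e d r v n x t"
  have orth: "(\<integral>x. ?P m x * ?P n x \<partial>M) = 0" if "m < n" for m n
    using int by (intro meixner_poly_orthogonal[OF fm _ that]) simp
  note i [simp] = integrable_meixner_poly_mult[OF fm, of e d r v _ t]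
  have "(?P (Suc 0) x)\<^sup>2 = ?P 0 x * ?P (Suc (Suc 0)) x + e * (?P 0 x * ?P (Suc 0) x) + v * t * (?P 0 x * ?P 0 x)" for x
    by (simp add: power2_eq_square algebra_simps)
  moreover have "(\<integral>x. ?P 0 x * ?P 0 x \<partial>M) = 1" using int[of 0] by simp
  ultimately show 1: "(\<integral>x. (?P (Suc 0) x)\<^sup>2 \<partial>M) = v * t"
    using orth[of 0 "Suc (Suc 0)"] orth[of 0 "Suc 0"] i[of 0 "Suc (Suc 0)"] i[of 0 "Suc 0"] i[of 0 0]
    by (simp del: meixner_poly.simps)
  have "(?P (Suc (Suc 0)) x)\<^sup>2 = ?P (Suc 0) x * ?P (Suc (Suc (Suc 0))) x
      + (d + v * t) * (?P (Suc 0) x * ?P (Suc 0) x) - v * t * (?P 0 x * ?P (Suc (Suc 0)) x)" for x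
    by (simp add: power2_eq_square algebra_simps)
  then have "(\<integral>x. (?P (Suc (Suc 0)) x)\<^sup>2 \<partial>M) = (d + v * t) * (\<integral>x. ?P (Suc 0) x * ?P (Suc 0) x \<partial>M)"
    using orth[of "Suc 0" "Suc (Suc (Suc 0))"] orth[of 0 "Suc (Suc 0)"]
    by (simp del: meixner_poly.simps)
  then show "(\<integral>x. (?P (Suc (Suc 0)) x)\<^sup>2 \<partial>M) = (d + v * t) * (v * t)"
    using 1 by (simp add: power2_eq_square del: meixner_poly.simps)
qed

lemma integral_square_diff_const:
  assumes "prob_space M" "finite_moments M"
  shows "(\<integral>x. (x - c)\<^sup>2 \<partial>M) = moment M 2 - 2 * c * moment M 1 + c\<^sup>2"
proof -
  have "(x - c)\<^sup>2 = poly [:c\<^sup>2, - 2 * c, 1:] x" for x by (simp add: power2_eq_square algebra_simps)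
  then have "(\<integral>x. (x - c)\<^sup>2 \<partial>M) = (\<integral>x. poly [:c\<^sup>2, - 2 * c, 1:] x \<partial>M)" by simp
  also have "\<dots> = c\<^sup>2 * moment M 0 - 2 * c * moment M 1 + moment M 2"
    unfolding integral_poly[OF assms(2)] by (simp add: numeral_2_eq_2)
  also have "moment M 0 = 1"
    using prob_space_integral_const[OF assms(1), of 1] by (simp add: moment_def)
  finally show ?thesis by simp
qed

lemma variance_of_meixner:
  assumes M: "prob_space M" "finite_moments M"
    and int: "\<And>n. (\<integral>x. meixner_poly e d r v n x t \<partial>M) = (if n = 0 then 1 else 0)"
  shows "variance_of M = v * t"
proof -
  have "moment M 1 = r * t"
    using int[of "Suc 0"] integral_meixner_poly_1[OF M, of e d r v t] by (simp add: moment_def)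
  moreover have "(\<integral>x. (x - r * t)\<^sup>2 \<partial>M) = v * t"
    using integral_meixner_poly_sq(1)[OF M(2) int] by simp
  ultimately show ?thesis
    using integral_square_diff_const[OF M, of "r * t"]
    by (simp add: variance_of_def power2_eq_square)
qed

lemma listed_propsI:
  assumes M: "\<And>t. t \<ge> 0 \<Longrightarrow> meixner_measure e d r v t (mu t)"
    and mu0: "mu 0 = return borel 0"
    and P: "\<And>n x t. P n x t = meixner_poly e d r v n x t"
    and S: "S oo meixner_u e d = fps_const r + fps_const v * fps_X"
    and v: "v \<noteq> 0"
  shows "listed_props mu P (meixner_u e d) S"
proof -
  note D = meixner_measureD[OF M]
  have R: "R_transform (mu t) = fps_const t * S" if "t \<ge> 0" for t
    by (rule R_transform_meixner[OF D(3)[OF that] D(5)[OF that] S])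
  have R1: "R_transform (mu 1) = S" using R[of 1] by simp
  have "free_conv_semigroup mu"
    unfolding free_conv_semigroup_def using D(1-3) mu0 R R1 by auto
  moreover have "\<forall>t\<ge>0. monic_OPS (mu t) (\<lambda>n x. P n x t)"
    unfolding P using D(3,5) by (auto intro!: monic_OPS_meixner_poly)
  moreover have gen: "Abs_fps (\<lambda>n. P n x t) = inverse (sheffer_denom (meixner_u e d) (meixner_u e d) S t x)" for t x
    unfolding P meixner_poly_gen[OF S] sheffer_denom_diag[OF P01_meixner_u] ..
  moreover have "gen_free_sheffer mu P"
    unfolding gen_free_sheffer_def R1 using gen P01_meixner_u by blast
  moreover have "variance_of (mu 1) = v"
    using variance_of_meixner[OF D(1,3,5)] by simp
  ultimately show ?thesis
    using v R1 P01_meixner_u sheffer_denom_diag[OF P01_meixner_u]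
    by (simp add: listed_props_def nontrivial_free_meixner_def free_meixner_def)
qed

text \<open>Dilation acts on the Jacobi coefficients with weight 1 on the diagonal and weight 2 off
  it; the time factor reaches only \<open>r\<close> and \<open>v\<close>, and the drift k only
  \<open>r\<close>.\<close>

lemma meixner_poly_affine:
  assumes c: "c \<noteq> 0"
  shows "c ^ n * meixner_poly e d r v n ((x - k * t) / c) (s * t) =
    meixner_poly (c * e) (c\<^sup>2 * d) (c * s * r + k) (c\<^sup>2 * s * v) n x t"
proof (induction n rule: less_induct)
  case (less n)
  show ?case
  proof (cases n)
    case 0
    then show ?thesis by simp
  next
    case (Suc m)
    let ?P = "\<lambda>n. meixner_poly e d r v n ((x - k * t) / c) (s * t)"
    let ?Q = "\<lambda>n. meixner_poly (c * e) (c\<^sup>2 * d) (c * s * r + k) (c\<^sup>2 * s * v) n x t"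
    have m: "c ^ m * ?P m = ?Q m" using less Suc by simp
    show ?thesis
    proof (cases m)
      case 0
      then show ?thesis using c Suc by (simp add: field_simps)
    next
      case (Suc l)
      have l: "c ^ l * ?P l = ?Q l" using less \<open>n = Suc m\<close> Suc by simp
      define b where "b = (if m = 1 then v * (s * t) else d + v * (s * t))"
      have P: "?P n = ((x - k * t) / c - (e + r * (s * t))) * ?P m - b * ?P l"
        unfolding \<open>n = Suc m\<close> meixner_poly_rec[of e d r v m] b_def using Suc by simp
      have Q: "?Q n = (x - (c * e + (c * s * r + k) * t)) * ?Q m - c\<^sup>2 * b * ?Q l"
        unfolding \<open>n = Suc m\<close> meixner_poly_rec[of "c * e" _ _ _ m] b_def using Suc by (simp add: algebra_simps)
      have "c ^ n * ?P n = (c * ((x - k * t) / c - (e + r * (s * t)))) * (c ^ m * ?P m) - c\<^sup>2 * b * (c ^ l * ?P l)"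
      proof -
        have "c ^ Suc (Suc l) * (w * p - b * q) = (c * w) * (c ^ Suc l * p) - c\<^sup>2 * b * (c ^ l * q)" for w p q
          by (simp add: algebra_simps power2_eq_square)
        then show ?thesis unfolding P unfolding \<open>n = Suc m\<close> Suc .
      qed
      also have "c * ((x - k * t) / c - (e + r * (s * t))) = x - (c * e + (c * s * r + k) * t)"
        using c by (simp add: field_simps)
      finally show ?thesis unfolding Q m l .
    qed
  qed
qed

lemma finite_moments_distr_affine:
  assumes "finite_moments M" "sets M = sets borel"
  shows "finite_moments (distr M borel (\<lambda>x. c * x + k))"
  unfolding finite_moments_def
proof
  fix n
  have f: "(\<lambda>x. c * x + k) \<in> borel_measurable M" using assms(2) by (simp cong: measurable_cong_sets)
  have "integrable M (\<lambda>x. poly ([:k, c:] ^ n) x)" by (rule integrable_poly[OF assms(1)])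
  then show "integrable (distr M borel (\<lambda>x. c * x + k)) (\<lambda>x. x ^ n)"
    by (subst integrable_distr_eq[OF f]) (simp_all add: algebra_simps)
qed

text \<open>The target law and the image of the model integrate the same monic polynomials to the
  same values, so their moments agree; boundedness of the model's support then gives equality of
  measures.\<close>

lemma affine_time_equivI:
  assumes model: "\<And>t. t \<ge> 0 \<Longrightarrow> meixner_measure e d r v t (mu t)"
    and P: "\<And>n x t. P n x t = meixner_poly e d r v n x t"
    and c: "c \<noteq> 0" and s: "s > 0"
    and mu': "\<And>t. t \<ge> 0 \<Longrightarrow> prob_space (mu' t)" "\<And>t. t \<ge> 0 \<Longrightarrow> sets (mu' t) = sets borel"
      "\<And>t. t \<ge> 0 \<Longrightarrow> finite_moments (mu' t)"
    and P': "\<And>n x t. t \<ge> 0 \<Longrightarrow> P' n x t = meixner_poly e' d' r' v' n x t"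
    and int: "\<And>n t. t \<ge> 0 \<Longrightarrow> (\<integral>x. meixner_poly e' d' r' v' n x t \<partial>mu' t) = (if n = 0 then 1 else 0)"
    and par: "e' = c * e" "d' = c\<^sup>2 * d" "v' = c\<^sup>2 * s * v"
  shows "affine_time_equiv mu P mu' P'"
  unfolding affine_time_equiv_def
proof (intro exI conjI allI impI)
  \<comment> \<open>The drift is chosen to match the means, which is why \<open>par\<close> imposes
    no relation between \<open>r\<close> and \<open>r'\<close>.\<close>
  define k where "k = r' - c * s * r"
  have r': "r' = c * s * r + k" by (simp add: k_def)
  show "c \<noteq> 0" "s > 0" by fact+
  fix t :: real assume t: "t \<ge> 0"
  have st: "s * t \<ge> 0" using s t by simp
  note D = meixner_measureD[OF model[OF st]]
  show "P' n x t = c ^ n * P n ((x - k * t) / c) (s * t)" for n x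
    unfolding P P'[OF t] meixner_poly_affine[OF c] par r' ..
  let ?f = "\<lambda>x. c * x + k * t"
  let ?N = "distr (mu (s * t)) borel ?f"
  have f [measurable]: "?f \<in> borel_measurable (mu (s * t))" using D(2) by (simp cong: measurable_cong_sets)
  obtain C where C: "AE x in mu (s * t). \<bar>x\<bar> \<le> C" using D(4) by blast
  show "mu' t = ?N"
  proof (rule moment_determinate)
    show "real_distribution (mu' t)"
      using mu'(1,2)[OF t] by (simp add: real_distribution_def real_distribution_axioms_def)
    show "real_distribution ?N"
      using prob_space.prob_space_distr[OF D(1) f] by (simp add: real_distribution_def real_distribution_axioms_def)
    show "finite_moments (mu' t)" by (rule mu'(3)[OF t])
    show "finite_moments ?N" by (rule finite_moments_distr_affine[OF D(3,2)])
    have "AE x in mu (s * t). \<bar>c * x + k * t\<bar> \<le> \<bar>c\<bar> * C + \<bar>k * t\<bar>"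
      using C
    proof eventually_elim
      case (elim x)
      have "\<bar>c * x + k * t\<bar> \<le> \<bar>c\<bar> * \<bar>x\<bar> + \<bar>k * t\<bar>" by (metis abs_mult abs_triangle_ineq)
      also have "\<dots> \<le> \<bar>c\<bar> * C + \<bar>k * t\<bar>" using elim by (intro add_mono mult_left_mono) auto
      finally show ?case .
    qed
    then show "AE x in ?N. \<bar>x\<bar> \<le> \<bar>c\<bar> * C + \<bar>k * t\<bar>" by (subst AE_distr_iff) auto
    show "moment (mu' t) n = moment ?N n" for n
    proof (rule moment_eqI)
      show "finite_moments (mu' t)" "finite_moments ?N" by fact+
      show "\<exists>q. degree q = n \<and> lead_coeff q = 1 \<and> (\<forall>x. meixner_poly e' d' r' v' n x t = poly q x)" for n
        by (rule meixner_poly_monic)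
      fix n
      have "(\<integral>x. meixner_poly e' d' r' v' n x t \<partial>?N) = (\<integral>x. meixner_poly e' d' r' v' n (?f x) t \<partial>mu (s * t))"
        by (rule integral_distr[OF f]) simp
      also have "\<dots> = (\<integral>x. c ^ n * meixner_poly e d r v n x (s * t) \<partial>mu (s * t))"
        using meixner_poly_affine[OF c, of n e d r v "?f _" k t s] c unfolding par r' by simp
      also have "\<dots> = (if n = 0 then 1 else 0)" using D(5) by simp
      finally show "(\<integral>x. meixner_poly e' d' r' v' n x t \<partial>mu' t) = (\<integral>x. meixner_poly e' d' r' v' n x t \<partial>?N)"
        using int[OF t] by simp
    qed
  qed
qed

section \<open>From an arbitrary free Meixner system to its parameters\<close>

lemma monic_OPS_D:
  assumes "monic_OPS M p"
  shows "\<exists>q :: real poly. degree q = n \<and> lead_coeff q = 1 \<and> (\<forall>x. p n x = poly q x)"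
    and "m \<noteq> n \<Longrightarrow> (\<integral>x. p m x * p n x \<partial>M) = 0"
  using assms by (auto simp: monic_OPS_def)

lemma monic_OPS_0: "monic_OPS M p \<Longrightarrow> p 0 x = 1"
  using monic_OPS_D(1)[of M p 0] by (auto elim!: degree_eq_zeroE)

lemma monic_OPS_1: "monic_OPS M p \<Longrightarrow> \<exists>c. \<forall>x. p (Suc 0) x = x - c"
proof -
  assume "monic_OPS M p"
  then obtain q where q: "degree q = Suc 0" "lead_coeff q = 1" "\<And>x. p (Suc 0) x = poly q x"
    using monic_OPS_D(1) by blast
  then have "poly q x = x - (- coeff q 0)" for x by (simp add: poly_altdef)
  with q show ?thesis by metis
qed

lemma integrable_monic_OPS:
  assumes "finite_moments M" "monic_OPS M p"
  shows "integrable M (p n)" "integrable M (\<lambda>x. p m x * p n x)" "integrable M (\<lambda>x. x * p m x * p n x)"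
    "integrable M (\<lambda>x. x * p n x)"
proof -
  obtain q where q: "\<And>x. p n x = poly q x" using monic_OPS_D(1)[OF assms(2)] by metis
  obtain r where r: "\<And>x. p m x = poly r x" using monic_OPS_D(1)[OF assms(2)] by metis
  show "integrable M (p n)"
    using integrable_poly[OF assms(1), of q] by (simp add: q[abs_def])
  show "integrable M (\<lambda>x. p m x * p n x)" unfolding q r
    using integrable_poly[OF assms(1), of "r * q"] by simp
  show "integrable M (\<lambda>x. x * p m x * p n x)" unfolding q r
    using integrable_poly[OF assms(1), of "[:0, 1:] * r * q"] by (simp add: mult.assoc)
  show "integrable M (\<lambda>x. x * p n x)" unfolding q
    using integrable_poly[OF assms(1), of "[:0, 1:] * q"] by simp
qed

text \<open>Multiplying the generating identity by w = z / u makes it linear in z; the coefficient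
  of z^(n+1) is the claim.\<close>

lemma gen_free_sheffer_recurrence:
  fixes p :: "nat \<Rightarrow> real"
  assumes u: "P01 u" and p0: "p 0 = 1"
    and gen: "Abs_fps p = inverse (1 + fps_const t * u * \<rho> - fps_const x * u)"
    and w: "u * w = fps_X"
  shows "x * p n = (\<Sum>k\<le>n. w $ k * p (Suc n - k)) + t * (\<Sum>k\<le>n. \<rho> $ k * p (n - k))"
proof -
  let ?F = "Abs_fps p"
  let ?B = "1 + fps_const t * u * \<rho> - fps_const x * u"
  have "?B $ 0 \<noteq> 0" using u by (simp add: P01_def)
  then have "?F * ?B = 1" unfolding gen by (rule inverse_mult_eq_1)
  then have "?F * ?B * w = w" by simp
  moreover have "?F * ?B * w = w * ?F + fps_const t * ((u * w) * (\<rho> * ?F)) - fps_const x * ((u * w) * ?F)"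
    by (simp add: algebra_simps)
  ultimately have "w * ?F + fps_const t * (fps_X * (\<rho> * ?F)) = fps_const x * (fps_X * ?F) + w"
    unfolding w by (simp add: algebra_simps)
  then have "(w * ?F + fps_const t * (fps_X * (\<rho> * ?F))) $ Suc n = (fps_const x * (fps_X * ?F) + w) $ Suc n"
    by simp
  then have "(w * ?F) $ Suc n + t * (\<rho> * ?F) $ n = x * p n + w $ Suc n" by simp
  \<comment> \<open>The last convolution term \<open>w $ Suc n * p 0\<close> cancels the stray w on
    the other side.\<close>
  moreover have "(w * ?F) $ Suc n = (\<Sum>k\<le>n. w $ k * p (Suc n - k)) + w $ Suc n"
    using p0 by (simp add: fps_mult_nth flip: atMost_atLeast0)
  moreover have "(\<rho> * ?F) $ n = (\<Sum>k\<le>n. \<rho> $ k * p (n - k))"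
    by (simp add: fps_mult_nth atMost_atLeast0)
  ultimately show ?thesis by simp
qed

lemma monic_OPS_variance:
  assumes M: "prob_space M" "finite_moments M" and p: "monic_OPS M p"
  shows "(\<integral>x. (p (Suc 0) x)\<^sup>2 \<partial>M) = variance_of M"
proof -
  obtain c where c: "\<And>x. p (Suc 0) x = x - c" using monic_OPS_1[OF p] by blast
  have "(\<integral>x. p 0 x * p (Suc 0) x \<partial>M) = 0" by (rule monic_OPS_D(2)[OF p]) simp
  then have "(\<integral>x. x - c \<partial>M) = 0" using c monic_OPS_0[OF p] by simp
  then have "moment M 1 = c"
    using integrable_ident[OF M(2)] prob_space_integral_const[OF M(1), of c]
      finite_measure.integrable_const[OF prob_space.finite_measure[OF M(1)], of c]
    by (simp add: moment_def)
  then show ?thesis using integral_square_diff_const[OF M, of c]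
    by (simp add: c variance_of_def power2_eq_square)
qed

text \<open>Comparing coefficients in the generating function expresses x P n through P (n+1), ..., P 0;
  orthogonality of x P n to P 0 kills the higher coefficients of \<rho> = R o u, and orthogonality
  to P 1 those of w = z / u. Only P 0 and P 1 are used, so no norm can degenerate.\<close>
lemma sheffer_monic_OPS_coeffs:
  assumes M: "prob_space M" "finite_moments M" and p: "monic_OPS M p"
    and var: "variance_of M \<noteq> 0"
    and u: "P01 u" and w: "u * w = fps_X"
    and gen: "\<And>x. Abs_fps (\<lambda>n. p n x) = inverse (1 + u * \<rho> - fps_const x * u)"
  shows "n \<ge> 2 \<Longrightarrow> \<rho> $ n = 0" "n \<ge> 3 \<Longrightarrow> w $ n = 0"
proof -
  note p0 = monic_OPS_0[OF p]
  note orth = monic_OPS_D(2)[OF p]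
  note i [simp] = integrable_monic_OPS[OF M(2) p]
  obtain c where c: "\<And>x. p (Suc 0) x = x - c" using monic_OPS_1[OF p] by blast
  have w0: "w $ 0 = 1"
  proof -
    have "(u * w) $ 1 = u $ 1 * w $ 0" using u by (simp add: P01_def fps_mult_nth)
    then show ?thesis using w u by (simp add: P01_def)
  qed
  have rec: "x * p n x = (\<Sum>k\<le>n. w $ k * p (Suc n - k) x) + (\<Sum>k\<le>n. \<rho> $ k * p (n - k) x)" for n x
    using gen_free_sheffer_recurrence[OF u, of "\<lambda>n. p n x" 1 \<rho> x w n] p0 gen w by simp
  have L0: "(\<integral>x. p n x \<partial>M) = (if n = 0 then 1 else 0)" for n
    using orth[of 0 n] p0 prob_space_integral_const[OF M(1), of 1] by (cases n) auto
  have "(\<integral>x. x * p n x \<partial>M) = \<rho> $ n" for n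
  proof -
    have "(\<integral>x. x * p n x \<partial>M) = (\<Sum>k\<le>n. w $ k * (\<integral>x. p (Suc n - k) x \<partial>M)) + (\<Sum>k\<le>n. \<rho> $ k * (\<integral>x. p (n - k) x \<partial>M))"
      unfolding rec by simp
    also have "(\<Sum>k\<le>n. w $ k * (\<integral>x. p (Suc n - k) x \<partial>M)) = 0"
      unfolding L0 by (intro sum.neutral) auto
    also have "(\<Sum>k\<le>n. \<rho> $ k * (\<integral>x. p (n - k) x \<partial>M)) = (\<Sum>k\<le>n. if k = n then \<rho> $ n else 0)"
      unfolding L0 by (intro sum.cong) auto
    finally show ?thesis by simp
  qed
  moreover have "(\<integral>x. x * p n x \<partial>M) = 0" if "n \<ge> 2" for n
  proof -
    have "x * p n x = p (Suc 0) x * p n x + c * p n x" for x unfolding c by (simp add: algebra_simps)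
    then have "(\<integral>x. x * p n x \<partial>M) = (\<integral>x. p (Suc 0) x * p n x \<partial>M) + c * (\<integral>x. p n x \<partial>M)" by simp
    then show ?thesis using orth[of "Suc 0" n] L0[of n] that by simp
  qed
  ultimately show \<rho>: "\<rho> $ n = 0" if "n \<ge> 2" for n using that by metis
  define c1 where "c1 = (\<integral>x. p (Suc 0) x * p (Suc 0) x \<partial>M)"
  have c1: "c1 \<noteq> 0" using monic_OPS_variance[OF M p] var by (simp add: c1_def power2_eq_square)
  have L1: "(\<integral>x. p n x * p (Suc 0) x \<partial>M) = (if n = Suc 0 then c1 else 0)" for n
    using orth[of n "Suc 0"] by (auto simp: c1_def)
  show "w $ n = 0" if n: "n \<ge> 3"
  proof -
    have "(\<integral>x. x * p n x * p (Suc 0) x \<partial>M)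
      = (\<Sum>k\<le>n. w $ k * (\<integral>x. p (Suc n - k) x * p (Suc 0) x \<partial>M)) + (\<Sum>k\<le>n. \<rho> $ k * (\<integral>x. p (n - k) x * p (Suc 0) x \<partial>M))"
      unfolding rec by (simp add: distrib_right sum_distrib_right mult.assoc)
    also have "(\<Sum>k\<le>n. w $ k * (\<integral>x. p (Suc n - k) x * p (Suc 0) x \<partial>M)) = (\<Sum>k\<le>n. if k = n then w $ n * c1 else 0)"
      unfolding L1 by (intro sum.cong) auto
    also have "(\<Sum>k\<le>n. \<rho> $ k * (\<integral>x. p (n - k) x * p (Suc 0) x \<partial>M)) = 0"
    \<comment> \<open>Only k = n - 1 could contribute, and n \<ge> 3 makes this index at least 2,
      where \<rho> already vanishes.\<close>
    proof (intro sum.neutral ballI)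
      fix k assume "k \<in> {..n}"
      then show "\<rho> $ k * (\<integral>x. p (n - k) x * p (Suc 0) x \<partial>M) = 0"
        unfolding L1 using \<rho>[of k] n by (cases "n - k = Suc 0") auto
    qed
    finally have 1: "(\<integral>x. x * p n x * p (Suc 0) x \<partial>M) = w $ n * c1" by simp
    have e: "x * p (Suc 0) x = p (Suc (Suc 0)) x + (w $ 1 + \<rho> $ 0) * p (Suc 0) x + \<rho> $ 1 * p 0 x" for x
      unfolding rec by (simp add: w0 algebra_simps)
    have "x * p n x * p (Suc 0) x = p n x * p (Suc (Suc 0)) x + (w $ 1 + \<rho> $ 0) * (p n x * p (Suc 0) x)
        + \<rho> $ 1 * (p n x * p 0 x)" for x
      using e[of x] by algebra
    then have "(\<integral>x. x * p n x * p (Suc 0) x \<partial>M) = (\<integral>x. p n x * p (Suc (Suc 0)) x \<partial>M)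
       + (w $ 1 + \<rho> $ 0) * (\<integral>x. p n x * p (Suc 0) x \<partial>M) + \<rho> $ 1 * (\<integral>x. p n x * p 0 x \<partial>M)" by simp
    also have "\<dots> = 0" using orth n by simp
    finally show ?thesis using 1 c1 by simp
  qed
qed

text \<open>At t = 0 the measure is the point mass at 0, so P n vanishes at (0, 0) for n > 0 and the
  generating function there, v / u, equals 1.\<close>
lemma free_meixner_diag:
  assumes "free_meixner mu P"
  obtains u where "P01 u"
    "\<And>t x. t \<ge> 0 \<Longrightarrow> Abs_fps (\<lambda>n. P n x t) = inverse (1 + fps_const t * u * (R_transform (mu 1) oo u) - fps_const x * u)"
proof -
  obtain u v where u: "P01 u" and v: "P01 v" and
    gen: "\<And>t x. t \<ge> 0 \<Longrightarrow> Abs_fps (\<lambda>n. P n x t) = inverse (sheffer_denom u v (R_transform (mu 1)) t x)"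
    using assms by (auto simp: free_meixner_def gen_free_sheffer_def)
  have ops: "monic_OPS (mu 0) (\<lambda>n x. P n x 0)" and mu0: "mu 0 = return borel 0"
    using assms by (auto simp: free_meixner_def free_conv_semigroup_def)
  have P0: "P n 0 0 = (if n = 0 then 1 else 0)" for n
  proof (cases n)
    case 0
    then show ?thesis using monic_OPS_0[OF ops] by simp
  next
    case (Suc m)
    obtain q where q: "\<And>x. P n x 0 = poly q x" using monic_OPS_D(1)[OF ops, of n] by blast
    have "(\<integral>x. P 0 x 0 * P n x 0 \<partial>mu 0) = 0" by (rule monic_OPS_D(2)[OF ops]) (use Suc in simp)
    then have "(\<integral>x. poly q x \<partial>return borel 0) = 0" using monic_OPS_0[OF ops] by (simp add: q mu0)
    then have "poly q 0 = 0"
      by (subst (asm) integral_return) (auto intro!: borel_measurable_continuous_onI continuous_at_imp_continuous_on)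
    then show ?thesis using q Suc by simp
  qed
  have "Abs_fps (\<lambda>n. P n 0 0) = 1" by (intro fps_ext) (simp add: P0)
  then have inv: "inverse (u / v) = 1"
    using gen[of 0 0] by (simp add: sheffer_denom_def)
  have "(u / v) $ 0 \<noteq> 0"
  proof
    assume "(u / v) $ 0 = 0"
    then have "inverse (u / v) $ 0 = 0" by simp
    then show False unfolding inv by simp
  qed
  then have "u / v = 1" using inverse_mult_eq_1[of "u / v"] inv by simp
  \<comment> \<open>The quotient of power series discards a remainder, so u / v = 1 gives u = v only
    together with divisibility.\<close>
  moreover have "v dvd u"
  proof -
    have "subdegree u = 1" "subdegree v = 1" using u v by (auto intro!: subdegreeI simp: P01_def)
    then show ?thesis using P01_nonzero[OF u] P01_nonzero[OF v] by (simp add: fps_dvd_iff)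
  qed
  ultimately have "u = v" by (metis dvd_div_mult_self mult_1)
  with that[OF u] gen sheffer_denom_diag[OF u] show ?thesis by simp
qed

lemma free_meixner_classification:
  assumes "nontrivial_free_meixner mu P"
  obtains e d r v where "v > 0" "d \<ge> 0"
    "\<And>n x t. t \<ge> 0 \<Longrightarrow> P n x t = meixner_poly e d r v n x t"
    "\<And>n t. t \<ge> 0 \<Longrightarrow> (\<integral>x. meixner_poly e d r v n x t \<partial>mu t) = (if n = 0 then 1 else 0)"
proof -
  have fmx: "free_meixner mu P" and var: "variance_of (mu 1) \<noteq> 0"
    using assms by (auto simp: nontrivial_free_meixner_def)
  have M: "prob_space (mu t)" "finite_moments (mu t)" and ops: "monic_OPS (mu t) (\<lambda>n x. P n x t)"
    if "t \<ge> 0" for t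
    using fmx that by (auto simp: free_meixner_def free_conv_semigroup_def)
  define R where "R = R_transform (mu 1)"
  obtain u where u: "P01 u" and
    gen: "\<And>t x. t \<ge> 0 \<Longrightarrow> Abs_fps (\<lambda>n. P n x t) = inverse (1 + fps_const t * u * (R oo u) - fps_const x * u)"
    using free_meixner_diag[OF fmx] unfolding R_def by blast
  define w where "w = inverse (fps_shift 1 u)"
  define \<rho> where "\<rho> = R oo u"
  have us: "u = fps_X * fps_shift 1 u"
    using u by (intro fps_ext) (simp add: P01_def fps_X_mult_nth)
  have s0: "fps_shift 1 u $ 0 \<noteq> 0" using u by (simp add: P01_def)
  have uw: "u * w = fps_X"
    by (subst us) (use s0 in \<open>simp add: w_def mult.assoc inverse_mult_eq_1'\<close>)
  \<comment> \<open>Since u and R do not depend on time, the single time t = 1 pins down all the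
    coefficients.\<close>
  have gen1: "Abs_fps (\<lambda>n. P n x 1) = inverse (1 + u * \<rho> - fps_const x * u)" for x
    using gen[of 1 x] by (simp add: \<rho>_def)
  note coeffs = sheffer_monic_OPS_coeffs[OF M ops var u uw gen1, simplified]
  define e d r v where "e = w $ 1" and "d = w $ 2" and "r = \<rho> $ 0" and "v = \<rho> $ 1"
  have \<rho>_eq: "\<rho> = fps_const r + fps_const v * fps_X"
  proof (rule fps_ext)
    fix n show "\<rho> $ n = (fps_const r + fps_const v * fps_X) $ n"
      using coeffs(1)[of n] by (cases "n = 0"; cases "n = 1") (auto simp: r_def v_def)
  qed
  have w0: "w $ 0 = 1" using u by (simp add: w_def P01_def)
  have w_eq: "w = 1 + fps_const e * fps_X + fps_const d * fps_X ^ 2"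
  proof (rule fps_ext)
    fix n :: nat
    consider "n = 0" | "n = 1" | "n = 2" | "n \<ge> 3" by linarith
    then show "w $ n = (1 + fps_const e * fps_X + fps_const d * fps_X ^ 2) $ n"
      by cases (use coeffs(2)[of n] w0 in \<open>auto simp: e_def d_def fps_X_power_nth\<close>)
  qed
  have "w \<noteq> 0" using w0 by auto
  have u_eq: "u = meixner_u e d"
    using uw meixner_u_mult[of e d] \<open>w \<noteq> 0\<close> unfolding w_eq by (metis mult_right_cancel)
  have P: "P n x t = meixner_poly e d r v n x t" if "t \<ge> 0" for n x t
  proof -
    have "R oo meixner_u e d = fps_const r + fps_const v * fps_X"
      using \<rho>_eq by (simp add: \<rho>_def u_eq)
    from meixner_poly_gen[OF this, of x t] gen[OF that, of x]
    have "Abs_fps (\<lambda>n. P n x t) = Abs_fps (\<lambda>n. meixner_poly e d r v n x t)" by (simp add: u_eq)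
    then show ?thesis by (metis fps_nth_Abs_fps)
  qed
  have int: "(\<integral>x. meixner_poly e d r v n x t \<partial>mu t) = (if n = 0 then 1 else 0)" if "t \<ge> 0" for n t
  proof (cases n)
    case 0
    then show ?thesis using prob_space_integral_const[OF M(1)[OF that], of 1] by simp
  next
    case (Suc m)
    have "(\<integral>x. P 0 x t * P n x t \<partial>mu t) = 0"
      using monic_OPS_D(2)[OF ops[OF that], of 0 n] Suc by simp
    then show ?thesis using Suc by (simp add: P[OF that])
  qed
  have "v = variance_of (mu 1)"
    using variance_of_meixner[OF M int, of 1] by simp
  moreover have "variance_of (mu 1) \<ge> 0"
    by (subst monic_OPS_variance[OF M ops, symmetric]) simp_all
  ultimately have v: "v > 0" using var by simp
  \<comment> \<open>The squared norm of P 2 is nonnegative; letting t be small excludes d < 0, for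
    instance t = - d / (2 v) would give d + v t = d / 2.\<close>
  have dvt: "d + v * t \<ge> 0" if "t > 0" for t
  proof -
    have "0 \<le> (\<integral>x. (meixner_poly e d r v (Suc (Suc 0)) x t)\<^sup>2 \<partial>mu t)" by (rule Bochner_Integration.integral_nonneg) simp
    then have "0 \<le> (d + v * t) * (v * t)"
      using integral_meixner_poly_sq(2)[OF M(2) int, of t] that by (simp del: meixner_poly.simps)
    moreover have "v * t > 0" using v that by simp
    ultimately show ?thesis by (simp only: zero_le_mult_iff) linarith
  qed
  have "d \<ge> 0"
  proof (rule ccontr)
    assume "\<not> d \<ge> 0"
    then have "- d / (2 * v) > 0" using v by (intro divide_pos_pos) auto
    from dvt[OF this] \<open>\<not> d \<ge> 0\<close> show False using v by simp
  qed
  from that[OF v this P int] show ?thesis .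
qed

lemma free_meixner_equiv:
  assumes "nontrivial_free_meixner mu P"
  shows "affine_time_equiv mu_semi P_semi mu P \<or> affine_time_equiv mu_poi P_poi mu P \<or>
    (\<exists>a\<ge>0. affine_time_equiv (mu3 a) (P3 a) mu P)"
proof -
  obtain e d r v where v: "v > 0" and d: "d \<ge> 0"
    and P: "\<And>n x t. t \<ge> 0 \<Longrightarrow> P n x t = meixner_poly e d r v n x t"
    and int: "\<And>n t. t \<ge> 0 \<Longrightarrow> (\<integral>x. meixner_poly e d r v n x t \<partial>mu t) = (if n = 0 then 1 else 0)"
    by (rule free_meixner_classification[OF assms]) (rule that; assumption)
  have mu: "prob_space (mu t)" "sets (mu t) = sets borel" "finite_moments (mu t)" if "t \<ge> 0" for t
    using assms that by (auto simp: nontrivial_free_meixner_def free_meixner_def free_conv_semigroup_def)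
  note equivI = affine_time_equivI[OF _ _ _ _ mu P int]
  consider "d = 0" "e = 0" | "d = 0" "e \<noteq> 0" | "d > 0" using d by linarith
  then show ?thesis
  proof cases
    case 1
    have "affine_time_equiv mu_semi P_semi mu P"
      by (rule equivI[where c = 1 and s = v, OF meixner_measure_semi P_semi_eq]) (use v 1 in auto)
    then show ?thesis by blast
  next
    case 2
    \<comment> \<open>The model has e = 1, so the dilation must be c = e; it may be negative, a
      reflection.\<close>
    have "affine_time_equiv mu_poi P_poi mu P"
      by (rule equivI[where c = e and s = "v / e\<^sup>2", OF meixner_measure_poi P_poi_eq]) (use v 2 in auto)
    then show ?thesis by blast
  next
    case 3
    \<comment> \<open>The model has d = 1, so c^2 = d; the sign of c follows that of e to make a = e
      / (2 c) nonnegative.\<close>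
    define c where "c = (if e \<ge> 0 then sqrt d else - sqrt d)"
    define a where "a = e / (2 * c)"
    have c: "c \<noteq> 0" "c\<^sup>2 = d" using 3 by (auto simp: c_def)
    have a: "a \<ge> 0" using 3 by (auto simp: a_def c_def divide_nonpos_pos)
    have "affine_time_equiv (mu3 a) (P3 a) mu P"
      by (rule equivI[where c = c and s = "v / c\<^sup>2", OF meixner_measure_mu3[OF _ a] P3_eq])
         (use v c in \<open>auto simp: a_def\<close>)
    with a show ?thesis by blast
  qed
qed

theorem theorem3p3:
  shows
  \<comment> \<open>Semicircular / Chebyshev\<close>
  "listed_props mu_semi P_semi u_semi R_semi \<and>
   (\<forall>n x t. t \<ge> 0 \<longrightarrow> P_semi n x t = chebU2 n x t) \<and>
   \<comment> \<open>Free Poisson / Charlier\<close>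
   listed_props mu_poi P_poi u_poi R_poi \<and>
   (\<forall>n x t. t \<ge> 0 \<longrightarrow> n \<ge> 1 \<longrightarrow> P_poi n x t = Q_poi n x t + Q_poi (n - 1) x t) \<and>
   \<comment> \<open>the three cases with parameter a\<close>
   (\<forall>a::real. a \<ge> 0 \<longrightarrow>
      listed_props (mu3 a) (P3 a) (u3 a) (R3 a) \<and>
      (\<forall>x t. t \<ge> 0 \<longrightarrow> P3 a 1 x t = Q3 a 1 x t + 2 * a * Q3 a 0 x t) \<and>
      (\<forall>n x t. t \<ge> 0 \<longrightarrow> n \<ge> 2 \<longrightarrow>
         P3 a n x t = Q3 a n x t + 2 * a * Q3 a (n - 1) x t + Q3 a (n - 2) x t)) \<and>
   \<comment> \<open>every non-trivial free Meixner system is one of these up to the transformations\<close>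
   (\<forall>mu P. nontrivial_free_meixner mu P \<longrightarrow>
      affine_time_equiv mu_semi P_semi mu P \<or>
      affine_time_equiv mu_poi P_poi mu P \<or>
      (\<exists>a\<ge>0. affine_time_equiv (mu3 a) (P3 a) mu P))"
proof (intro conjI allI impI)
  show "listed_props mu_semi P_semi u_semi R_semi"
    unfolding u_semi_eq
    by (rule listed_propsI[OF meixner_measure_semi _ P_semi_eq R_semi_comp])
       (simp_all add: mu_semi_def semicircle_def)
  show "P_semi n x t = chebU2 n x t" if "t \<ge> 0" for n x t
    using that by (induction n x t rule: P_semi.induct) (simp_all add: chebU2_Suc_Suc)
  show "listed_props mu_poi P_poi u_poi R_poi"
    unfolding u_poi_eq by (rule listed_propsI[OF meixner_measure_poi mu_poi_0 P_poi_eq R_poi_comp]) simp_all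
  show "P_poi n x t = Q_poi n x t + Q_poi (n - 1) x t" if t: "t \<ge> 0" and n: "n \<ge> 1" for n x t
  proof (cases "n = 1")
    case True
    then show ?thesis using t by (simp add: Q_poi_def)
  next
    case False
    with n have "n = Suc (Suc (n - 2))" by simp
    then obtain m where "n = Suc (Suc m)" ..
    then show ?thesis
      using t meixner_poly_eq_chebU2[of 0 1 t 1 1 m x] by (simp only: P_poi_eq Q_poi_def) (simp add: add.commute)
  qed
  fix a :: real assume a: "a \<ge> 0"
  show "listed_props (mu3 a) (P3 a) (u3 a) (R3 a)"
    unfolding u3_eq
    by (rule listed_propsI[OF meixner_measure_mu3[OF _ a] mu3_0 P3_eq R3_comp]) simp_all
  show "P3 a 1 x t = Q3 a 1 x t + 2 * a * Q3 a 0 x t" if "t \<ge> 0" for x t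
    using that by (simp add: Q3_def alpha3_def beta3_def algebra_simps)
  show "P3 a n x t = Q3 a n x t + 2 * a * Q3 a (n - 1) x t + Q3 a (n - 2) x t" if t: "t \<ge> 0" and n: "n \<ge> 2" for n x t
  proof -
    have "n = Suc (Suc (n - 2))" using n by simp
    then obtain m where m: "n = Suc (Suc m)" ..
    have e: "alpha3 a t = 2 * a + a * t" "beta3 t = 1 + 1 * t" by (simp_all add: alpha3_def beta3_def algebra_simps)
    show ?thesis
      unfolding P3_eq Q3_def e m using t meixner_poly_eq_chebU2[of 1 1 t "2 * a" a m x] by simp
  qed
next
  fix mu P assume "nontrivial_free_meixner mu P"
  then show "affine_time_equiv mu_semi P_semi mu P \<or> affine_time_equiv mu_poi P_poi mu P \<or>
    (\<exists>a\<ge>0. affine_time_equiv (mu3 a) (P3 a) mu P)" by (rule free_meixner_equiv)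
qed

end
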